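(* Up to graph isomorphism, there exist exactly three polyhedral graphs $G$ such that the complement graph $\overline{G}$ is also polyhedral. Each of these three graphs is self-complementary, i.e. isomorphic to its complement.
   Context: All graphs are finite and simple. A graph is polyhedral if it is planar and $3$-connected, where a graph of order at least $4$ is $3$-connected if removing any set of $0$, $1$ or $2$ vertices leaves a connected graph. The complement $\overline{G}$ of $G$ has the same vertex set as $G$, two distinct vertices being adjacent in $\overline{G}$ if and only if they are not adjacent in $G$. *)

theory Defs
  imports
    "HOL-Analysis.Analysis"
    "Graph_Theory.Pair_Digraph"
    "Graph_Theory.Digraph_Component"
    "Graph_Theory.Digraph_Isomorphism"
begin

text \<open>
  A finite simple graph is a \<^locale>\<open>pair_graph\<close>: a finite loop-free digraph without parallel arcs
  whose arc relation is symmetric, so that the edge joining \<open>u\<close> and \<open>v\<close> is the pair of arcs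
  \<open>(u, v)\<close>, \<open>(v, u)\<close>.
\<close>

definition complement_graph :: "'a pair_pre_digraph \<Rightarrow> 'a pair_pre_digraph" where
  "complement_graph G =
    \<lparr> pverts = pverts G,
      parcs = {(u, v). u \<in> pverts G \<and> v \<in> pverts G \<and> u \<noteq> v \<and> (u, v) \<notin> parcs G} \<rparr>"

text \<open>
  The plane is \<^typ>\<open>complex\<close>. Curves are indexed by the unordered pair \<open>{u, v}\<close>, so the two arcs of
  an edge share one curve, whose orientation is irrelevant.
\<close>

definition plane_embedding ::
    "'a pair_pre_digraph \<Rightarrow> ('a \<Rightarrow> complex) \<Rightarrow> ('a set \<Rightarrow> real \<Rightarrow> complex) \<Rightarrow> bool" where
  "plane_embedding G p \<gamma> \<longleftrightarrow>
    inj_on p (pverts G) \<and>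
    (\<forall>(u, v) \<in> parcs G.
      Path_Connected.arc (\<gamma> {u, v}) \<and>
      {pathstart (\<gamma> {u, v}), pathfinish (\<gamma> {u, v})} = {p u, p v} \<and>
      path_image (\<gamma> {u, v}) \<inter> p ` pverts G = {p u, p v}) \<and>
    (\<forall>(u, v) \<in> parcs G. \<forall>(x, y) \<in> parcs G. {u, v} \<noteq> {x, y} \<longrightarrow>
      path_image (\<gamma> {u, v}) \<inter> path_image (\<gamma> {x, y}) \<subseteq> p ` ({u, v} \<inter> {x, y}))"

definition planar :: "'a pair_pre_digraph \<Rightarrow> bool" where
  "planar G \<longleftrightarrow> (\<exists>p \<gamma>. plane_embedding G p \<gamma>)"

text \<open>The unqualified name \<open>connected\<close> would be ambiguous with topological connectedness.\<close>

definition three_connected :: "'a pair_pre_digraph \<Rightarrow> bool" where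
  "three_connected G \<longleftrightarrow>
    4 \<le> card (pverts G) \<and>
    (\<forall>S \<subseteq> pverts G. card S \<le> 2 \<longrightarrow>
      Digraph_Component.connected (with_proj G \<restriction> (pverts G - S)))"

definition polyhedral :: "'a pair_pre_digraph \<Rightarrow> bool" where
  "polyhedral G \<longleftrightarrow> pair_graph G \<and> planar G \<and> three_connected G"

end

theory Submission
  imports Defs
begin

text \<open>
  If two chords of a cycle in a plane graph have interleaving ends, then one of them runs inside and the
  other outside the cycle. The theta-curve theorem excludes that both run inside, and an inversion centred
  at a point inside the cycle reduces the case that both run outside to it. Hence a subdivided \<open>K\<^sub>5\<close>
  or \<open>K\<^sub>3\<^sub>,\<^sub>3\<close> is not planar.

  Colour the edges of \<open>G\<close> red and those of its complement blue. Among any nine vertices there is either a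
  vertex with four red and four blue neighbours, or there are five vertices with at most three
  neighbours of the same colour. In both cases the clauses ``this subdivided Kuratowski graph is not
  monochromatic'', with the remaining symmetry broken by sorting, are propositionally unsatisfiable.
  So there are at most eight vertices. Since all degrees in \<open>G\<close> and in its complement are at least \<open>3\<close>,
  there are at least seven, and seven is impossible by parity. On eight vertices the same kind of
  clauses, together with those excluding separating pairs of vertices, leave only three graphs, which
  are drawn with straight edges and told apart by their numbers of pairs with two common neighbours.
\<close>

section \<open>Chords of a simple closed curve\<close>

text \<open>Planarity enters through a single consequence: every chord of a cycle has a side, and
  interleaving chords have different sides. A forbidden graph is then an odd cycle in the
  interleaving relation of its chords. Only subdivisions whose subdivided edges all lie on one cycle
  through the branch vertices are considered. This is enough because nothing like the converse
  direction of Kuratowski's theorem is required: the clauses have to be true and jointly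
  contradictory, they need not be complete. The obstacle is symmetry. The dichotomy on nine vertices
  is chosen so that it distinguishes a few vertices and leaves only the freedom to permute two
  groups of four. One group is normalised by its inner edges, the other by its columns of colours
  against the vertices fixed before, and the two choices do not interfere. On eight vertices the red
  and the blue degree of a vertex add up to 7, so one of them is exactly 3. That this may happen in
  the wrong colour is harmless, since all three solutions are self-complementary.\<close>

text \<open>The chord \<open>c\<close> cuts the inside of the closed curve into two regions, one
  bounded by \<open>c1\<close> and \<open>c\<close>, the other by \<open>c2\<close> and
  \<open>c\<close>. The open arc \<open>d\<close> is connected and avoids \<open>c\<close>, so it
  stays in one region; but one of its ends lies on the opposite part of the curve, away from the
  closure of that region.\<close>

lemma theta_inside:
  fixes c :: "real \<Rightarrow> complex"
  assumes c1: "Path_Connected.arc c1" "pathstart c1 = a" "pathfinish c1 = b"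
      and c2: "Path_Connected.arc c2" "pathstart c2 = a" "pathfinish c2 = b"
      and c: "Path_Connected.arc c" "pathstart c = a" "pathfinish c = b"
      and c1c2: "path_image c1 \<inter> path_image c2 = {a,b}"
      and c1c: "path_image c1 \<inter> path_image c = {a,b}"
      and c2c: "path_image c2 \<inter> path_image c = {a,b}"
      and d: "Path_Connected.arc d" "pathstart d = q" "pathfinish d = s"
      and qs: "q \<in> path_image c1 - {a,b}" "s \<in> path_image c2 - {a,b}"
      and dc: "path_image d \<inter> path_image c = {}"
      and c_in: "path_image c - {a,b} \<subseteq> inside (path_image c1 \<union> path_image c2)"
      and d_in: "path_image d - {q,s} \<subseteq> inside (path_image c1 \<union> path_image c2)"
    shows False
proof -
  let ?I1 = "inside (path_image c1 \<union> path_image c)" and ?I2 = "inside (path_image c2 \<union> path_image c)"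
  let ?C = "path_image c1 \<union> path_image c2"
  have ab: "a \<noteq> b" using c1 arc_distinct_ends by metis
  have qs': "q \<noteq> s" using qs c1c2 by auto
  have sp: "simple_path c1" "simple_path c2" "simple_path c" "simple_path d"
    using c1 c2 c d by (simp_all add: arc_imp_simple_path)
  have "path_image c - {a,b} \<noteq> {}"
    using nonempty_simple_path_endless[OF sp(3)] c by simp
  then have ne: "path_image c \<inter> inside ?C \<noteq> {}" using c_in by blast
  have split1: "?I1 \<inter> ?I2 = {}" and split2: "?I1 \<union> ?I2 \<union> (path_image c - {a,b}) = inside ?C"
    using split_inside_simple_closed_curve[OF sp(1) c1(2,3) sp(2) c2(2,3) sp(3) c(2,3) ab c1c2 c1c c2c ne]
    by blast+
  have cl: "closed (path_image c1 \<union> path_image c)" "closed (path_image c2 \<union> path_image c)"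
    using sp by (simp_all add: closed_Un closed_simple_path_image)
  then have op: "open ?I1" "open ?I2" by (simp_all add: open_inside)
  let ?D = "path_image d - {q,s}"
  have con: "Topological_Spaces.connected ?D" using connected_simple_path_endless[OF sp(4)] d by simp
  have Dne: "?D \<noteq> {}" using nonempty_simple_path_endless[OF sp(4)] d by simp
  have Dsub: "?D \<subseteq> ?I1 \<union> ?I2" using d_in split2 dc by blast
  \<comment> \<open>An end outside the closure of \<open>?D\<close> would belong to a finite, hence
    closed, relatively open part of the connected image; this part would be everything, leaving
    \<open>?D\<close> empty.\<close>
  have closD: "{q,s} \<subseteq> closure ?D"
  proof -
    have "closure ?D = path_image d"
    proof -
      have "path_image d - ?D \<subseteq> closure ?D"
      proof (rule ccontr)
        assume "\<not> ?thesis"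
        then obtain x where x: "x \<in> {q,s}" "x \<notin> closure ?D" "x \<in> path_image d" by blast
        have cd: "Topological_Spaces.connected (path_image d)" using d(1) connected_arc_image by blast
        let ?U = "- closure ?D"
        have xd: "path_image d \<inter> ?U \<subseteq> {q,s}" using closure_subset[of ?D] by blast
        have "openin (top_of_set (path_image d)) (path_image d \<inter> ?U)" by (rule openin_open_Int[OF open_Compl[OF closed_closure]])
        moreover have "finite (path_image d \<inter> ?U)" using xd finite_subset by blast
        then have "closedin (top_of_set (path_image d)) (path_image d \<inter> ?U)"
          by (meson Int_lower1 closed_subset finite_imp_closed)
        ultimately have "path_image d \<inter> ?U = {} \<or> path_image d \<inter> ?U = path_image d"
          using cd connected_clopen by blast
        then have "path_image d \<subseteq> {q,s}" using x xd by blast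
        then show False using Dne by blast
      qed
      moreover have "closure ?D \<subseteq> path_image d"
        using closed_simple_path_image[OF sp(4)] by (intro closure_minimal) auto
      moreover have "?D \<subseteq> closure ?D" by (rule closure_subset)
      ultimately show ?thesis by blast
    qed
    then show ?thesis using d by (metis empty_subsetI insert_subset pathfinish_in_path_image pathstart_in_path_image)
  qed
  have notin: "x \<notin> inside ?C" if "x \<in> ?C" for x using that inside_no_overlap by blast
  have clos: "closure (inside S) \<subseteq> S \<union> inside S" if "closed S" for S :: "complex set"
    using closure_inside_subset that by blast
  consider "?D \<subseteq> ?I1" | "?D \<subseteq> ?I2"
  proof -
    have "?I1 \<inter> ?I2 \<inter> ?D = {}" using split1 by blast
    then have "?I1 \<inter> ?D = {} \<or> ?I2 \<inter> ?D = {}" using connectedD[OF con op _ Dsub] by blast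
    then show ?thesis using that Dsub by blast
  qed
  then show False
  proof cases
    case 1
    then have "s \<in> closure ?I1" using closD closure_mono by blast
    then have "s \<in> path_image c1 \<union> path_image c \<union> ?I1" using clos cl by blast
    moreover have "s \<notin> ?I1" using notin[of s] qs split2 by blast
    moreover have "s \<notin> path_image c1" "s \<notin> path_image c" using qs c1c2 c2c by blast+
    ultimately show False by blast
  next
    case 2
    then have "q \<in> closure ?I2" using closD closure_mono by blast
    then have "q \<in> path_image c2 \<union> path_image c \<union> ?I2" using clos cl by blast
    moreover have "q \<notin> ?I2" using notin[of q] qs split2 by blast
    moreover have "q \<notin> path_image c2" "q \<notin> path_image c" using qs c1c2 c1c by blast+
    ultimately show False by blast
  qed
qed

text \<open>The inversion turns the inside of \<open>C\<close> into a set \<open>V\<close> reaching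
  to infinity, so the outside goes into a bounded set \<open>W\<close>. Both sets are open, hence
  the component of \<open>f z\<close> off the image of \<open>C\<close> cannot pass from
  \<open>W\<close> to \<open>V\<close> and is bounded.\<close>

lemma inversion_outside_inside:
  fixes C :: "complex set"
  assumes C: "compact C" and z0: "z0 \<in> inside C" and z: "z \<in> outside C"
  defines "f \<equiv> \<lambda>z. 1 / (z - z0)"
  shows "f z \<in> inside (f ` C)"
proof -
  have z0C: "z0 \<notin> C" using z0 inside_no_overlap by blast
  let ?K = "C \<union> inside C"
  have bd: "bounded ?K" using C by (simp add: bounded_inside compact_imp_bounded)
  have clK: "closed ?K"
  proof -
    have "?K = - outside C" using inside_Un_outside[of C] inside_Int_outside[of C] outside_no_overlap[of C] by blast
    then show ?thesis using open_outside[OF compact_imp_closed[OF C]] by auto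
  qed
  obtain M where M: "M > 0" "\<And>x. x \<in> ?K \<Longrightarrow> norm (x - z0) \<le> M"
  proof -
    obtain e where "\<And>x. x \<in> ?K \<Longrightarrow> norm (x - z0) \<le> e"
      using bd unfolding bounded_any_center[where a=z0] by (metis dist_norm norm_minus_commute)
    then have "norm (x - z0) \<le> max 1 e" if "x \<in> ?K" for x using that by (meson le_max_iff_disj)
    then show ?thesis using that[of "max 1 e"] by simp
  qed
  define V where "V = f ` (inside C - {z0})"
  define g where "g = (\<lambda>w::complex. z0 + 1 / w)"
  have gf: "g (f x) = x" if "x \<noteq> z0" for x using that by (simp add: g_def f_def)
  have fg: "f (g w) = w" if "w \<noteq> 0" for w using that by (simp add: g_def f_def)
  have f0: "f x \<noteq> 0" if "x \<noteq> z0" for x using that by (simp add: f_def)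
  have gz: "g w \<noteq> z0" if "w \<noteq> 0" for w using that by (simp add: g_def)
  have contg: "continuous_on (- {0}) g" unfolding g_def by (intro continuous_intros) auto
  have Veq: "V = (- {0}) \<inter> g -` (inside C)"
    
  proof (intro set_eqI iffI)
    fix w assume "w \<in> V"
    then obtain x where "x \<in> inside C - {z0}" "w = f x" unfolding V_def by blast
    then show "w \<in> (- {0}) \<inter> g -` (inside C)" using gf f0 by simp
  next
    fix w assume "w \<in> (- {0}) \<inter> g -` (inside C)"
    then have "w = f (g w)" "g w \<in> inside C - {z0}" using fg gz by auto
    then show "w \<in> V" unfolding V_def by blast
  qed
  have "open (inside C)" using C by (simp add: open_inside compact_imp_closed)
  then have opV: "open V" unfolding Veq using contg by (intro continuous_open_preimage) auto
  \<comment> \<open>\<open>W\<close> is the image of the outside together with 0, the image of the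
    point at infinity.\<close>
  define W where "W = - (f ` C \<union> V)"
  \<comment> \<open>Since \<open>1 / 0 = 0\<close>, the map \<open>g\<close> sends 0 to
    \<open>z0\<close>, a point inside \<open>C\<close>, so 0 has to be excluded. The condition
    \<open>norm w \<ge> 1 / M\<close> does this on a closed set where \<open>g\<close> is
    continuous, and it loses nothing because \<open>M\<close> bounds the distance of
    \<open>?K\<close> from \<open>z0\<close>.\<close>
  have fKeq: "f ` C \<union> V = {w. norm w \<ge> 1 / M} \<inter> g -` ?K"
  proof -
    have 1: "w \<in> f ` C \<longleftrightarrow> w \<noteq> 0 \<and> g w \<in> C" for w
    proof
      assume "w \<in> f ` C"
      then obtain x where x: "x \<in> C" "w = f x" by blast
      then have "x \<noteq> z0" using z0C by blast
      then show "w \<noteq> 0 \<and> g w \<in> C" using x gf f0 by simp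
    next
      assume "w \<noteq> 0 \<and> g w \<in> C"
      then show "w \<in> f ` C" using fg by (metis imageI)
    qed
    have 2: "norm w \<ge> 1 / M" if "w \<noteq> 0" "g w \<in> ?K" for w
    proof -
      have "norm (1 / w) \<le> M" using M(2)[OF that(2)] by (simp add: g_def)
      then show ?thesis using that M(1) by (simp add: norm_divide field_simps)
    qed
    have 3: "w \<noteq> 0" if "norm w \<ge> 1 / M" for w :: complex using that M(1) by auto
    show ?thesis
    proof (intro set_eqI iffI)
      fix w assume "w \<in> f ` C \<union> V"
      then have "w \<noteq> 0" "g w \<in> ?K" using 1 unfolding Veq by auto
      then show "w \<in> {w. norm w \<ge> 1 / M} \<inter> g -` ?K" using 2 by auto
    next
      fix w assume "w \<in> {w. norm w \<ge> 1 / M} \<inter> g -` ?K"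
      then have "w \<noteq> 0" "g w \<in> ?K" using 3 by auto
      then show "w \<in> f ` C \<union> V" using 1 unfolding Veq by auto
    qed
  qed
  have "closed {w::complex. norm w \<ge> 1 / M}"
    by (intro closed_Collect_le continuous_intros)
  moreover have "continuous_on {w. norm w \<ge> 1 / M} g"
    using contg by (rule continuous_on_subset) (use M(1) in auto)
  ultimately have "closed (f ` C \<union> V)"
    unfolding fKeq using clK by (intro continuous_closed_preimage) auto
  then have opW: "open W" unfolding W_def by (rule open_Compl)
  have bdW: "bounded W"
  proof -
    \<comment> \<open>A ball around \<open>z0\<close> inside \<open>C\<close> becomes the exterior
      of a disc, which \<open>W\<close> avoids.\<close>
    obtain e where e: "e > 0" "ball z0 e \<subseteq> inside C"
      using \<open>open (inside C)\<close> z0 openE by blast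
    have "norm w \<le> 1 / e" if "w \<in> W" for w
    proof (cases "w = 0")
      case True then show ?thesis using e by simp
    next
      case False
      have "g w \<notin> inside C" using that False unfolding W_def Veq by blast
      then have "g w \<notin> ball z0 e" using e(2) by blast
      then have "norm (1 / w) \<ge> e" by (simp add: g_def dist_norm norm_divide)
      then show ?thesis using False e(1) by (simp add: norm_divide field_simps)
    qed
    then show ?thesis by (meson boundedI)
  qed
  have zz: "z \<noteq> z0" "z \<notin> C" "z \<notin> inside C"
    using z z0 inside_Int_outside outside_no_overlap by blast+
  have fz: "f z \<in> W"
  proof -
    have "f z \<notin> f ` C"
    proof
      assume "f z \<in> f ` C"
      then obtain x where "x \<in> C" "f z = f x" by blast
      then have "z = x" using gf zz z0C by metis
      then show False using zz \<open>x \<in> C\<close> by blast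
    qed
    then show ?thesis unfolding W_def Veq using zz gf by simp
  qed
  have "connected_component_set (- f ` C) (f z) \<subseteq> W"
  proof -
    let ?Z = "connected_component_set (- f ` C) (f z)"
    have "?Z \<subseteq> - f ` C" by (simp add: connected_component_subset)
    then have 1: "?Z \<subseteq> W \<union> V" unfolding W_def by blast
    have 2: "W \<inter> V \<inter> ?Z = {}" unfolding W_def by blast
    have 3: "f z \<in> ?Z" using fz unfolding W_def by (simp add: connected_component_refl)
    have "W \<inter> ?Z = {} \<or> V \<inter> ?Z = {}"
      by (rule connectedD[OF connected_connected_component opW opV 2 1])
    then show ?thesis using 1 3 fz by blast
  qed
  then have "bounded (connected_component_set (- f ` C) (f z))" using bdW bounded_subset by blast
  moreover have "f z \<notin> f ` C" using fz unfolding W_def by blast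
  ultimately show ?thesis unfolding inside_def by blast
qed

lemma arc_comp_inj:
  fixes c :: "real \<Rightarrow> complex"
  assumes "Path_Connected.arc c" "continuous_on S f" "inj_on f S" "path_image c \<subseteq> S"
  shows "Path_Connected.arc (f \<circ> c)"
proof -
  have "path (f \<circ> c)"
    using assms continuous_on_subset by (metis arc_imp_path path_continuous_image)
  moreover have "inj_on (f \<circ> c) {0..1}"
    using assms by (metis arc_def comp_inj_on inj_on_subset path_image_def)
  ultimately show ?thesis by (simp add: arc_def)
qed

text \<open>All four arcs lie on the closed curve or outside it, so they miss the centre
  \<open>z0\<close> and the inversion is continuous and injective on them. It therefore keeps every
  incidence hypothesis of \<open>theta_inside\<close>.\<close>

lemma theta_outside:
  fixes c :: "real \<Rightarrow> complex"
  assumes c1: "Path_Connected.arc c1" "pathstart c1 = a" "pathfinish c1 = b"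
      and c2: "Path_Connected.arc c2" "pathstart c2 = a" "pathfinish c2 = b"
      and c: "Path_Connected.arc c" "pathstart c = a" "pathfinish c = b"
      and c1c2: "path_image c1 \<inter> path_image c2 = {a,b}"
      and c1c: "path_image c1 \<inter> path_image c = {a,b}"
      and c2c: "path_image c2 \<inter> path_image c = {a,b}"
      and d: "Path_Connected.arc d" "pathstart d = q" "pathfinish d = s"
      and qs: "q \<in> path_image c1 - {a,b}" "s \<in> path_image c2 - {a,b}"
      and dc: "path_image d \<inter> path_image c = {}"
      and c_out: "path_image c - {a,b} \<subseteq> outside (path_image c1 \<union> path_image c2)"
      and d_out: "path_image d - {q,s} \<subseteq> outside (path_image c1 \<union> path_image c2)"
    shows False
proof -
  let ?C = "path_image c1 \<union> path_image c2"
  have sp: "simple_path (c1 +++ reversepath c2)"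
    using c1 c2 c1c2 by (intro simple_path_join_loop) (auto simp: arc_reversepath)
  have pim: "path_image (c1 +++ reversepath c2) = ?C"
    using c1 c2 by (simp add: path_image_join)
  \<comment> \<open>A centre exists by the Jordan curve theorem.\<close>
  have "inside ?C \<noteq> {}"
    using Jordan_inside_outside[OF sp] c1 c2 by (simp add: pim)
  then obtain z0 where z0: "z0 \<in> inside ?C" by blast
  have cpt: "compact ?C" using compact_simple_path_image[OF sp] by (simp add: pim)
  define f where "f = (\<lambda>z::complex. 1 / (z - z0))"
  have cont: "continuous_on (- {z0}) f" unfolding f_def by (intro continuous_intros) auto
  have inj: "inj_on f (- {z0})" unfolding f_def by (auto simp: inj_on_def field_simps)
  have z0C: "z0 \<notin> ?C" using z0 inside_no_overlap by blast
  have z0o: "z0 \<notin> outside ?C" using z0 inside_Int_outside by blast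
  have ab: "a \<in> ?C" "b \<in> ?C" "q \<in> ?C" "s \<in> ?C" using c1c2 qs by blast+
  have sub: "path_image c1 \<subseteq> - {z0}" "path_image c2 \<subseteq> - {z0}" "path_image c \<subseteq> - {z0}" "path_image d \<subseteq> - {z0}"
    using z0C z0o c_out d_out ab by blast+
  have im: "path_image (f \<circ> g) = f ` path_image g" "pathstart (f \<circ> g) = f (pathstart g)"
    "pathfinish (f \<circ> g) = f (pathfinish g)" for g
    by (simp_all add: path_image_compose pathstart_compose pathfinish_compose)
  have Int: "f ` A \<inter> f ` B = f ` (A \<inter> B)" if "A \<subseteq> - {z0}" "B \<subseteq> - {z0}" for A B
    using inj_on_image_Int[OF inj that] by simp
  have Diff: "f ` A - f ` B = f ` (A - B)" if "A \<subseteq> - {z0}" "B \<subseteq> - {z0}" for A B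
    by (rule inj_on_image_set_diff[OF inj, symmetric]) (use that in auto)
  have ab2: "{f a, f b} = f ` {a,b}" "{f q, f s} = f ` {q,s}" by auto
  have sub2: "{a,b} \<subseteq> - {z0}" "{q,s} \<subseteq> - {z0}" using ab z0C by auto
  have out: "f ` A \<subseteq> inside (f ` ?C)" if "A \<subseteq> outside ?C" for A
    using inversion_outside_inside[OF cpt z0] that unfolding f_def by blast
  note arcs = arc_comp_inj[OF c1(1) cont inj sub(1)] arc_comp_inj[OF c2(1) cont inj sub(2)]
    arc_comp_inj[OF c(1) cont inj sub(3)] arc_comp_inj[OF d(1) cont inj sub(4)]
  show False
  proof (rule theta_inside[of "f \<circ> c1" "f a" "f b" "f \<circ> c2" "f \<circ> c" "f \<circ> d" "f q" "f s"])
    show "f q \<in> path_image (f \<circ> c1) - {f a, f b}" "f s \<in> path_image (f \<circ> c2) - {f a, f b}"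
      unfolding im ab2 using Diff[OF sub(1) sub2(1)] Diff[OF sub(2) sub2(1)] qs by auto
    show "path_image (f \<circ> c) - {f a, f b} \<subseteq> inside (path_image (f \<circ> c1) \<union> path_image (f \<circ> c2))"
      unfolding im ab2 Diff[OF sub(3) sub2(1)] image_Un[symmetric] by (rule out[OF c_out])
    show "path_image (f \<circ> d) - {f q, f s} \<subseteq> inside (path_image (f \<circ> c1) \<union> path_image (f \<circ> c2))"
      unfolding im ab2 Diff[OF sub(4) sub2(2)] image_Un[symmetric] by (rule out[OF d_out])
  qed (simp_all add: arcs im c1 c2 c d Int[OF sub(1,2)] Int[OF sub(1,3)] Int[OF sub(2,3)] Int[OF sub(4,3)] c1c2 c1c c2c dc)
qed

section \<open>Subdivided Kuratowski graphs in the plane\<close>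

definition arc_pairs :: "'a list \<Rightarrow> ('a \<times> 'a) set" where
  "arc_pairs vs = set (zip vs (tl vs))"

definition cycle_pairs :: "'a list \<Rightarrow> ('a \<times> 'a) set" where
  "cycle_pairs vs = set (zip vs (rotate1 vs))"

lemma arc_pairs_simps [simp]:
  "arc_pairs [] = {}" "arc_pairs [u] = {}" "arc_pairs (u # v # vs) = insert (u, v) (arc_pairs (v # vs))"
  by (simp_all add: arc_pairs_def)

lemma arc_pairs_append:
  "xs \<noteq> [] \<Longrightarrow> ys \<noteq> [] \<Longrightarrow> arc_pairs (xs @ ys) = insert (last xs, hd ys) (arc_pairs xs \<union> arc_pairs ys)"
proof (induction xs)
  case (Cons x xs)
  then show ?case by (cases xs; cases ys) auto
qed simp

lemma arc_pairs_subset: "arc_pairs vs \<subseteq> set vs \<times> set vs"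
  by (induction vs rule: induct_list012) auto

lemma cycle_pairs_eq_arc_pairs: "vs \<noteq> [] \<Longrightarrow> cycle_pairs vs = arc_pairs (vs @ [hd vs])"
proof (cases vs)
  case (Cons a ws)
  have "zip (a # ws @ [a]) (ws @ [a]) = zip (a # ws) (ws @ [a])"
    using zip_append[of "a # ws" "ws @ [a]" "[a]" "[]"] by simp
  then show ?thesis using Cons by (simp add: cycle_pairs_def arc_pairs_def)
qed simp

text \<open>Cuts a cycle at two of its vertices into the two paths between them, as the ends of a
  chord do.\<close>

lemma cycle_pairs_split:
  assumes "xs \<noteq> []" "ys \<noteq> []"
  shows "cycle_pairs (xs @ ys) = arc_pairs (xs @ [hd ys]) \<union> arc_pairs (ys @ [hd xs])"
proof -
  have "cycle_pairs (xs @ ys) = arc_pairs (xs @ (ys @ [hd xs]))"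
    using assms by (simp add: cycle_pairs_eq_arc_pairs)
  then show ?thesis
    using assms by (auto simp: arc_pairs_append)
qed

lemma cycle_pairs_rotate: "xs \<noteq> [] \<Longrightarrow> ys \<noteq> [] \<Longrightarrow> cycle_pairs (xs @ ys) = cycle_pairs (ys @ xs)"
  by (simp add: cycle_pairs_split Un_commute)

lemma distinct_append_commute: "distinct (xs @ ys) = distinct (ys @ xs)"
  by auto

text \<open>Used in the contrapositive: once a path has an inner vertex, a chord joining its ends is
  not one of its edges.\<close>

lemma arc_pairs_ends:
  assumes "distinct vs" "(u, v) \<in> arc_pairs vs" "{u, v} = {hd vs, last vs}"
  shows "length vs = 2"
proof -
  obtain i where i: "Suc i < length vs" "u = vs ! i" "v = vs ! Suc i"
    using assms(2) unfolding arc_pairs_def by (auto simp: set_zip nth_tl less_diff_conv)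
  have ne: "vs \<noteq> []" using i by auto
  have *: "{vs ! i, vs ! Suc i} = {vs ! 0, vs ! (length vs - 1)}"
    using assms(3) i ne by (simp add: hd_conv_nth last_conv_nth)
  have "i = 0 \<or> Suc i = 0" 
    using * assms(1) i ne by (metis One_nat_def Suc_lessD doubleton_eq_iff length_greater_0_conv nth_eq_iff_index_eq)
  moreover have "Suc i = length vs - 1 \<or> i = length vs - 1"
    using * assms(1) i ne by (metis One_nat_def Suc_lessD diff_less doubleton_eq_iff length_greater_0_conv lessI nth_eq_iff_index_eq)
  ultimately show ?thesis using i by auto
qed

section \<open>Curves of edges, paths and cycles in a plane embedding\<close>

locale plane_graph =
  pair_graph G for G :: "'a pair_pre_digraph" +
  fixes p :: "'a \<Rightarrow> complex" and \<gamma> :: "'a set \<Rightarrow> real \<Rightarrow> complex"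
  assumes embedding: "plane_embedding G p \<gamma>"
begin

definition region :: "('a \<times> 'a) set \<Rightarrow> complex set" where
  "region F = (\<Union>(u, v) \<in> F. path_image (\<gamma> {u, v}))"

lemma p_eq_iff: "u \<in> pverts G \<Longrightarrow> v \<in> pverts G \<Longrightarrow> p u = p v \<longleftrightarrow> u = v"
  using embedding unfolding plane_embedding_def by (auto dest: inj_onD)

text \<open>An embedding prescribes the ends of a curve only as a set; a curve running the other way
  is reversed.\<close>

lemma edge_arc:
  assumes "(u, v) \<in> parcs G"
  obtains g where "Path_Connected.arc g" "pathstart g = p u" "pathfinish g = p v" "path_image g = path_image (\<gamma> {u, v})"
proof -
  have *: "Path_Connected.arc (\<gamma> {u, v})" "{pathstart (\<gamma> {u, v}), pathfinish (\<gamma> {u, v})} = {p u, p v}"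
    using embedding assms unfolding plane_embedding_def by blast+
  then consider "pathstart (\<gamma> {u, v}) = p u" "pathfinish (\<gamma> {u, v}) = p v"
    | "pathstart (\<gamma> {u, v}) = p v" "pathfinish (\<gamma> {u, v}) = p u" by (auto simp: doubleton_eq_iff)
  then show thesis
  proof cases
    case 1 then show ?thesis using that * by blast
  next
    case 2 then show ?thesis using that[of "reversepath (\<gamma> {u, v})"] * by (simp add: arc_reversepath)
  qed
qed

text \<open>Edges are compared as unordered pairs because both arcs of an edge share one
  curve.\<close>

lemma edge_region_Int:
  assumes "(u, v) \<in> parcs G" "F \<subseteq> parcs G" "\<And>x y. (x, y) \<in> F \<Longrightarrow> {x, y} \<noteq> {u, v}" "F \<subseteq> V \<times> V"
  shows "path_image (\<gamma> {u, v}) \<inter> region F \<subseteq> p ` ({u, v} \<inter> V)"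
proof
  fix z assume z: "z \<in> path_image (\<gamma> {u, v}) \<inter> region F"
  then obtain x y where xy: "(x, y) \<in> F" "z \<in> path_image (\<gamma> {x, y})" unfolding region_def by blast
  have "path_image (\<gamma> {u, v}) \<inter> path_image (\<gamma> {x, y}) \<subseteq> p ` ({u, v} \<inter> {x, y})"
    using embedding assms xy unfolding plane_embedding_def by (smt (verit) case_prodD subsetD)
  moreover have "{x, y} \<subseteq> V" using xy(1) assms(4) by auto
  then have "p ` ({u, v} \<inter> {x, y}) \<subseteq> p ` ({u, v} \<inter> V)" by (intro image_mono) auto
  moreover have "z \<in> path_image (\<gamma> {u, v}) \<inter> path_image (\<gamma> {x, y})" using z xy(2) by simp
  ultimately show "z \<in> p ` ({u, v} \<inter> V)" by (meson subsetD)
qed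

lemma region_Int:
  assumes "F \<subseteq> parcs G" "H \<subseteq> parcs G" "F \<subseteq> U \<times> U" "H \<subseteq> V \<times> V"
    "\<And>x y u v. (x, y) \<in> F \<Longrightarrow> (u, v) \<in> H \<Longrightarrow> {x, y} \<noteq> {u, v}"
  shows "region F \<inter> region H \<subseteq> p ` (U \<inter> V)"
proof
  fix z assume z: "z \<in> region F \<inter> region H"
  then obtain x y where xy: "(x, y) \<in> F" "z \<in> path_image (\<gamma> {x, y})" unfolding region_def by blast
  have "path_image (\<gamma> {x, y}) \<inter> region H \<subseteq> p ` ({x, y} \<inter> V)"
  proof (rule edge_region_Int[OF _ assms(2) _ assms(4)])
    show "(x, y) \<in> parcs G" using xy(1) assms(1) by (rule subsetD[rotated])
    show "{u, v} \<noteq> {x, y}" if "(u, v) \<in> H" for u v using assms(5)[OF xy(1) that] by (rule not_sym)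
  qed
  then have "z \<in> p ` ({x, y} \<inter> V)" using xy(2) z by (meson IntD2 IntI subsetD)
  moreover have "{x, y} \<subseteq> U" using xy(1) assms(3) by auto
  then have "p ` ({x, y} \<inter> V) \<subseteq> p ` (U \<inter> V)" by (intro image_mono) auto
  ultimately show "z \<in> p ` (U \<inter> V)" by (meson subsetD)
qed

text \<open>As the vertices are distinct, the curve of the first edge meets the rest of the path
  only at their common vertex, so the arcs can be joined.\<close>

lemma path_arc:
  assumes "distinct vs" "2 \<le> length vs" "arc_pairs vs \<subseteq> parcs G"
  shows "\<exists>g. Path_Connected.arc g \<and> pathstart g = p (hd vs) \<and> pathfinish g = p (last vs) \<and>
           path_image g = region (arc_pairs vs)"
  using assms
proof (induction vs rule: induct_list012)
  case (3 u v ws)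
  have uv: "(u, v) \<in> parcs G" using 3 by simp
  obtain g1 where g1: "Path_Connected.arc g1" "pathstart g1 = p u" "pathfinish g1 = p v" "path_image g1 = path_image (\<gamma> {u, v})"
    using edge_arc[OF uv] by blast
  show ?case
  proof (cases ws)
    case Nil
    then show ?thesis using g1 by (auto simp: region_def)
  next
    case (Cons w ws')
    obtain g2 where g2: "Path_Connected.arc g2" "pathstart g2 = p v" "pathfinish g2 = p (last (v # ws))"
      "path_image g2 = region (arc_pairs (v # ws))"
      using 3 Cons by auto
    have "path_image g1 \<inter> path_image g2 \<subseteq> p ` ({u, v} \<inter> set (v # ws))"
      unfolding g1 g2
      by (rule edge_region_Int[OF uv _ _ arc_pairs_subset])
        (use 3 arc_pairs_subset[of "v # ws"] in \<open>auto simp: doubleton_eq_iff\<close>)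
    then have "path_image g1 \<inter> path_image g2 \<subseteq> {pathstart g2}" using 3 g2 by auto
    then have "Path_Connected.arc (g1 +++ g2)" using g1 g2 by (intro arc_join) auto
    moreover have "path_image (g1 +++ g2) = region (arc_pairs (u # v # ws))"
      using g1 g2 by (simp add: path_image_join region_def)
    ultimately show ?thesis using g1 g2 by (intro exI[of _ "g1 +++ g2"]) auto
  qed
qed auto

lemma path_vertices:
  assumes "2 \<le> length vs" "arc_pairs vs \<subseteq> parcs G"
  shows "p ` set vs \<subseteq> region (arc_pairs vs)"
  using assms
proof (induction vs rule: induct_list012)
  case (3 u v ws)
  have "p u \<in> path_image (\<gamma> {u, v})" "p v \<in> path_image (\<gamma> {u, v})"
    using edge_arc[of u v] 3(4) by (metis arc_pairs_simps(3) insert_subset pathstart_in_path_image pathfinish_in_path_image)+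
  then show ?case using 3 by (cases ws) (auto simp: region_def)
qed auto

text \<open>The vertices \<open>a\<close> and \<open>b\<close> cut the cycle into a path through
  \<open>q\<close> and a path through \<open>s\<close>. Each chord without its ends is connected and
  avoids the cycle, so it lies entirely on one side; \<open>theta_inside\<close> and
  \<open>theta_outside\<close> rule out equal sides.\<close>

lemma crossing_chords:
  assumes cs: "distinct (a # xs @ b # ys)" "cycle_pairs (a # xs @ b # ys) \<subseteq> parcs G"
    and q: "q \<in> set xs" and s: "s \<in> set ys"
    and ab: "(a, b) \<in> parcs G" and qs: "(q, s) \<in> parcs G"
  defines "R \<equiv> region (cycle_pairs (a # xs @ b # ys))"
  shows "(path_image (\<gamma> {a, b}) - {p a, p b} \<subseteq> inside R) \<noteq> (path_image (\<gamma> {q, s}) - {p q, p s} \<subseteq> inside R)"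
proof -
  define P1 where "P1 = a # xs @ [b]"
  define P2 where "P2 = b # ys @ [a]"
  have split: "cycle_pairs (a # xs @ b # ys) = arc_pairs P1 \<union> arc_pairs P2"
    using cycle_pairs_split[of "a # xs" "b # ys"] by (simp add: P1_def P2_def)
  have R: "R = region (arc_pairs P1) \<union> region (arc_pairs P2)"
    unfolding R_def split by (simp add: region_def)
  have E: "arc_pairs P1 \<subseteq> parcs G" "arc_pairs P2 \<subseteq> parcs G" using cs split by auto
  have dist: "distinct P1" "distinct P2" "length P1 > 2" "length P2 > 2"
    using cs q s by (auto simp: P1_def P2_def intro: length_pos_if_in_set)
  obtain c1 where c1: "Path_Connected.arc c1" "pathstart c1 = p a" "pathfinish c1 = p b" "path_image c1 = region (arc_pairs P1)"
    using path_arc[OF dist(1) _ E(1)] dist by (auto simp: P1_def)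
  obtain c2' where c2': "Path_Connected.arc c2'" "pathstart c2' = p b" "pathfinish c2' = p a" "path_image c2' = region (arc_pairs P2)"
    using path_arc[OF dist(2) _ E(2)] dist by (auto simp: P2_def)
  define c2 where "c2 = reversepath c2'"
  have c2: "Path_Connected.arc c2" "pathstart c2 = p a" "pathfinish c2 = p b" "path_image c2 = region (arc_pairs P2)"
    using c2' by (simp_all add: c2_def arc_reversepath)
  obtain c where c: "Path_Connected.arc c" "pathstart c = p a" "pathfinish c = p b" "path_image c = path_image (\<gamma> {a, b})"
    using edge_arc[OF ab] by blast
  obtain d where d: "Path_Connected.arc d" "pathstart d = p q" "pathfinish d = p s" "path_image d = path_image (\<gamma> {q, s})"
    using edge_arc[OF qs] by blast
  have V1: "set P1 = insert a (insert b (set xs))" and V2: "set P2 = insert a (insert b (set ys))"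
    by (auto simp: P1_def P2_def)
  \<comment> \<open>Both paths have an inner vertex, \<open>q\<close> or \<open>s\<close>, so the
    chord joining their ends is an edge of neither.\<close>
  have neq: "{x, y} \<noteq> {a, b}" if "(x, y) \<in> arc_pairs P1 \<union> arc_pairs P2" for x y
    using that arc_pairs_ends[OF dist(1), of x y] arc_pairs_ends[OF dist(2), of x y] dist
    by (auto simp: P1_def P2_def insert_commute)
  have ends: "p a \<in> path_image c1" "p b \<in> path_image c1" "p a \<in> path_image c2" "p b \<in> path_image c2"
    "p a \<in> path_image c" "p b \<in> path_image c" "p q \<in> path_image d" "p s \<in> path_image d"
    using c1 c2 c d by (metis pathstart_in_path_image pathfinish_in_path_image)+
  have c1c2: "path_image c1 \<inter> path_image c2 = {p a, p b}"
  proof -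
    have "path_image c1 \<inter> path_image c2 \<subseteq> p ` (set P1 \<inter> set P2)"
      unfolding c1(4) c2(4)
    proof (rule region_Int[OF E arc_pairs_subset arc_pairs_subset])
      fix x y u v assume xy: "(x, y) \<in> arc_pairs P1" "(u, v) \<in> arc_pairs P2"
      show "{x, y} \<noteq> {u, v}"
      proof
        assume eq: "{x, y} = {u, v}"
        have "{x, y} \<subseteq> set P1" "{u, v} \<subseteq> set P2"
          using xy arc_pairs_subset[of P1] arc_pairs_subset[of P2] by auto
        then have "{x, y} \<subseteq> set P1 \<inter> set P2" using eq by blast
        \<comment> \<open>The two paths share only \<open>a\<close> and \<open>b\<close>, so a
          common edge would be the chord itself.\<close>
        then have "{x, y} \<subseteq> {a, b}" using cs V1 V2 by auto
        moreover have "x \<noteq> y" using xy E pair_no_loops by fastforce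
        ultimately show False using neq[of x y] xy(1) by auto
      qed
    qed
    then show ?thesis using ends cs V1 V2 by auto
  qed
  have c1c: "path_image c1 \<inter> path_image c = {p a, p b}"
    using edge_region_Int[OF ab E(1) _ arc_pairs_subset] neq ends c1 c by auto
  have c2c: "path_image c2 \<inter> path_image c = {p a, p b}"
    using edge_region_Int[OF ab E(2) _ arc_pairs_subset] neq ends c2 c by auto
  have dc: "path_image d \<inter> path_image c = {}"
  proof -
    have "path_image (\<gamma> {q, s}) \<inter> region {(a, b)} \<subseteq> p ` ({q, s} \<inter> {a, b})"
      by (rule edge_region_Int[OF qs]) (use ab q s cs in \<open>auto simp: doubleton_eq_iff\<close>)
    then show ?thesis using c d q s cs by (auto simp: region_def)
  qed
  have dR1: "path_image d \<inter> path_image c1 \<subseteq> {p q, p s}"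
  proof -
    have "path_image (\<gamma> {q, s}) \<inter> region (arc_pairs P1) \<subseteq> p ` ({q, s} \<inter> set P1)"
    proof (rule edge_region_Int[OF qs E(1) _ arc_pairs_subset])
      fix x y assume "(x, y) \<in> arc_pairs P1"
      then have "{x, y} \<subseteq> set P1" using arc_pairs_subset[of P1] by auto
      moreover have "s \<notin> set P1" using s cs V1 by auto
      ultimately show "{x, y} \<noteq> {q, s}" by blast
    qed
    then show ?thesis using c1 d by blast
  qed
  have dR2: "path_image d \<inter> path_image c2 \<subseteq> {p q, p s}"
  proof -
    have "path_image (\<gamma> {q, s}) \<inter> region (arc_pairs P2) \<subseteq> p ` ({q, s} \<inter> set P2)"
    proof (rule edge_region_Int[OF qs E(2) _ arc_pairs_subset])
      fix x y assume "(x, y) \<in> arc_pairs P2"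
      then have "{x, y} \<subseteq> set P2" using arc_pairs_subset[of P2] by auto
      moreover have "q \<notin> set P2" using q cs V2 by auto
      ultimately show "{x, y} \<noteq> {q, s}" by blast
    qed
    then show ?thesis using c2 d by blast
  qed
  have inG: "a \<in> pverts G" "b \<in> pverts G" "q \<in> pverts G" "s \<in> pverts G" using ab qs wellformed' by blast+
  have qC: "p q \<in> path_image c1 - {p a, p b}" "p s \<in> path_image c2 - {p a, p b}"
    using path_vertices[OF _ E(1)] path_vertices[OF _ E(2)] dist q s V1 V2 c1 c2 p_eq_iff inG cs by auto
  have R': "R = path_image c1 \<union> path_image c2" using R c1 c2 by simp
  have clR: "closed R" unfolding R' using c1(1) c2(1) by (simp add: closed_Un closed_arc_image)
  have side: "path_image g - {pathstart g, pathfinish g} \<subseteq> inside R \<or> path_image g - {pathstart g, pathfinish g} \<subseteq> outside R"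
    if g: "Path_Connected.arc g" "path_image g \<inter> R \<subseteq> {pathstart g, pathfinish g}" for g
  proof -
    let ?D = "path_image g - {pathstart g, pathfinish g}"
    have con: "Topological_Spaces.connected ?D"
      using connected_simple_path_endless g(1) arc_imp_simple_path by blast
    have 1: "?D \<subseteq> inside R \<union> outside R" using g(2) inside_Un_outside[of R] by blast
    have 2: "inside R \<inter> outside R \<inter> ?D = {}" using inside_Int_outside[of R] by blast
    have "inside R \<inter> ?D = {} \<or> outside R \<inter> ?D = {}"
      by (rule connectedD[OF con open_inside[OF clR] open_outside[OF clR] 2 1])
    then show ?thesis using 1 by blast
  qed
  have sidec: "path_image c - {p a, p b} \<subseteq> inside R \<or> path_image c - {p a, p b} \<subseteq> outside R"
    using side[of c] c(1-3) c1c c2c R' by auto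
  have sided: "path_image d - {p q, p s} \<subseteq> inside R \<or> path_image d - {p q, p s} \<subseteq> outside R"
    using side[of d] d(1-3) dR1 dR2 R' by auto
  have ni: "\<not> (path_image c - {p a, p b} \<subseteq> inside R \<and> path_image d - {p q, p s} \<subseteq> inside R)"
    using theta_inside[OF c1(1-3) c2(1-3) c(1-3) c1c2 c1c c2c d(1-3) qC dc] R' by blast
  have no: "\<not> (path_image c - {p a, p b} \<subseteq> outside R \<and> path_image d - {p q, p s} \<subseteq> outside R)"
    using theta_outside[OF c1(1-3) c2(1-3) c(1-3) c1c2 c1c c2c d(1-3) qC dc] R' by blast
  show ?thesis using ni no sidec sided c(4) d(4) by auto
qed

text \<open>A hexagon with its three long diagonals is \<open>K\<^sub>3\<^sub>,\<^sub>3\<close>; the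
  tails of the segments subdivide the hexagon. The diagonals interleave pairwise, but there are only
  two sides.\<close>

lemma no_Kuratowski6:
  assumes "distinct (concat ss)" "ss = [s0, s1, s2, s3, s4, s5]" "[] \<notin> set ss"
    "cycle_pairs (concat ss) \<subseteq> parcs G"
    "(hd s0, hd s3) \<in> parcs G" "(hd s1, hd s4) \<in> parcs G" "(hd s2, hd s5) \<in> parcs G"
  shows False
proof -
  obtain h0 t0 h1 t1 h2 t2 h3 t3 h4 t4 h5 t5 where eq: "s0 = h0 # t0" "s1 = h1 # t1" "s2 = h2 # t2"
    "s3 = h3 # t3" "s4 = h4 # t4" "s5 = h5 # t5"
    using assms(2,3) by (auto simp: neq_Nil_conv eq_commute[of "[]"])
  define cs where "cs = h0 # (t0 @ h1 # t1 @ h2 # t2) @ h3 # (t3 @ h4 # t4 @ h5 # t5)"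
  have cs: "concat ss = cs" using assms(2) eq by (simp add: cs_def)
  \<comment> \<open>\<open>crossing_chords\<close> wants the list to start at an end of a chord.
    Rotation keeps the set of pairs, so the sides still refer to the same region.\<close>
  have rot: "cycle_pairs (h1 # (t1 @ h2 # t2 @ h3 # t3) @ h4 # (t4 @ h5 # t5 @ s0)) = cycle_pairs cs"
    using cycle_pairs_rotate[of s0 "h1 # t1 @ h2 # t2 @ h3 # t3 @ h4 # t4 @ h5 # t5"] by (simp add: cs_def eq)
  let ?in = "\<lambda>u v. path_image (\<gamma> {u, v}) - {p u, p v} \<subseteq> inside (region (cycle_pairs cs))"
  have dist: "distinct cs" and sub: "cycle_pairs cs \<subseteq> parcs G" using assms(1,4) cs by auto
  have ch: "(h0, h3) \<in> parcs G" "(h1, h4) \<in> parcs G" "(h2, h5) \<in> parcs G" using assms(5-7) eq by auto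
  have "?in h0 h3 \<noteq> ?in h1 h4"
    using crossing_chords[of h0 "t0 @ h1 # t1 @ h2 # t2" h3 "t3 @ h4 # t4 @ h5 # t5" h1 h4] dist sub ch
    by (simp add: cs_def)
  moreover have "?in h0 h3 \<noteq> ?in h2 h5"
    using crossing_chords[of h0 "t0 @ h1 # t1 @ h2 # t2" h3 "t3 @ h4 # t4 @ h5 # t5" h2 h5] dist sub ch
    by (simp add: cs_def)
  moreover have "?in h1 h4 \<noteq> ?in h2 h5"
  proof -
    have "distinct (h1 # (t1 @ h2 # t2 @ h3 # t3) @ h4 # (t4 @ h5 # t5 @ s0))"
      using dist distinct_append_commute[of s0 "h1 # t1 @ h2 # t2 @ h3 # t3 @ h4 # t4 @ h5 # t5"]
      by (simp only: cs_def eq append_Cons append_assoc)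
    then show ?thesis
      using crossing_chords[of h1 "t1 @ h2 # t2 @ h3 # t3" h4 "t4 @ h5 # t5 @ s0" h2 h5] sub ch
      unfolding rot by simp
  qed
  ultimately show False by sat
qed

text \<open>A pentagon with all its diagonals is \<open>K\<^sub>5\<close>. Each diagonal interleaves
  with exactly two others, and this relation is a cycle of length five, on which sides cannot
  alternate.\<close>

lemma no_Kuratowski5:
  assumes "distinct (concat ss)" "ss = [s0, s1, s2, s3, s4]" "[] \<notin> set ss"
    "cycle_pairs (concat ss) \<subseteq> parcs G"
    "(hd s0, hd s2) \<in> parcs G" "(hd s1, hd s3) \<in> parcs G" "(hd s2, hd s4) \<in> parcs G"
    "(hd s0, hd s3) \<in> parcs G" "(hd s1, hd s4) \<in> parcs G"
  shows False
proof -
  obtain h0 t0 h1 t1 h2 t2 h3 t3 h4 t4 where eq: "s0 = h0 # t0" "s1 = h1 # t1" "s2 = h2 # t2"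
    "s3 = h3 # t3" "s4 = h4 # t4"
    using assms(2,3) by (auto simp: neq_Nil_conv eq_commute[of "[]"])
  define cs where "cs = h0 # t0 @ h1 # t1 @ h2 # t2 @ h3 # t3 @ h4 # t4"
  have cs: "concat ss = cs" using assms(2) eq by (simp add: cs_def)
  have rot: "cycle_pairs (h1 # (t1 @ h2 # t2) @ h3 # (t3 @ h4 # t4 @ s0)) = cycle_pairs cs"
    using cycle_pairs_rotate[of s0 "h1 # t1 @ h2 # t2 @ h3 # t3 @ h4 # t4"] by (simp add: cs_def eq)
  let ?in = "\<lambda>u v. path_image (\<gamma> {u, v}) - {p u, p v} \<subseteq> inside (region (cycle_pairs cs))"
  have dist: "distinct cs" and sub: "cycle_pairs cs \<subseteq> parcs G" using assms(1,4) cs by auto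
  have ch: "(h0, h2) \<in> parcs G" "(h1, h3) \<in> parcs G" "(h2, h4) \<in> parcs G" "(h0, h3) \<in> parcs G" "(h1, h4) \<in> parcs G"
    using assms(5-9) eq by auto
  have "?in h0 h2 \<noteq> ?in h1 h3" "?in h0 h2 \<noteq> ?in h1 h4"
    using crossing_chords[of h0 "t0 @ h1 # t1" h2 "t2 @ h3 # t3 @ h4 # t4" h1] dist sub ch
    by (simp_all add: cs_def)
  moreover have "?in h0 h3 \<noteq> ?in h1 h4" "?in h0 h3 \<noteq> ?in h2 h4"
    using crossing_chords[of h0 "t0 @ h1 # t1 @ h2 # t2" h3 "t3 @ h4 # t4" _ h4] dist sub ch
    by (simp_all add: cs_def)
  moreover have "?in h1 h3 \<noteq> ?in h2 h4"
  proof -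
    have "distinct (h1 # (t1 @ h2 # t2) @ h3 # (t3 @ h4 # t4 @ s0))"
      using dist distinct_append_commute[of s0 "h1 # t1 @ h2 # t2 @ h3 # t3 @ h4 # t4"]
      by (simp only: cs_def eq append_Cons append_assoc)
    then show ?thesis
      using crossing_chords[of h1 "t1 @ h2 # t2" h3 "t3 @ h4 # t4 @ s0" h2 h4] sub ch
      unfolding rot by simp
  qed
  ultimately show False by sat
qed

end

section \<open>Two-coloured complete graphs on eight and nine vertices\<close>

text \<open>
  A subdivision of \<open>K\<^sub>5\<close> or \<open>K\<^sub>3\<^sub>,\<^sub>3\<close> is encoded by a Hamiltonian cycle that is cut into five or six
  segments whose heads are the branch vertices; the chords of the cycle are not subdivided.
\<close>

fun chords :: "'b list list \<Rightarrow> ('b \<times> 'b) list" where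
  "chords [a, b, c, d, e] = [(hd a, hd c), (hd b, hd d), (hd c, hd e), (hd a, hd d), (hd b, hd e)]"
| "chords [a, b, c, d, e, f] = [(hd a, hd d), (hd b, hd e), (hd c, hd f)]"
| "chords _ = []"

definition seg_pairs :: "'b list list \<Rightarrow> ('b \<times> 'b) list" where
  "seg_pairs ss = zip (concat ss) (rotate1 (concat ss)) @ chords ss"

text \<open>Here \<open>r i j\<close> means that the edge between the \<open>i\<close>-th and the \<open>j\<close>-th vertex is red.\<close>

definition bicoloured :: "(nat \<Rightarrow> nat \<Rightarrow> bool) \<Rightarrow> (nat \<times> nat) list \<Rightarrow> bool" where
  "bicoloured r es \<longleftrightarrow> list_ex (\<lambda>(i, j). \<not> r i j) es \<and> list_ex (\<lambda>(i, j). r i j) es"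

text \<open>These rewrites expand a clause over concrete indices into a propositional formula in the
  atoms \<open>r i j\<close>.\<close>

lemmas clause_simps = list.pred_inject seg_pairs_def concat.simps append.simps rotate1.simps
  zip_Cons_Cons zip_Nil chords.simps(1,2) list.sel(1) bicoloured_def list_ex_Nil_iff list_ex_Cons_iff prod.case

text \<open>Vertices with the same role may be renamed, so they may be assumed sorted by their
  columns of colours; comparing neighbours in the order expresses this.\<close>

fun lexge :: "bool list \<Rightarrow> bool list \<Rightarrow> bool" where
  "lexge (x # xs) (y # ys) \<longleftrightarrow> (y \<longrightarrow> x) \<and> ((x \<longleftrightarrow> y) \<longrightarrow> lexge xs ys)"
| "lexge _ _ \<longleftrightarrow> True"

text \<open>
  If the vector \<open>[ab, ac, ad, bc, bd, cd]\<close> is lexicographically maximal among all orders of the four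
  vertices, then exchanging two neighbours in the order does not increase it.
\<close>

definition sorted_quad :: "bool \<Rightarrow> bool \<Rightarrow> bool \<Rightarrow> bool \<Rightarrow> bool \<Rightarrow> bool \<Rightarrow> bool" where
  "sorted_quad ab ac ad bc bd cd \<longleftrightarrow>
    lexge [ac, ad] [bc, bd] \<and> lexge [ab, bd] [ac, cd] \<and> lexge [ac, bc] [ad, bd]"

text \<open>Every permutation of the three edges of a triangle comes from one of its vertices, so
  the three colours can simply be sorted.\<close>

definition sorted_triple :: "bool \<Rightarrow> bool \<Rightarrow> bool \<Rightarrow> bool" where
  "sorted_triple ab ac bc \<longleftrightarrow> (ac \<longrightarrow> ab) \<and> (bc \<longrightarrow> ac)"

text \<open>The two lists will be the edges of a model and of its twisted copy, so that together
  they settle all 28 pairs. The form with \<open>list_ex\<close> suits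
  \<open>clause_simps\<close>.\<close>

definition all_coloured :: "(nat \<Rightarrow> nat \<Rightarrow> bool) \<Rightarrow> (nat \<times> nat) list \<Rightarrow> (nat \<times> nat) list \<Rightarrow> bool" where
  "all_coloured r es fs \<longleftrightarrow> \<not> list_ex (\<lambda>(i, j). \<not> r i j) es \<and> \<not> list_ex (\<lambda>(i, j). r i j) fs"

text \<open>
  The lists of this section were found by a computer search and then thinned out.
\<close>

definition segments_balanced :: "nat list list list" where
  "segments_balanced = [
    [[0,2],[5],[1,7],[4],[6,3]], [[8],[0,6],[2,3],[5],[7,1]], [[0],[7,2],[8],[5,4],[1,6]],
    [[5,4],[0],[1,6],[3,7],[2]], [[7,3],[8],[1,6],[0,5],[4]], [[8,4],[7],[0,6],[2,3],[5]],
    [[7],[3,5],[0,6],[2],[8,1]], [[4,5],[0],[6,2],[8,1],[7]], [[0,5],[4,1],[8],[6,2],[7]],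
    [[7],[0,5],[3],[6,2],[8,1]], [[1],[3,7],[2],[0,4],[6,5]], [[6],[2,7],[3],[5,1],[0,4]],
    [[4,7],[2],[5,3],[0],[1,6]], [[7],[1,6],[0,5],[4],[8,2]], [[0],[8,3],[7],[5,4],[1,6]],
    [[8,4],[7],[2,6],[0,5],[3]], [[1,7],[3],[6,4],[0,2],[5]], [[2,7],[1],[6,4],[0,3],[5]],
    [[0],[8,1],[7],[6,2],[3,5]], [[7],[6,4],[8],[0,5],[3,2]], [[6,3],[0,1],[5],[4,7],[2]],
    [[0],[6,3],[7],[8,1],[4,5]], [[3],[5,1],[0,2],[6],[4,7]], [[0],[4,8],[2,6],[1],[5],[7,3]],
    [[0,5],[4],[3],[6,2],[8,1],[7]], [[7],[8],[3,5],[0],[6,2]], [[0,4],[8],[5],[3,7],[1,6],[2]],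
    [[0],[3,7],[1,8],[4],[5],[6,2]], [[6],[8],[3,5],[0],[7,4]], [[7,2],[0],[1,6],[4,8],[3],[5]],
    [[3],[1],[2,7],[5,4],[0]], [[3],[0],[2,5],[6],[4,8,7],[1]], [[5],[2],[1],[6,4],[0,3]],
    [[6],[3,5],[0],[8,1],[7]], [[0],[7],[6],[8,1],[4,5]], [[0,3],[6],[5],[2],[1,7,8],[4]],
    [[3,2],[7],[8],[6],[0,5]], [[0],[1],[2,7],[3],[5,4]], [[0],[6],[8,2],[7],[1,5]], [[6,4],[0],[2],[3],[1,5]],
    [[6],[4],[3,5],[0],[7,1],[8,2]], [[8,3],[2],[6],[0,5],[4],[7,1]], [[2],[0,1],[6],[5],[4,8],[3,7]],
    [[2],[7],[8,4],[6],[0,5]], [[2,7],[4,6],[1],[5],[8,3],[0]], [[1],[3,8],[2],[0],[4,5]],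
    [[6],[8],[0,5],[4],[7,2]], [[0,6],[2],[8],[7],[3,5]], [[2],[5],[7,3],[0],[4,8],[1,6]],
    [[0],[1,6],[2,7],[3],[5],[8,4]], [[5,4],[0],[1],[3],[2,8]], [[1],[2],[3,8],[5,4],[0]],
    [[0,7],[1],[8,2],[6],[4],[3,5]], [[3,6],[1],[0,2],[7],[5],[4,8]], [[4],[5],[0,6],[1],[8,2,3],[7]],
    [[4,5],[0],[8,2],[7],[6]], [[8],[7],[1,6],[0,5],[4]], [[2],[0,4],[8],[5],[1,6],[3,7]],
    [[8],[5,4],[1,6],[0],[7]], [[5],[6,1],[0],[3,8],[4,7],[2]], [[6],[8],[2,5],[0],[7,4]],
    [[3],[6],[5,2],[0],[4,8],[1,7]], [[4],[6],[7,1],[8],[0,5]], [[8],[6],[2,5],[0],[7,1]],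
    [[3,7],[2,8],[4],[0,1],[6],[5]], [[7],[3,5],[0],[6],[8,2]], [[7,3],[8],[6],[0,5],[1]],
    [[5,4],[0],[1],[2,8],[3]], [[8],[7],[5,3],[2,6],[0]], [[4],[5,7],[3,8],[6],[1],[0]],
    [[1,4],[6],[2,5],[7],[0],[8]], [[6],[2],[0,1],[5,8],[7],[4]], [[5],[0],[8,1],[4],[7,2],[6]],
    [[0,4],[5],[2,8],[3],[7],[1]], [[3,2],[4],[8,0],[5],[7],[1]], [[7,5],[8],[6],[2,0],[4],[3]],
    [[4],[0,3],[5],[8],[2],[1,7]], [[6],[5,2],[0,4],[8],[7],[1]], [[3],[2],[7,5],[1],[0],[4,6]],
    [[8],[0],[7],[1,4],[6,3],[2]], [[1,6],[4],[5,8],[3],[0],[2]], [[2],[5,0],[6],[4],[8,1],[7]],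
    [[5],[7],[8],[2,3],[1,6],[0]], [[5],[3,7,8],[6],[4],[0],[1]], [[5],[3],[2,6],[0,8],[1],[4]],
    [[2],[0],[3],[6],[4,8],[5,7]], [[0],[2,8],[6],[1,7],[4],[3]], [[3],[1],[5],[6],[2,7,4],[8]],
    [[4,1],[8],[0],[7],[5,3],[6]], [[5],[4],[6],[0],[7,1],[8,3]], [[2],[8,1],[7],[3,6],[0],[5]],
    [[1],[5],[2],[0],[3],[7,4,6]], [[6,4],[0,3],[5],[8],[2],[1]], [[3],[2],[1],[0],[4,7]],
    [[5],[1],[3,6],[2],[0],[4,8]], [[6],[0,7],[1,4],[2],[5],[8]], [[5],[1],[4,8],[6],[3],[0,2]],
    [[5,2],[6],[0,7],[4],[3],[8]], [[3],[4,8],[2],[0,1],[5],[7]], [[2,8],[6],[3,7],[5],[1],[0]],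
    [[6],[8,1],[7],[0,5],[2],[4]], [[4,5],[0],[7],[6,2],[8],[1]], [[2],[0],[4],[7,6],[1],[5,8]],
    [[3],[6],[0,5],[4,1],[8],[7]], [[1],[6,7],[3,8],[5],[4],[0]], [[2],[7],[4],[0],[3,8],[6,1]],
    [[4],[7],[0],[6],[3,2],[8,1]], [[7,4],[2],[6],[0,5],[3],[8]], [[5],[2],[0],[3,6],[1,7],[4]],
    [[0],[7],[1],[8,2,3],[4],[6]], [[0,5],[4,1],[3],[8],[2],[7]], [[1],[3],[5,8],[2],[0],[4,6]],
    [[3],[7,1],[8],[2],[6],[0,5]], [[7,0],[6],[4],[1],[8,2],[3]], [[3,8],[5],[7,4],[0],[1],[6]],
    [[1],[5,4],[0],[2],[7],[3,6]], [[7],[6,4],[1,8],[0],[5],[3]], [[2],[8],[4],[0,3],[7],[5,1]],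
    [[1,6],[0],[5],[4],[7,2],[8]], [[1],[8,2],[7],[4],[6],[0,5]], [[8],[1],[5,7],[4],[0],[3,6]],
    [[4,1],[8],[0],[5],[2],[6,3]], [[6,2],[5],[7],[0],[8],[1,4]], [[3],[5,8],[4],[0],[1],[7,6]],
    [[3],[0],[2,7],[6],[1],[5,8]], [[6],[0,5],[4],[8],[7]], [[2,7],[0,5],[3],[8],[6],[4]],
    [[6],[8,1],[4],[7],[0],[5,3]], [[6],[3,4],[2,5],[0],[8],[7]], [[3],[8,1],[4],[7],[0,6],[2]],
    [[7],[2,3,4],[5],[6],[8],[0]], [[3],[8,1],[7],[4,5],[0],[6]], [[3],[1],[6,4],[0],[2],[7,8]],
    [[5,3],[0],[2],[7],[4,6],[1]], [[3],[0],[2],[7,6],[1],[5,8]], [[8],[0],[7],[3,2],[5,4],[1]],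
    [[2],[0],[3],[7,5],[1,6],[4]], [[2,8],[6],[1],[0],[4],[5,7]], [[7,1],[8],[0],[6,2],[3],[5]],
    [[8],[3],[0],[4],[7,5],[1,6]], [[2,6],[3],[5,7],[4],[0],[1]], [[4],[0],[3],[7],[2,5,1],[6]],
    [[8],[7],[6],[3,5],[0]], [[7,0],[8,5],[4],[2],[3],[6]], [[0],[7,1],[8,2],[6],[4],[5]],
    [[0,7],[1],[4],[6,2],[8],[5]], [[5],[1],[2,7],[3],[0,4],[8]], [[0],[2,7],[5],[3],[1,6],[4]],
    [[0],[3],[2],[4,8,5],[6],[1]], [[1],[2,0],[4],[5],[7,8],[6]], [[0],[7],[2,3],[8,1],[4],[6]],
    [[0],[5],[4,2],[8],[7,3],[6]], [[7],[0,5],[3,4],[1],[8],[6]], [[8],[0],[5,4],[3],[6],[7,1]],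
    [[5],[3,2],[6],[4,1],[8],[0]], [[4],[6],[7,2],[8],[0,5],[3]], [[3],[8,5],[1],[0],[4,7],[6]],
    [[6],[0],[8,1],[4],[5,3],[7]], [[0],[7,2],[4],[5],[6],[3,8]], [[0,6],[2],[4],[7],[3,1],[8]],
    [[1,5],[0],[7,3],[8],[6],[4]], [[7],[4,1],[8],[0],[6],[3,2]], [[1,8],[4],[3,7],[5],[2],[0]],
    [[1],[0],[3],[5,7],[2,8],[6]], [[3],[0,4],[5],[1],[2]], [[6],[4],[0,3],[8],[7,2],[1]],
    [[0],[1],[3,8],[4],[2]], [[6],[3],[2],[4,8],[5,0],[7]], [[5],[0,8],[3],[4,2],[6],[7]],
    [[8],[4],[6,2],[7],[3,5],[0]], [[0,5],[3],[2],[6],[8,4],[7]], [[0],[3],[6,7],[2,8],[5],[1]],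
    [[6],[3,8],[0],[5],[4],[7,2]], [[2],[6],[1],[3],[8,7,4],[0]], [[3],[5],[1],[0,4],[7],[2,6]],
    [[5],[2,7],[3],[6],[1],[0,4]], [[2,8],[7],[1],[5,6],[4],[0]], [[0],[8],[3],[7],[5,4],[2,6]],
    [[0],[6,3],[8],[5],[4],[1,7]], [[0],[6],[1],[7,3],[5,2],[8]], [[1],[0],[2],[6,8],[4,7],[5]],
    [[7,5],[3,8],[6],[1],[0],[4]], [[8,2],[3],[7],[0],[6,4],[1]], [[2,8],[6],[4,7],[5],[1],[0]],
    [[7],[0],[8],[1],[6,5],[4,3]], [[5,6],[3],[8,7],[1],[0],[2]], [[3],[0],[1],[6],[4,8],[5,7]],
    [[2],[1],[5,3],[0],[4,8],[7]], [[3],[4,5],[0],[6],[8,2],[7]], [[1],[0],[3],[5,8],[2],[7,6]],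
    [[2],[5,7,8],[3],[1],[6],[4]], [[3,5],[1,6],[4],[0],[2],[8]], [[2],[4,6],[5],[1],[0],[3,7]],
    [[5],[6,3],[0],[4,8],[2],[1]], [[0],[8,1],[4],[6],[2,3],[5]], [[7],[2],[1],[3],[0,4],[5,8]],
    [[2],[1,6],[4,8],[7],[3],[0]], [[4,1],[7],[3],[6],[0],[5,2]], [[5],[8],[7,2],[4],[3,6],[0]],
    [[0,3],[5],[7],[2],[1],[6,4]], [[5],[1,6],[4],[2,0],[3],[8]], [[2],[8],[3,6],[1],[5,4],[0]],
    [[8],[0],[5,4],[7,2],[6],[3]], [[5],[3,0],[4,7],[8],[2],[1]], [[0],[2],[7,6],[1],[5,8],[4]],
    [[8,1],[7],[3],[4,6],[0],[5]], [[3],[7,1],[8,4],[5],[0],[6]], [[5,6],[3],[7,8],[2],[0],[1]],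
    [[8,1],[7],[5,3],[2],[6],[0]], [[8,1],[7],[3],[5],[0],[6,2]], [[4],[1],[3,7],[5,0],[8],[2]],
    [[4,2],[3],[7],[1],[8],[0,6]], [[4,2],[6],[5],[3,8],[0],[7]], [[6],[7],[0,5],[4],[1],[8,3]],
    [[0],[5],[4,1],[8,6],[3],[7]], [[8],[0,5],[2],[3],[7],[6,4]], [[2],[5],[7],[4,0],[1],[3,6]],
    [[3],[5],[6,2],[8],[0,7],[4]], [[5],[8,2],[3],[7],[0,6],[4]], [[2],[1],[3],[5,8],[7,4],[0]],
    [[0],[8],[1,4],[6,2],[3],[7]], [[2],[1],[5],[7,4],[0,3],[6]], [[5],[4],[8,2],[7],[1,6],[0]],
    [[1],[7,8],[4,0],[2],[6],[5]], [[4],[3,5],[0],[6],[8],[7,2]], [[8,2],[3],[5],[7,4],[6],[0]],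
    [[2,7],[3],[0],[1],[5],[4,8]], [[8],[2],[0],[3],[7,6],[1,5]], [[4],[3,6],[0],[8,1],[7],[5]],
    [[0],[3,7,8],[6],[1],[5],[2]], [[2],[0],[1],[6,8],[3,7],[5]], [[7],[8],[6,3],[4],[2,5],[0]],
    [[2,8],[0],[5],[3],[6,4],[7]], [[6],[7,3],[5],[0],[8,2],[4]], [[4],[3,7],[2],[0],[1],[5,6]],
    [[2],[3],[5],[7,1],[8],[0,6]], [[0,4],[8,5],[1],[2],[7],[3]], [[5,8],[4,7],[6],[3],[0],[2]],
    [[8],[2,5],[0],[6],[3],[7,4]], [[6,4],[0],[1],[2,7],[3],[5]], [[7,4],[0],[2],[5],[3],[6,8]],
    [[8],[0],[7,3],[2],[6,4],[1]], [[3],[7,2],[6],[4,8],[0],[5]], [[7,1],[8],[2],[4,5],[0],[6]],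
    [[3,7,8],[5],[1],[0],[4],[2]], [[2],[0,4],[6],[5],[1],[3,7]], [[3,7],[0,5],[4],[2],[6],[8]],
    [[3],[6],[1,7],[4],[8,2],[0]], [[1],[7],[5],[2,8],[4],[3,0]], [[4],[5],[0,6],[2],[8,1],[7]],
    [[8],[3],[4],[7,0],[5,6],[1]], [[3],[5],[4],[0],[1,6],[8,7]], [[4],[2],[8],[1],[3,7],[0,6]],
    [[5,4],[6],[0],[7],[2],[8,3]], [[5],[2],[0],[1,7],[8],[3,4]], [[6],[3],[1],[7,4],[0,2],[5]],
    [[3],[4,8],[5,7],[6],[2],[1]], [[2,5],[0],[7],[8],[6]], [[1],[5,8],[3],[0],[2],[4,7]],
    [[7,0],[6],[8],[3],[2,4],[1]], [[0],[3],[6,4,8],[2],[5],[1]], [[7],[8,2],[3],[4,5],[0],[6]],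
    [[0,5],[3,4],[1],[8],[2],[7]], [[3,7],[6],[1],[5,8],[4],[0]], [[3,5],[1,6],[4],[7],[2],[0]],
    [[7],[2,6,4],[8],[3],[1],[5]], [[2],[5],[6],[1,0],[4,8],[7]], [[0],[2],[5,8],[3],[1],[6,4]],
    [[6],[1],[0],[4],[7,8],[3,5]], [[5],[6],[2],[8],[7,3,0],[1]], [[1,6],[8],[4],[0],[2,7],[5]],
    [[8,5],[1,6],[7],[4],[0],[2]], [[5],[6],[1],[2],[4],[0,3,7]], [[4],[6],[0,5],[3],[7,1],[8]],
    [[3,2],[5,8],[4],[0],[1],[6]], [[3],[4,5],[0],[7],[1],[8,2]], [[1,5],[7],[4],[0],[2],[8,6]],
    [[2],[0,4],[5],[6,8],[3],[1]], [[8,6],[1,5],[7],[2],[0],[3]], [[4,7],[5],[3],[0],[2],[6,8]],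
    [[1,2],[6],[0,5],[3],[4],[8]], [[0],[1],[2,8],[3],[6],[5,4]], [[1,5],[3],[8],[7,4],[0],[2]],
    [[7],[8],[0,6],[1],[3],[5,4]], [[1,6],[4],[5,7],[3],[0],[2]], [[0],[1],[5,2,8],[3],[6],[4]],
    [[1],[0,4],[7],[6,8],[2],[5]], [[7,4],[5],[3],[6],[0],[8,1]], [[0],[2,5],[8],[3],[1],[6,4]],
    [[3],[7],[6,1],[0],[2,8],[4]], [[0],[6,8],[2],[7],[3],[4,5]], [[4],[0],[3],[7,6],[1,5],[8]],
    [[7],[3,2],[8],[0],[5],[6,4]], [[2],[0,3],[7],[4,6],[1],[5]], [[3],[4,2,8],[0],[6],[1],[7]],
    [[5],[4,7],[1],[2],[0,3],[6]], [[2],[7],[3],[4],[6,0],[8,5]], [[4],[6],[5],[7],[0,8],[3,1]],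
    [[4,8],[5],[2],[0],[1],[6,7]], [[0],[2,5],[6],[4],[8,7],[1]], [[7],[0],[8,3,1],[4],[6],[2]],
    [[0,1],[5,8],[7],[2],[6],[3]], [[3,8],[5],[2],[0],[1],[6,7]], [[2],[5],[7,0],[6],[3],[1,4]],
    [[6,7],[2,8],[5],[4],[0],[1]], [[0,5],[1],[8],[6],[7]], [[3],[7,4,0],[2],[1],[6],[8]],
    [[7],[1],[6,5],[3,2],[8],[0]], [[5,4],[0,3],[8],[6],[1],[2]], [[5],[3],[8,1],[7],[4,6],[0]],
    [[4],[8],[1],[7],[0,6],[3,2]], [[0],[2,7],[6],[4,8],[5],[1]], [[7],[6,4],[8],[0,5],[3],[2]],
    [[1],[7],[5,2],[0],[4],[3,6]], [[0],[7],[4,1],[8],[2,3],[6]], [[6],[3],[2,7],[8],[1],[4,5]],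
    [[3],[0],[2,8],[5],[1,6],[4]], [[7],[5,3],[4,6],[0],[8],[1]], [[3],[0],[1,6],[4],[2,7],[5]],
    [[0],[4],[5],[1,6],[3,7],[2]], [[4,7],[1],[3],[6,5],[2],[0]], [[1,5],[7],[4],[6],[8,2],[0]],
    [[1],[7],[0],[8],[2,4,3],[6]], [[3],[0],[4,5],[1],[2],[6]], [[5],[2],[0,4],[6],[1],[3]],
    [[7],[6,3],[4],[5],[0],[8]], [[3],[0],[4],[7],[1],[2,8]], [[1],[5,4],[0],[3],[7],[2]],
    [[4,6],[0],[8],[5],[7],[1]], [[4,8],[5],[6],[2],[1],[3]], [[8],[4],[2,6],[7],[1],[3]],
    [[6],[0],[7],[1],[8],[4,3]], [[7],[0],[8],[4],[5,6],[2]], [[6,4],[0],[3],[1],[2],[7]],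
    [[1],[5],[2],[0],[3],[4,8]], [[3],[1],[2],[5,8],[4],[0]], [[3],[2],[8,0],[7],[4],[1]],
    [[5],[7],[6],[3,0],[4],[2]], [[8,7],[3],[1],[6],[2],[5]], [[4],[3],[0],[2],[5],[1,6]],
    [[2],[7],[5,3],[0],[4],[1]], [[2],[0],[3],[7,8],[4],[1]], [[0],[6],[4],[7],[3,2],[8]],
    [[8,7],[2],[5],[4],[0],[3]], [[0],[7,3],[4],[8],[1],[6]], [[8],[4],[6,2],[7],[5],[0]],
    [[7],[8],[5],[6,4],[2],[1]], [[1],[0],[2],[5,8],[4],[6]], [[2],[4,7],[0],[6],[3],[8]],
    [[7],[6],[8],[0,5],[2],[4]], [[2],[0],[3],[5],[4,8],[7]], [[8],[4],[7],[2],[3,5],[0]],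
    [[5],[3],[8,7],[1],[0],[2]], [[2],[3],[7,8],[4],[0],[1]], [[0],[2],[7,8],[3],[5],[1]],
    [[3,6],[0],[7],[8],[5],[4]], [[8],[2],[6,4],[3],[7],[0]], [[0],[7],[2],[8,1],[4],[5]],
    [[2,5],[7],[6],[4],[3],[1]], [[1],[5],[4],[0],[3],[7,6]], [[5],[7],[1],[2],[3],[0,4]],
    [[5],[3],[6],[7,4],[0],[1]], [[1],[2,7],[3],[0],[4],[5]], [[4,7],[6],[3],[0],[1],[5]],
    [[5],[8],[4,0],[1],[6],[2]], [[5],[6],[8],[0,7],[4],[3]], [[3],[8],[4,0],[1],[6],[7]],
    [[2],[6],[3],[7],[8],[1,4]], [[5],[7],[0],[6,3],[1],[8]], [[6],[3],[5],[4,1],[8],[0]],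
    [[0,5],[4],[3],[7],[2],[6]], [[4],[5],[0],[6,3],[7],[8]], [[5],[0],[8],[4,3],[7],[6]],
    [[1],[5],[2],[6,7],[3],[0]], [[4],[0],[1],[6],[3],[5,8]], [[4],[7,2],[8],[6],[0],[5]],
    [[4],[5],[1],[6,8],[2],[0]], [[4],[7],[0],[6],[2],[5,8]], [[4],[6],[3],[7],[0],[5,8]],
    [[1],[0],[3,8],[6],[2],[5]], [[5],[2],[1,7],[4],[0],[3]], [[7,8],[3],[0],[4],[6],[2]],
    [[6],[0],[8],[1],[7,4],[5]], [[2],[6],[4],[0],[3],[5,8]], [[0],[3],[5],[1],[6,7],[2]],
    [[8],[4],[1],[3],[0],[2,5]], [[4],[2],[7],[8,5],[1],[6]], [[7],[2],[4,8],[0],[6],[5]],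
    [[2],[7,5],[4],[0],[3],[6]], [[1,7],[8],[3],[5],[4],[0]], [[6],[1],[8],[0],[7],[5,4]],
    [[3,0],[4],[1],[2],[8],[7]], [[0],[8],[3],[5,4],[1],[7]], [[6],[0],[5],[4],[8,1],[7]],
    [[7],[4],[8],[6],[2,3],[1]], [[1],[5],[4,7],[2],[3],[0]], [[7],[8],[4],[5],[0,6],[2]],
    [[6],[2],[7],[0],[8],[1,4]], [[2],[8],[6],[7],[0,5],[4]], [[5],[6],[4],[7],[0],[8,3]],
    [[7],[0],[5,6],[1],[8],[2]], [[2],[8,0],[7],[4],[6],[3]], [[1],[5],[7,2],[0],[4],[6]],
    [[0],[5],[3],[8],[7],[1,6]], [[7],[0],[5,3],[2],[6],[8]], [[8],[6],[3,7],[0],[5],[4]],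
    [[0],[6],[2],[8],[4,7],[5]], [[7],[3,2],[8],[0],[6],[1]], [[0],[2],[6,8],[4],[5],[1]],
    [[2],[0],[4],[8,6],[3],[1]], [[8],[2,5],[0],[6],[3],[7]], [[7],[4],[1,6],[8],[5],[3]],
    [[7],[1,6],[0],[5],[4],[8]], [[0],[4],[1],[2,7],[5],[3]], [[2],[6],[8,3],[0],[1],[5]],
    [[8],[6],[0],[5],[3],[7,1]], [[5],[1],[7],[6],[3,2],[8]], [[6],[2],[8],[4],[3],[1,7]],
    [[0],[5,4],[2],[7],[8],[6]], [[5],[1,7],[8],[2],[0],[4]], [[3],[8,4],[2],[5],[7],[1]],
    [[7,2],[6],[0],[8],[3],[5]], [[0],[8],[1,4],[5],[6],[7]], [[2],[5],[3,7],[8],[0],[6]],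
    [[8,1],[2],[6],[0],[7],[3]], [[5],[7],[8],[4],[3,2],[6]], [[0],[1],[7,8],[4],[5],[2]],
    [[4],[8],[5],[3],[6],[0,7]], [[7,4],[6],[2],[8],[0],[5]], [[5],[8],[1,4],[2],[3],[7]],
    [[7,4],[0],[1],[6],[2],[5]], [[0],[8],[2],[6],[7],[3,5]], [[6],[7],[8],[2,4],[1],[3]],
    [[0],[8],[3],[7],[4],[1,6]], [[7],[2],[6],[0],[8],[3,5]], [[3],[5,0],[8],[1],[4],[2]],
    [[8,0],[6],[4],[2],[3],[1]], [[5],[3],[0],[2],[1,8],[4]], [[1],[6],[4,3],[8],[0],[7]],
    [[1],[2],[8,5],[3],[0],[4]], [[1,2],[7],[3],[0],[4],[5]], [[7,8],[2],[0],[1],[5],[4]],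
    [[7],[3],[6],[0],[8,1],[4]], [[3],[8],[4],[1,7],[0],[6]], [[1],[0],[2,8],[7],[3],[5]],
    [[4],[3,6],[0],[8],[7],[5]], [[0],[8,1],[7],[6],[3],[5]], [[3],[5],[2],[0],[1,7],[4]],
    [[3],[5],[2],[1],[7,4],[0]], [[3],[6,5],[4],[8],[0],[7]], [[5],[8],[4],[7],[0],[6,2]],
    [[1],[2],[8,4],[0],[3],[5]], [[3,6],[0],[8],[5],[7],[4]], [[7],[2],[0],[4],[1],[3,6]],
    [[6],[8],[4],[1,7],[0],[5]], [[5],[3,8],[6],[1],[0],[4]], [[8],[0],[5],[4],[7,2],[6]],
    [[5],[3,4],[7],[8],[6],[2]], [[6],[7],[5],[2,3],[8],[0]], [[0],[5],[6,2],[7],[3],[8]],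
    [[2,6],[0],[5],[7],[8],[3]], [[3],[7,8],[4],[5],[1],[0]], [[7],[3],[0],[2],[5],[1,6]],
    [[3],[8],[1],[2,5],[7],[4]], [[5],[8,4],[0],[3],[1],[2]], [[0],[5,8],[3],[7],[2],[6]],
    [[6],[2],[5],[0],[8,1],[7]], [[5],[8,7],[2],[1],[3],[6]], [[4],[5],[1],[2,8],[3],[0]],
    [[4],[5],[1,2],[6],[3],[0]], [[7,4],[6],[0],[8],[3],[5]], [[0,5],[2],[6],[7],[3],[8]],
    [[2],[1],[6],[5],[3,8],[7]], [[7],[5],[0],[6],[1],[8,2]], [[4],[8,5],[2],[0],[3],[6]],
    [[4],[8],[0,5],[3],[7],[6]], [[3],[2],[7],[5],[8],[0,6]], [[0],[7],[5,2],[6],[3],[8]],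
    [[2],[6],[0],[8,3],[4],[5]], [[1],[8],[3,4],[6],[0],[7]], [[0],[1],[6],[3],[2],[7,4]],
    [[2],[1],[5,7],[3],[0],[4]], [[2],[1],[4],[0],[3],[8,7]], [[8,3],[6],[5],[0],[7],[4]],
    [[0],[3],[5],[2,8],[6],[1]], [[3],[6,4],[1],[8],[0],[7]], [[7],[5],[2],[6],[1],[0,3]],
    [[8],[0],[5,6],[1],[7],[3]], [[1],[0],[4],[5,8],[3],[2]], [[2,3],[6],[1],[7],[0],[8]],
    [[5],[4],[6],[8,3],[7],[0]], [[1],[3],[8],[7,4],[0],[2]], [[1],[2,0],[3],[7],[5],[6]],
    [[4],[2],[1],[7],[8,5],[3]], [[5],[4],[3,7],[8],[2],[6]], [[0,8],[1],[4],[7],[2],[6]],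
    [[7],[1],[0],[3,5],[6],[4]], [[2],[0],[4,8],[6],[3],[5]], [[1,6],[7],[2],[0],[4],[5]],
    [[1],[2],[7],[4],[3,6],[8]], [[5],[0],[7,3],[8],[6],[2]], [[6],[0],[8,1],[3],[7],[4]],
    [[8],[5],[0],[7],[6]], [[2],[6],[7],[1],[8],[0,5]], [[7],[1],[3],[4],[2,8],[5]],
    [[8],[6],[4],[5],[0],[7,1]], [[3],[2],[7],[6],[8,5],[4]], [[6],[2],[7],[0],[8,1],[4]],
    [[0],[8],[2,3],[6],[4],[7]], [[3,5],[0],[7],[2],[8],[6]], [[5],[2],[8],[0],[6,3],[4]],
    [[8],[2],[0],[3],[1,7],[4]], [[2],[3,7],[4],[5],[1],[0]], [[5],[1],[6],[4],[0],[3,7]],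
    [[3,4],[5],[0],[6],[8],[7]], [[0,5],[4],[1],[8],[2],[7]], [[2],[5,7],[4],[0],[3],[1]],
    [[0,7],[2],[6],[5],[3],[8]], [[8],[3],[0],[2],[5],[1,6]], [[0],[3,7],[6],[1],[5],[4]],
    [[4,2],[5],[1],[7],[3],[0]], [[2],[5],[6,4],[0],[1],[3]], [[3],[6],[4],[2,7],[0],[8]],
    [[8,6],[4],[0],[2],[7],[3]], [[0],[8],[3],[5,4],[6],[7]], [[1,6],[5],[0],[7],[4],[8]],
    [[4],[3],[8,6],[2],[1],[7]], [[2],[4],[1,8],[7],[6],[3]], [[6,2],[8],[0],[5],[4],[7]],
    [[7,5],[3],[1],[4],[2],[8]], [[1],[4],[3,7],[8],[6],[2]], [[6],[7],[4],[5],[0,8],[1]],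
    [[5],[0],[8,2],[6],[7],[3]], [[7],[2],[8],[0],[6],[5,4]], [[2,7],[3],[0],[1],[6],[4]],
    [[5,8],[3],[0],[2],[1],[4]], [[2],[6],[0],[8,4],[5],[7]], [[3],[0],[1],[6,8],[4],[5]],
    [[2],[4],[3],[6,7],[1],[8]], [[1],[2],[8],[3],[0,4],[5]], [[1],[3],[5],[2],[0],[4,6]],
    [[2],[4],[6],[1],[0],[3,5]], [[7],[5],[1],[6],[0],[8,3]], [[5],[2,7],[3],[1],[0],[4]],
    [[0],[4],[8,6],[1],[5],[3]], [[0],[2,3],[6],[1],[5],[4]], [[4],[6],[0,5],[1],[8],[7]],
    [[4],[6],[7],[3],[8],[0,5]], [[7],[3],[8,4],[2],[6],[0]], [[2],[0,4],[7],[5],[1],[3]],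
    [[2],[6],[0,5],[4],[3],[8]], [[8],[7],[1],[5],[4],[0,3]], [[3],[0,4],[6],[8],[2],[1]],
    [[2,3],[8],[4],[6],[0],[7]], [[3],[1],[2],[0],[4],[5,7]], [[3],[0],[2],[1],[4],[6,7]],
    [[4],[7,8],[3],[0],[1],[5]], [[0],[1],[5],[2],[3],[8,4]], [[6],[0],[5],[2],[8,1],[4]],
    [[0,5],[4],[8],[6],[2],[7]], [[1],[3,5],[6],[2],[0],[4]], [[3],[6],[4],[0],[1],[5,8]],
    [[6,7],[4],[5],[2],[0],[1]], [[1],[6],[2],[0],[4,3],[5]], [[0],[5],[3,2],[6],[4],[8]],
    [[7],[0],[6],[2,3],[5],[4]], [[2],[7],[3,0],[1],[6],[8]], [[6],[7],[1,5],[0],[8],[4]],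
    [[0],[8],[3],[7],[4],[2,6]], [[6],[2,4],[5],[0],[8],[7]], [[7],[2],[8],[0],[6],[5,3]],
    [[5],[7],[3],[8],[0,6],[4]], [[4],[5],[6],[3],[8],[0,7]], [[2],[0],[3],[6],[4,8],[7]],
    [[0,1],[5],[7],[3],[6],[2]], [[8],[7],[0],[6],[3],[5,2]], [[3],[6],[5,4],[0],[1],[2]],
    [[5],[3],[6],[1],[0,2],[8]], [[2],[0],[3],[6,7],[4],[5]], [[0],[7],[3,2],[8],[5],[6]],
    [[6],[2,7],[5],[0],[8],[4]], [[1],[7],[5],[6],[2],[4,0]], [[1],[2,6],[3],[0],[4],[5]],
    [[6,4],[8],[5],[0],[7],[2]], [[8,1],[4],[3],[2],[7],[5]], [[6],[1],[8,2],[4],[7],[0]],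
    [[0],[3],[1],[4],[8,6],[2]], [[3],[5],[6],[1],[7],[4,0]], [[6],[1],[2],[8,4],[0],[3]],
    [[7],[4,2],[8],[6],[5],[0]], [[4],[6],[2],[0],[1],[3,7]], [[0],[7],[3],[6,4],[2],[8]],
    [[1],[3],[2],[4],[0]], [[2,3],[5],[4],[8],[0],[7]], [[2],[3,8],[0],[5],[7],[6]],
    [[5],[8],[0],[6],[1],[7,3]], [[6],[0],[7],[3],[8],[5,4]], [[8],[2],[0],[4],[5],[1,6]],
    [[0],[5],[2],[8],[6,3],[7]], [[8],[7],[3],[2,6],[0],[5]], [[6],[2],[8],[0],[7],[5,4]],
    [[5],[2],[6],[4,3],[7],[0]], [[2],[7],[5],[3,8],[0],[6]], [[4],[0],[1],[5],[2],[3,8]],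
    [[6],[0,8],[4],[2],[7],[3]], [[2,8],[7],[4],[0],[1],[6]], [[8],[3],[5,6],[2],[7],[0]],
    [[7],[5,3],[8],[0],[6],[1]], [[2],[8],[5],[4,6],[0],[7]], [[3],[6],[2,8],[5],[0],[7]],
    [[2,5],[0],[8],[3],[6],[7]], [[8],[2],[3],[6,7],[4],[1]], [[3],[4],[8],[6],[7],[0,5]],
    [[5],[1],[0],[2,6],[3],[4]], [[6,3],[5],[8],[2],[7],[0]], [[8,2],[5],[6],[1],[7],[0]],
    [[5,1],[0],[4],[7],[2],[6]], [[7],[5],[4,1],[8],[0],[6]], [[6],[4],[5],[8],[1,7],[0]],
    [[0],[5],[4,8],[6],[2],[7]], [[5],[2,4],[8],[0],[6],[7]], [[5],[2],[4,8],[0],[6],[3]],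
    [[0],[7],[1,4],[5],[2],[8]], [[8],[6],[4,2],[7],[0],[5]], [[3],[7],[8],[6],[0,5],[4]],
    [[1],[3,5],[0],[7],[6],[8]], [[2],[0],[3],[6],[4,8],[5]], [[6],[3],[7],[4,2],[8],[0]],
    [[2,4],[6],[1],[7],[0],[8]], [[6],[3],[5],[0,7],[2],[4]], [[4],[3],[8],[7],[6],[0,5]],
    [[0],[3],[6],[4,8],[2],[1]], [[7],[1],[8],[4],[2,6],[0]], [[6],[2],[0],[3],[1],[4,5]],
    [[3,1],[8],[0],[7],[2],[6]], [[6,3],[7],[5],[0],[8],[2]], [[7],[2],[8],[1],[4,6],[0]],
    [[1],[7],[6],[4,5],[0],[8]], [[8],[7],[0,5],[3],[2],[6]], [[7],[5],[8,4],[2],[6],[0]],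
    [[4],[8],[0],[6],[1],[7,5]], [[5],[8,1],[7],[2],[6],[0]], [[4],[6],[0],[7,8],[2],[5]],
    [[4],[0],[3],[7,5],[2],[1]], [[1],[6,7],[2],[0],[4],[5]], [[0],[3],[7],[4,5],[8],[2]],
    [[8,2],[4],[5],[1],[6],[0]], [[6],[0],[8],[2,4],[7],[5]], [[8],[1],[7],[0,5],[3],[2]],
    [[8],[1],[4],[3],[2],[7,0]], [[7,4],[2],[5],[8],[6],[3]], [[7],[2],[6],[4],[0],[3,5]],
    [[5],[0,8],[3],[4],[6],[7]], [[3],[8,1],[4],[7],[0],[5]], [[8],[7],[1],[5,4],[3],[6]],
    [[0],[2],[5],[4],[7,8],[3]], [[4],[1],[3],[0],[2],[5]], [[3],[4],[7],[2],[8],[6]],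
    [[4],[7],[8],[2],[1],[6]], [[6],[8],[0],[5],[4],[7]], [[0],[6],[3],[7],[2],[8]], [[5],[4],[3],[2],[1],[8]],
    [[7],[5],[2],[4],[8],[1]], [[6],[5],[0],[7],[3],[8]], [[5],[1],[6],[4],[0],[2]], [[0],[6],[3],[5],[4],[7]],
    [[8],[3],[7],[0],[6],[1]], [[2],[5],[0],[7],[4],[6]], [[4],[8],[0],[6],[1],[7]], [[4],[8],[5],[6],[0],[7]],
    [[1],[0],[4],[6],[3],[2]], [[0],[7],[2],[8],[1],[6]], [[0],[6],[4],[8],[2],[5]], [[7],[2],[1],[4],[8],[6]],
    [[0],[5],[3],[6],[4],[8]], [[6],[3],[8],[0],[5],[2]], [[8],[4],[6],[0],[7],[3]], [[5],[4],[7],[0],[6],[8]],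
    [[6],[1],[7],[3],[2],[8]], [[6],[0],[7],[3],[8],[5]], [[1],[4],[6],[8],[7],[3]], [[6],[1],[5],[7],[2],[8]],
    [[2],[7],[3],[6],[4],[0]], [[4],[6],[0],[7],[2],[8]], [[6],[8],[3],[2],[1],[4]], [[5],[2],[6],[0],[7],[8]],
    [[1],[3],[6],[5],[4],[2]], [[3],[1],[4],[0],[2],[6]], [[4],[2],[3],[5],[1],[0]], [[7],[4],[8],[2],[3],[1]],
    [[7],[3],[5],[0],[6],[2]], [[8],[3],[4],[7],[1],[6]], [[3],[7],[1],[4],[8],[2]], [[0],[6],[3],[7],[1],[5]],
    [[0],[1],[5],[3],[6],[4]], [[1],[7],[3],[8],[5],[4]], [[4],[0],[3],[1],[2],[8]], [[2],[1],[4],[5],[7],[6]],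
    [[0],[4],[7],[1],[5],[3]], [[6],[3],[5],[2],[0],[1]], [[2],[5],[4],[6],[3],[0]], [[3],[8],[4],[5],[2],[0]],
    [[7],[4],[8],[0],[5],[3]], [[3],[0],[2],[7],[4],[5]], [[8],[1],[7],[2],[4],[3]], [[3],[6],[7],[8],[0],[5]],
    [[2],[3],[1],[7],[6],[8]], [[4],[7],[1],[6],[3],[0]], [[5],[8],[7],[0],[6],[3]], [[1],[2],[8],[7],[5],[6]],
    [[3],[1],[2],[0],[4],[7]], [[1],[7],[0],[5],[4],[6]], [[6],[5],[7],[0],[8],[2]], [[0],[4],[7],[2],[6],[1]]]"

text \<open>
  The permutative rule \<open>r_commute\<close> is used for ordered rewriting, so that \<open>r i j\<close> and \<open>r j i\<close>
  become the same propositional atom.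
\<close>

lemma balanced_vertex_core:
  fixes r :: "nat \<Rightarrow> nat \<Rightarrow> bool"
  assumes r_commute: "\<And>i j. r i j = r j i"
    and certs: "list_all (\<lambda>ss. bicoloured r (seg_pairs ss)) segments_balanced"
    and v: "r 0 1" "r 0 2" "r 0 3" "r 0 4" "\<not> r 0 5" "\<not> r 0 6" "\<not> r 0 7" "\<not> r 0 8"
    and quad: "sorted_quad (r 1 2) (r 1 3) (r 1 4) (r 2 3) (r 2 4) (r 3 4)"
    and columns: "lexge [r 1 5, r 2 5, r 3 5, r 4 5] [r 1 6, r 2 6, r 3 6, r 4 6]"
      "lexge [r 1 6, r 2 6, r 3 6, r 4 6] [r 1 7, r 2 7, r 3 7, r 4 7]"
      "lexge [r 1 7, r 2 7, r 3 7, r 4 7] [r 1 8, r 2 8, r 3 8, r 4 8]"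
  shows False
    using certs[unfolded segments_balanced_def list.pred_inject, unfolded clause_simps, simplified r_commute]
      quad[unfolded sorted_quad_def lexge.simps, simplified r_commute]
      columns[unfolded lexge.simps, simplified r_commute] v[simplified r_commute]
  by sat
text \<open>Indices 0 to 4 stand for the vertices with at most three red neighbours, 5 to 8 for the
  other four.\<close>

definition segments_low :: "nat list list list" where
  "segments_low = [
    [[5],[8,4],[7,3],[2],[6,0],[1]], [[7,8],[2],[5,0],[1],[6,3],[4]], [[5,3],[2],[6,4],[8],[7],[1,0]],
    [[4,2],[5],[3,8],[6],[0,1],[7]], [[6],[0,1],[7],[3,2],[5,4],[8]], [[0],[5,4],[8],[6,2],[3],[7,1]],
    [[1],[6],[3,4],[7,8],[2],[5,0]], [[0,1],[7,8],[2],[6],[3,4],[5]], [[5,0],[1],[7],[4,2],[6],[8,3]],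
    [[0,1],[7],[8,3],[6,4],[2],[5]], [[5],[3,4],[7],[8,2],[6],[1,0]], [[7],[2,3],[6],[8,4],[5],[0,1]],
    [[4,2],[6],[0,1],[7,8],[3],[5]], [[8,2],[5],[0,1],[7,4],[3],[6]], [[6,2],[3],[7,4],[8],[5,0],[1]],
    [[0],[5,3],[8],[6,4],[2],[7,1]], [[6,2],[3],[5],[0,1],[7,8],[4]], [[0],[6,8],[2],[5],[4,3],[7,1]],
    [[8],[7,1],[0],[5,2],[4],[6,3]], [[0],[5,4],[2],[6,3],[8],[7,1]], [[6],[1,0],[5],[2,4],[7],[3,8]],
    [[0],[6,8],[3],[5],[2,4],[7,1]], [[7,1],[0],[6,4],[8],[5],[2,3]], [[5],[4,8],[7,3],[2],[6],[1,0]],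
    [[2],[6],[1,0],[5],[4,3],[7,8]], [[1,0],[6],[2,4],[5,3],[8],[7]], [[7,1],[0],[5],[2,4],[6],[8,3]],
    [[5,8],[2],[7],[1,0],[6],[3,4]], [[2,8],[6],[4,3],[5],[0,1],[7]], [[8,3],[5],[0,1],[7],[4,2],[6]],
    [[4,2],[5],[3,8],[7,1],[0],[6]], [[1],[7],[3,4],[6,2],[8],[5,0]], [[6],[2,8],[7],[1,0],[5,4],[3]],
    [[5],[8,2],[7],[1,0],[6],[3,4]], [[6,4],[3],[5,2],[8],[7,1],[0]], [[4,8],[7],[1,0],[5,2],[3],[6]],
    [[7,8],[3],[5],[1,0],[6],[2,4]], [[6],[0,1],[7,2],[8],[5],[3,4]], [[1],[7,3],[2],[5,8],[4],[6,0]],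
    [[3],[6],[2,4],[5],[0,1],[7,8]], [[5,2],[3],[6],[0,1],[7],[4,8]], [[8,3],[7],[4,2],[5,0],[1],[6]],
    [[8],[6],[3,2],[5,0],[1],[7,4]], [[3,4],[6,2],[8],[7,1],[0],[5]], [[5],[2,3],[7,8],[4],[6,0],[1]],
    [[1,0],[5],[4,8],[7],[3,2],[6]], [[3,8],[5,0],[1],[6,2],[4],[7]], [[5,0],[1],[7],[8,2],[6,3],[4]],
    [[5,3],[8],[6],[0,1],[7,4],[2]], [[3,8],[5],[0,1],[7,2],[4],[6]], [[5],[0,1],[7],[8,2],[6],[4,3]],
    [[6,2],[3],[7,1],[0],[5],[8,4]], [[0],[6,8],[4],[5],[3,2],[7,1]], [[8],[5],[1,0],[6],[4,2],[7,3]],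
    [[5,8],[3],[7,1],[0],[6,4],[2]], [[0],[6],[2,8],[5],[3,4],[7,1]], [[5],[4,3],[6,2],[8],[7,1],[0]],
    [[8,2],[5,4],[3],[6],[0,1],[7]], [[5,0],[1],[6],[2,8],[7],[4,3]], [[2],[6],[0,1],[7],[4,3],[5,8]],
    [[7,1],[0],[5],[2,3],[6],[4,8]], [[3,2],[7,8],[4],[6,0],[1],[5]], [[6],[2,8],[5,0],[1],[7,3],[4]],
    [[4,8],[5,0],[1],[7],[3,2],[6]], [[8],[7],[2,3],[5],[1,0],[6,4]], [[2,3],[6],[8,4],[7,1],[0],[5]],
    [[7,1],[0],[5,8],[2],[6],[4,3]], [[7],[3,2],[6,4],[8],[5,0],[1]], [[3,8],[5],[1,0],[6],[2,4],[7]],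
    [[7],[3,8],[6,2],[4],[5,0],[1]], [[3],[5],[1,0],[6],[8,2],[7,4]], [[5],[1,0],[6],[4,3],[7,8],[2]],
    [[5],[3,2],[7,1],[0],[6],[8,4]], [[5],[8,2],[7,1],[0],[6],[4,3]], [[2],[6,4],[3],[5,0],[1],[7,8]],
    [[2],[7,1],[0],[5],[3,8],[6,4]], [[7,1],[0],[5],[8,4],[6,3],[2]], [[7],[4,2],[6],[1,0],[5],[8,3]],
    [[7,1],[0],[5],[8,3],[6],[4,2]], [[1,0],[6,3],[4],[5,8],[2],[7]], [[7,1],[0],[6],[4,2],[5,8],[3]],
    [[3,8],[5],[1,0],[6,2],[4],[7]], [[7],[8,4],[5,0],[1],[6],[2,3]], [[1],[6],[8,3],[7,4],[2],[5,0]],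
    [[1,0],[6,4],[3],[7],[2,8],[5]], [[5,3],[4],[6],[0,1],[7,8],[2]], [[0,1],[7,4],[3],[5],[2,8],[6]],
    [[5,2],[8],[6],[4,3],[7],[1,0]], [[5],[0,1],[7,8],[4],[6],[3,2]], [[6],[2,3],[5,0],[1],[7,8],[4]],
    [[5],[3,8],[7,4],[2],[6],[1,0]], [[7,1],[0],[6,3],[8],[5],[2,4]], [[7],[1,0],[5,4],[3],[6,2],[8]],
    [[5],[3,4],[7,8],[2],[6,0],[1]], [[3],[6,4],[8],[7,1],[0],[5,2]], [[6],[1,0],[5],[8,4],[7,3],[2]],
    [[7],[2,8],[6,4],[3],[5],[0,1]], [[6],[8,2],[7,1],[0],[5],[4,3]], [[1,0],[5,8],[4],[7,2],[3],[6]],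
    [[5,2],[4],[7,8],[3],[6],[1,0]], [[6,3],[4],[5],[0,1],[7,8],[2]], [[3,2],[6,8],[4],[5,0],[1],[7]],
    [[0,1],[7,3],[8],[5],[4,2],[6]], [[1,0],[5,4],[8],[6,2],[3],[7]], [[6],[1,0],[5],[3,8],[7],[4,2]],
    [[4],[5],[0,1],[7],[3,8],[6,2]], [[4],[6],[1,0],[5,8],[3],[7,2]], [[1,0],[5],[8,2],[6],[4,3],[7]],
    [[8],[7,1],[0],[5],[4,2],[6,3]], [[6,0],[1],[5,3],[2],[7],[4,8]], [[7,2],[8],[5],[1,0],[6],[4,3]],
    [[0],[6,2],[8],[5],[4,3],[7,1]], [[3,8],[1,5],[0],[7,2],[4],[6]], [[8,4],[7,1],[0],[5,3],[2],[6]],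
    [[6],[0,1],[7],[2,4],[5,8],[3]], [[4],[6],[0,1],[7,2],[3],[5,8]], [[6],[4,2],[5],[8,3],[7,1],[0]],
    [[6],[0,1],[7],[8,2],[5,3],[4]], [[7,4],[2],[6,0],[1],[5],[8,3]], [[7,8],[3],[5],[2,4],[6],[0,1]],
    [[7,1],[0],[5],[4,3],[6,8],[2]], [[5],[8,4],[7,1],[0],[6,2],[3]], [[0],[5,2],[3],[6,8],[4],[7,1]],
    [[5,4],[3],[6,8],[2],[7,1],[0]], [[6],[8,3],[7],[1,0],[5,4],[2]], [[0,1],[7],[8,2],[6],[3,4],[5]],
    [[6],[3,8],[7],[1,0],[5,4],[2]], [[5,8],[4],[6,2],[3],[7,1],[0]], [[6],[4,2],[7,1],[0],[5,3],[8]],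
    [[5],[0,1],[7],[4,3],[6],[8,2]], [[3,8],[6,0],[1],[5,4],[2],[7]], [[6],[1,0],[5],[2,4],[7],[8,3]],
    [[3],[6,4],[8],[5],[0,1],[7,2]], [[4,8],[5],[2,3],[6],[0,1],[7]], [[3,2],[7,4],[8],[5],[1,0],[6]],
    [[1],[6,2],[8],[7],[4,3],[5,0]], [[5],[0,1],[7],[4,8],[6,2],[3]], [[8,2],[5],[0,1],[7,3],[4],[6]],
    [[1,0],[5,3],[4],[7,2],[8],[6]], [[5,4],[2],[6],[8,3],[7,1],[0]], [[6],[1,0],[5,2],[8],[7,4],[3]],
    [[5,0],[1],[6,4],[8],[7,3],[2]], [[2,3],[5,8],[4],[7,1],[0],[6]], [[7,8],[2],[6,4],[3],[5],[0,1]],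
    [[5,3],[2],[6],[0,1],[7,8],[4]], [[7,2],[3],[6,8],[4],[5,0],[1]], [[5,2],[3],[6],[8,4],[7,1],[0]],
    [[7],[2,3],[6,8],[4],[5],[0,1]], [[0],[5],[3,8],[6],[4,2],[7,1]], [[7],[8,3],[5,2],[4],[6],[0,1]],
    [[6],[4,2],[7],[8,3],[5,0],[1]], [[7],[4,3],[6],[8,2],[5,0],[1]], [[2,3],[5,4],[8],[6],[0,1],[7]],
    [[0,1],[7,3],[2],[5,4],[8],[6]], [[8,4],[5,0],[1],[6],[3,2],[7]], [[2],[6,3],[4],[7],[1,0],[5,8]],
    [[6],[1,0],[5,8],[4],[7,3],[2]], [[5],[2,3],[7,1],[0],[6,8],[4]], [[1],[5],[4,2],[7,8],[3],[6,0]],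
    [[2],[6],[1,0],[5,8],[3],[7,4]], [[4],[7,3],[2],[5,0],[1],[6,8]], [[2],[6],[8,4],[7],[1,0],[5,3]],
    [[7,4],[3],[6],[2,8],[5,0],[1]], [[7],[3,2],[5,0],[1],[6,4],[8]], [[7],[3,4],[5,0],[1],[6],[8,2]],
    [[7],[4,2],[6,3],[8],[5,0],[1]], [[2],[6],[1,0],[5,3],[8],[7,4]], [[5,0],[1],[6,3],[8],[7],[2,4]],
    [[5,0],[1],[6,3],[8],[7],[4,2]], [[0,1],[7,4],[3],[6,2],[8],[5]], [[1],[0],[5,3],[8],[6,4],[7]],
    [[4],[0,8],[1],[3],[7],[2,5]], [[2],[7],[3,5],[4],[0,8],[1]], [[6],[2,3],[5,0],[1],[7],[8]],
    [[3],[0,8],[1],[2],[4]], [[7],[8],[6,2],[3],[5,0],[1]], [[1],[5],[8],[7],[3,2],[6,0]],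
    [[1,0],[5],[4,7],[3],[8],[6]], [[8],[6,4],[2],[7,1],[0],[5]], [[5],[8],[6,3],[2],[7,1],[0]],
    [[4],[1,8],[0],[2,5],[3],[7]], [[0],[3,5],[4],[2],[1]], [[2],[3],[4,7],[1],[0]],
    [[6],[4,2],[5],[0,1],[7],[8]], [[3],[2],[1,8],[0],[7],[4,5]], [[8],[1],[5],[2],[7,4],[0,6]],
    [[7,1],[0],[6],[8],[5],[3,4]], [[4,6],[0],[2],[3],[1]], [[5,4],[7],[2],[0,1],[6],[8]],
    [[6],[8],[5],[3,2],[7,1],[0]], [[6],[3],[4,8],[1],[5],[2,7]], [[6],[3,5],[2],[4],[0,8],[1]],
    [[0],[5],[3,4],[6],[8],[7,1]], [[5,3],[2],[7,1],[0],[6],[8]], [[0],[6],[8],[5,2],[3],[7,1]],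
    [[6],[8],[5],[4,2],[7],[1,0]], [[4,5],[2],[0],[1],[3]], [[1,8],[0],[3],[4,5],[2],[6]],
    [[0],[3],[1],[4,6],[2]], [[0],[5],[7,3],[1],[6,4],[2]], [[8],[5,0],[1],[7,3],[4],[6]],
    [[0,7],[4],[1],[2],[3],[6,8]], [[4,8],[6],[0],[5],[1],[7,3]], [[3],[0,8],[1],[6],[2],[4,5]],
    [[4,2],[6],[8],[7,1],[0],[5]], [[6],[2,4],[7],[1,0],[5],[8]], [[5],[8],[7],[2,4,1],[6],[0]],
    [[1],[7],[3,4],[5],[8],[6,0]], [[3],[4],[1,8],[0],[7],[2,5]], [[7],[8],[6],[1,0],[5,4],[2]],
    [[3],[1,6],[4],[2],[0]], [[0],[2,5],[4],[7],[3],[1,8]], [[6],[1,8],[0],[4,5],[3],[2]],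
    [[6,3],[4],[5,0],[1],[7],[8]], [[5],[8],[7,1],[0],[6],[4,3]], [[7,3],[4],[5,0],[2],[8],[6]],
    [[5,2],[7],[1],[8,3],[6],[0]], [[2,4],[8],[5],[7],[6,1],[0]], [[6],[1],[7],[3,8,2],[5],[0]],
    [[5],[8],[7],[4,3],[6,0],[1]], [[0,8],[1],[6],[4],[3,5],[2]], [[5,0],[1],[7,3],[2],[6],[8]],
    [[4],[6],[3],[0,8],[1],[2,5]], [[1],[4,3],[7],[6],[8],[2,0]], [[6],[2,4],[5],[8],[7,1],[0]],
    [[3],[6],[1,0],[5],[8],[7,4]], [[0],[5],[8],[6],[2,4],[7,1]], [[3],[1,5],[4],[0],[2]],
    [[6],[1],[0,2,8],[3],[7],[5]], [[7],[1],[5,3],[4,8],[6],[0]], [[2],[7,3],[5],[8],[6],[1,0]],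
    [[3,5],[4,7],[1],[8],[0],[2]], [[5],[8],[6,2],[4],[7],[1,0]], [[0],[7,8],[1],[6,4],[3],[5]],
    [[7,3],[2],[6],[8],[5],[0,1]], [[6],[4,3],[7],[8],[5],[1,0]], [[0],[1],[3],[2],[4,7]],
    [[5],[6,3],[4],[2],[7],[8]], [[0],[6],[3],[7],[2,8],[4]], [[3],[1,6],[7],[0],[8],[4]],
    [[1],[3],[0],[4],[2],[6,5]], [[2],[0],[3],[1],[4],[5,8]], [[0],[2],[1],[3],[6,7],[4]],
    [[0,8],[1],[3],[7],[4],[2]], [[2],[7],[0,8],[1],[3],[4]], [[2],[3],[0,7],[5],[1],[4]],
    [[7],[3,6],[4],[1],[0],[2]], [[0],[4],[2],[3,5],[1],[8]], [[0],[2],[3],[8,6],[4],[1]],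
    [[1],[7],[6],[0],[5,3],[8]], [[2],[4],[6],[5],[3,8],[7]], [[1,4],[2],[6],[0],[5],[7]],
    [[0],[7],[4],[3,2],[1],[8]], [[0],[4,6],[3],[1],[7],[2]], [[2],[4],[0],[1,6],[5],[3]],
    [[2],[5],[8,0],[7],[4],[1]], [[1],[0],[2],[6,4],[7],[3]], [[3],[2],[5],[1],[0,7],[4]],
    [[8],[4],[2],[7,5],[0],[6]], [[0],[3],[4],[6,1],[2],[8]], [[3],[7],[4],[1],[2,6],[0]],
    [[2],[6],[3],[0],[4,7],[1]], [[8],[2],[3],[1,7],[4],[0]], [[1],[8,0],[6],[4],[5],[2]],
    [[2],[4],[8],[5],[0,6],[7]], [[5],[7],[1],[4],[8,6],[0]], [[1],[8],[3],[4],[0,6],[2]],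
    [[1],[0],[6],[7],[5,2],[8]], [[2],[3],[0],[4],[1,5],[8]], [[6,1],[7],[8],[5],[4],[2]],
    [[1],[4],[2],[3],[6,7],[0]], [[7],[3,6],[2],[1],[8],[0]], [[1],[6],[2],[8,7],[0],[5]],
    [[4],[7,5],[2],[0],[1],[3]], [[8,7],[4],[2],[0],[1],[3]], [[1],[4,6],[3],[0],[8],[2]],
    [[4],[2],[0],[8],[1,3],[7]], [[0],[2],[3,5],[8],[4],[1]], [[0],[8,5],[1],[4],[3],[2]],
    [[6],[2],[7],[8],[4],[5,3]], [[3],[2],[6],[1,8],[0],[4]], [[3,4],[6],[0],[8],[1],[7]],
    [[3],[7],[4,5],[2],[0],[1]], [[2,7],[3],[1],[4],[0],[8]], [[6],[2],[0,8],[1],[4],[3]],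
    [[0],[6,2],[1],[7],[4],[3]], [[4],[1],[0],[3],[2],[8,6]], [[1,7],[8],[2],[0],[4],[3]],
    [[2],[0,7],[6],[1],[3],[4]], [[4],[0],[3],[1,2],[8],[7]], [[7],[1],[8],[0,6],[3],[2]],
    [[2],[4],[7],[8,3],[6],[5]], [[7],[6],[4],[8],[5],[3,2]], [[7,3],[5],[0],[6],[8],[1]],
    [[1],[3],[6],[5],[7],[2,0]], [[8],[1],[0],[2],[3],[4,6]], [[2],[1],[4,6],[3],[0],[7]],
    [[1],[7,5],[4],[2],[3],[0]], [[5,2],[6],[8],[4],[3],[7]], [[8],[0],[1],[2],[3],[4,5]],
    [[2],[1],[3],[0],[7,5],[4]], [[2],[5],[4],[3],[0,8],[1]], [[1,6],[8],[0],[3],[2],[4]],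
    [[1],[3],[6],[2],[0,7],[4]], [[2],[8],[3,6],[4],[0],[1]], [[5],[4],[2],[3],[0,8],[1]],
    [[8],[2,4],[0],[6],[7],[5]], [[4],[1],[0],[2],[3,5],[7]], [[2],[1],[3],[0],[8,6],[4]],
    [[8],[3],[0],[1],[2,5],[4]], [[5],[8],[3],[6,7],[4],[2]], [[0],[4,6],[8],[3],[1],[2]],
    [[3],[4],[5,6],[0],[2],[1]], [[0],[8],[1],[2],[4,5],[3]], [[7,8],[4],[1],[3],[2],[0]],
    [[6],[3],[2],[0],[8],[1,4]], [[3],[4],[2],[1],[6,8],[0]], [[7],[4],[1],[3],[0],[2,6]],
    [[3],[1],[8,7],[2],[4],[0]], [[3,5],[4],[1],[0],[7],[2]], [[6],[7],[5],[2,4],[3],[8]],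
    [[0],[5],[8,4],[1],[7],[6]], [[3],[4],[8],[0,7],[1],[2]], [[5],[8,2],[7],[3],[4],[6]],
    [[2],[1],[4],[0],[3],[8,5]], [[1],[7],[2],[4,5],[3],[8]], [[6,0],[5],[1],[7],[8],[4]],
    [[8],[4],[7,1],[5],[0],[6]], [[0,1],[6],[7],[4],[8],[5]], [[8],[5],[1,3],[0],[7],[4]],
    [[6],[8],[5],[0],[1,7],[3]], [[1],[2],[3],[0],[7,6],[4]], [[2],[5],[4],[1],[3,0],[6]],
    [[5,8],[4],[7],[6],[3],[2]], [[2],[6],[7],[8],[3],[5,4]], [[2],[3,4],[0],[8],[1],[7]],
    [[6],[7],[3],[8],[5],[4,2]], [[4],[3],[8],[1],[2],[0,7]], [[1],[4],[0],[2],[6,5],[3]],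
    [[5],[6],[0,4],[1],[2],[3]], [[1],[5],[2],[6],[4],[0,3]], [[6],[2],[7],[0,3],[1],[8]],
    [[0],[1],[7,2],[5],[8],[6]], [[2],[0],[3],[1],[4],[7,5]], [[2],[6],[5],[3,8],[4],[7]],
    [[8],[1,5],[0],[6],[7],[4]], [[0],[1],[3],[8],[4,6],[2]], [[2],[0],[8],[4,5],[1],[3]],
    [[6],[0,8],[1],[2],[3],[4]], [[3,6],[1],[7],[0],[8],[2]], [[6,2],[5],[8],[4],[3],[7]],
    [[3],[6,5],[4],[0],[2],[1]], [[0],[5],[6],[1],[7,4],[2]], [[1,5],[6],[2],[7],[3],[8]],
    [[6],[4],[7],[5],[1,0],[2]], [[3],[1,7],[0],[8],[2],[4]], [[2,8],[3],[7],[4],[6],[5]],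
    [[7],[0],[4],[1],[8],[2,5]], [[1,8],[0],[3],[5],[7],[2]], [[1,0],[4],[7],[6],[8],[5]],
    [[4],[1],[2],[0,8],[5],[3]], [[3],[1,6],[7],[4],[2],[0]], [[4],[6],[1],[2],[3],[0,7]],
    [[0],[8,5],[2],[3],[1],[4]], [[4],[3,6],[5],[2],[7],[8]], [[3],[8],[1],[7],[5],[0,6]],
    [[0],[2],[4],[3],[1,5],[6]], [[0],[7],[2],[1,5],[4],[3]], [[0],[3],[4],[1],[2,5],[8]],
    [[6],[8,4],[7],[5],[3],[2]], [[4,6],[2],[8],[1],[3],[0]], [[0],[4,6],[1],[3],[5],[2]],
    [[8],[4,1],[6],[5],[3],[7]], [[0],[1],[7,5],[3],[2],[4]], [[7],[5],[8],[6,1],[0],[2]],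
    [[7],[3],[0],[1],[2],[4,6]], [[8],[4],[5],[1],[2],[7,0]], [[6],[0,8],[2],[1],[7],[3]],
    [[0],[4,6],[3],[8],[1],[2]], [[4],[1,0],[5],[8],[6],[7]], [[8,4],[5],[2],[1],[3],[0]],
    [[5],[0,1],[4],[3],[6],[8]], [[1],[4],[2],[3],[0,8],[6]], [[4],[1],[2],[8],[0],[3,5]],
    [[0],[3],[4],[1],[6,5],[2]], [[4],[5],[7],[2],[6],[8,3]], [[1],[4],[2],[8],[7],[6,5]],
    [[0],[8],[1],[3],[2,5],[4]], [[7],[0],[8],[2],[3],[1,6]], [[2],[3],[5],[6],[7,8],[4]],
    [[2,6],[5],[3],[8],[7],[4]], [[0],[2],[1],[8,6],[4],[7]], [[6],[7],[8],[2,4],[3],[5]],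
    [[7,4],[0],[2],[5],[3],[1]], [[4],[0],[2],[3],[1]], [[5],[8,7],[2],[6],[4],[3]],
    [[6],[8],[3],[0,7],[1],[2]], [[2],[7],[3],[1,6],[4],[0]], [[7],[0,4],[2],[3],[8],[1]],
    [[2],[0],[3,6],[5],[4],[1]], [[2],[6],[0],[7],[8,1],[5]], [[5],[0],[6],[3,8],[1],[7]],
    [[2,6],[3],[1],[8],[0],[7]], [[3],[2],[1,8],[0],[4],[6]], [[3],[2,7],[4],[0],[8],[1]],
    [[3],[1],[0],[4],[8,7],[2]], [[8],[1,2],[0],[7],[3],[6]], [[5],[2,3],[4],[6],[7],[8]],
    [[5],[2],[6],[3],[0,4],[1]], [[1],[2],[4],[3],[0],[6,7]], [[1],[7],[6],[0],[5,8],[4]],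
    [[4],[2],[0],[7],[3],[8,5]], [[6],[4],[3],[5],[2,8],[7]], [[1],[5,4],[0],[3],[8],[2]],
    [[2],[3],[8],[4,7],[1],[0]], [[3],[1,6],[8],[0],[2],[4]], [[3],[7],[2],[4],[6],[8,5]],
    [[4],[5],[2],[1],[3],[0,7]], [[8,4],[1],[2],[0],[3],[6]], [[3],[0],[2],[5,6],[8],[1]],
    [[0,4],[6],[7],[1],[3],[2]], [[7],[3],[8],[2,1],[4],[0]], [[7,2],[8],[6],[5],[4],[3]],
    [[3,6],[2],[8],[1],[4],[0]], [[0],[3,5],[4],[2],[1],[7]], [[0],[3],[1],[2],[8],[4,6]],
    [[2],[3],[5,7],[0],[8],[1]], [[8],[1,5],[4],[0],[3],[2]], [[4],[8],[7,6],[0],[5],[1]],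
    [[0,5],[3],[4],[6],[7],[1]], [[4],[2],[3],[8],[1,7],[0]], [[4],[2],[5,0],[6],[7],[8]],
    [[4],[3],[0],[1],[2,6],[8]], [[4],[7,5],[2],[3],[0],[1]], [[3],[4],[1],[5],[2],[8,0]],
    [[8],[1],[2,3],[0],[7],[4]], [[0],[1],[6],[4,3],[7],[5]], [[7],[0,3],[5],[1],[8],[2]],
    [[8],[0],[4],[1,5],[6],[3]], [[4],[0],[1],[8],[2],[3,6]], [[6],[2],[3,1],[4],[5],[0]],
    [[2],[7,5],[3],[1],[4],[0]], [[6],[3],[1],[4],[0],[2,5]], [[3],[2],[6],[4,7],[0],[1]],
    [[0],[1],[3,2],[4],[5],[8]], [[2],[1],[0,8],[4],[6],[3]], [[2],[0],[3],[4,5],[8],[1]],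
    [[0],[6],[4],[1],[7],[2,5]], [[7],[6],[8],[2,0],[1],[4]], [[4],[6,3],[7],[8],[5],[2]],
    [[6],[5],[8,3],[4],[2],[7]], [[4],[5],[2],[0],[8,3],[1]], [[8,7],[3],[6],[2],[4],[5]],
    [[6],[4],[5],[7],[2,3],[8]], [[8],[2],[5],[4,3],[7],[6]], [[7],[5],[6],[2],[0],[1,3]],
    [[1],[0],[8],[2],[3,7],[4]], [[3],[2],[0],[1],[4],[6,7]], [[5,0],[1],[8],[6],[7],[2]],
    [[2],[1],[4],[0],[8],[3,5]], [[2],[1],[0],[8,7],[4],[3]], [[5,6],[4],[1],[3],[0],[2]],
    [[7],[1,0],[6],[5],[8],[4]], [[2],[0,7],[6],[1],[8],[3]], [[1,3],[0],[2],[5],[8],[6]],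
    [[1],[8],[0],[4],[3,5],[6]], [[2],[0,7],[5],[1],[3],[4]], [[3],[4],[2,5],[6],[7],[8]],
    [[0],[4],[1,2],[8],[6],[3]], [[3],[1],[6,5],[2],[8],[0]], [[3],[0],[2],[1],[4],[6,7]],
    [[8],[2],[1],[4],[0],[3,5]], [[3],[1],[8],[4,7],[2],[0]], [[4],[8],[0],[2],[1],[3,6]],
    [[3],[5],[1,4],[0],[8],[6]], [[0,6],[3],[4],[1],[7],[5]], [[8],[0,7],[4],[6],[3],[1]],
    [[1,8],[7],[0],[3],[4],[2]], [[2],[0],[8,6],[1],[4],[3]], [[3,6],[1],[7],[5],[0],[4]],
    [[3,5],[4],[8],[0],[1],[7]], [[8],[0,6],[4],[1],[7],[2]], [[8],[3],[2],[0],[1],[4,5]],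
    [[4],[1],[6],[7],[0],[2,3]], [[8],[5,2],[6],[7],[4],[3]], [[8],[7,4],[2],[6],[0],[5]],
    [[3],[5],[6],[7],[2],[8,4]], [[0],[5],[8],[1,7],[2],[6]], [[1],[3],[4],[5],[2],[0,8]],
    [[2,5],[4],[8],[0],[3],[1]], [[8],[6],[2],[4],[0,7],[1]], [[4,6],[1],[2],[8],[0],[3]],
    [[7],[8],[6],[5,1],[4],[2]], [[6,5],[1],[8],[7],[4],[3]], [[6,7],[3],[2],[4],[0],[1]],
    [[0,3],[2],[5],[7],[1],[4]], [[4],[5],[1],[8],[2],[3,0]], [[0],[6],[3],[4],[8],[7,5]],
    [[1],[2],[0,8],[5],[4],[3]], [[0],[6],[4,2],[8],[1],[7]], [[5],[3],[8],[1],[7],[2,6]],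
    [[4,8],[7],[6],[3],[2],[5]], [[8],[1],[7],[2,5],[4],[0]], [[8],[3,5],[0],[6],[7],[1]],
    [[0],[7],[3],[4],[5],[1,2]], [[4],[6],[7],[8],[5],[3,2]], [[1],[2],[6],[3],[5],[0,4]],
    [[6,3],[7],[5],[8],[1],[0]], [[4,2],[6],[1],[0],[5],[7]], [[7,4],[8],[1],[2],[0],[3]],
    [[7],[2],[4,8],[3],[6],[5]], [[2],[7,4],[1],[6],[5],[0]], [[3],[7,1],[2],[8],[0],[6]],
    [[0],[2],[6],[8],[1,5],[4]], [[1],[7],[4],[5],[8],[2,6]], [[0],[1],[3],[4,8],[7],[2]],
    [[2],[5],[3,1],[8],[0],[4]], [[5],[8],[6],[0,4],[7],[2]], [[5],[1,8],[0],[2],[4],[3]],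
    [[4],[7],[5],[0],[1,6],[8]], [[3],[5,2],[6],[4],[7],[8]], [[7],[4,5],[8],[2],[3],[6]],
    [[2],[1],[0],[3],[7,4],[8]], [[4],[6],[3],[2],[5],[7,8]], [[8,4],[6],[3],[0],[2],[1]],
    [[7],[4],[3],[2],[1,8],[0]], [[1],[7],[0],[8,5],[4],[3]], [[6],[5,4],[2],[3],[8],[7]],
    [[2],[6],[4],[1,3],[0],[7]], [[1],[7,5],[2],[8],[0],[3]], [[2],[3],[1],[0],[6],[5,4]],
    [[4,0],[5],[7],[3],[8],[6]], [[7],[4,6],[1],[0],[3],[2]], [[0],[3],[8],[1],[2]],
    [[6],[1],[2,5],[4],[0],[3]], [[4],[8],[3],[6],[5],[7,2]], [[0],[8],[1],[4],[2,5],[3]],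
    [[0],[7,1],[4],[3],[2],[8]], [[0],[4],[1,5],[7],[3],[2]], [[8],[6],[4],[0,3],[1],[5]],
    [[4,1],[0],[5],[8],[6],[7]], [[2],[6],[3],[0],[4,5],[1]], [[3],[6],[2],[4],[0,8],[1]],
    [[4,2],[3],[6],[7],[0],[1]], [[3],[2],[4],[0,7],[6],[1]], [[4],[7,5],[3],[1],[8],[0]],
    [[2],[6],[4,5],[3],[1],[0]], [[6],[1,4],[8],[3],[5],[7]], [[1],[4,8],[0],[3],[5],[2]],
    [[3],[7],[1],[2,4],[8],[0]], [[4],[3],[7],[2,5],[8],[6]], [[6,2],[1],[8],[4],[7],[0]],
    [[4],[0],[3],[5,6],[2],[1]], [[0],[2],[6],[1,3],[4],[5]], [[6],[0],[7],[2,1],[8],[3]],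
    [[8],[0,6],[2],[5],[3],[4]], [[5],[4],[3,6],[8],[2],[7]], [[1],[3],[7,5],[4],[2],[0]],
    [[1],[4],[0],[8],[2,6],[7]], [[4],[2],[5,3],[6],[8],[7]], [[0],[6],[4],[5],[8],[2,7]],
    [[3],[4],[5,6],[0],[8],[1]], [[1],[6,4],[8],[2],[3],[0]], [[5],[0],[1],[7,4],[6],[8]],
    [[1,7],[4],[6],[0],[5],[8]], [[3,6],[7],[4],[1],[2],[0]], [[8],[0],[7],[3],[2,6],[4]],
    [[4],[8],[3,6],[5],[1],[2]], [[1],[6],[0,7],[4],[8],[5]], [[8,3],[7],[2],[4],[6],[5]],
    [[0],[3],[5],[8],[1,7],[4]], [[7],[0],[2,5],[4],[3],[1]], [[6],[3],[7],[0,8],[1],[4]],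
    [[3],[1],[2],[0],[4,5],[7]], [[2],[4],[0,6],[5],[1],[3]], [[4],[2],[8,5],[3],[6],[7]],
    [[6],[3],[4,2],[8],[7],[1]], [[1],[4],[0],[8],[6],[7,3]], [[3,2],[8],[1],[4],[0],[7]],
    [[3],[5,4],[2],[0],[8],[1]], [[8,4],[0],[6],[2],[7],[1]], [[0],[1],[2],[3],[5],[4,6]],
    [[5],[8],[7],[0,6],[4],[2]], [[4],[7],[3],[0],[1],[2,5]], [[4,6],[0],[3],[1],[2],[7]],
    [[0],[7],[1],[2,6],[4],[3]], [[3],[2],[4,6],[1],[0],[7]], [[8],[0],[1],[6],[4],[2,3]],
    [[4,7],[1],[2],[0],[3],[8]], [[8],[0],[2],[4],[1],[3,6]], [[1],[5,7],[0],[4],[3],[2]],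
    [[4,6],[1],[8],[0],[3],[2]], [[0],[8],[4,5],[1],[2],[3]], [[5],[4],[8],[6,2],[3],[7]],
    [[2,1],[4],[0],[3],[8],[7]], [[3],[2],[0],[8],[4,6],[1]], [[3],[6],[7,2],[4],[5],[8]],
    [[2],[3],[1],[6],[4,8],[0]], [[0],[1,5],[4],[7],[3],[2]], [[2],[3],[4],[1],[0,7],[6]],
    [[6],[2],[3],[4],[0],[1,7]], [[5],[1],[8,2],[3],[7],[4]], [[1],[7],[4],[2],[6],[0,8]],
    [[8],[6,4],[3],[0],[1],[2]], [[7],[4,6],[3],[1],[2],[0]], [[5,6],[0],[7],[1],[8],[2]],
    [[0],[1],[7],[8],[3,5],[4]], [[1],[6],[4,8],[2],[3],[5]], [[0],[1],[3,6],[4],[2],[7]],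
    [[5],[6],[2,7],[3],[4],[8]], [[6],[0],[5],[7],[1,8],[4]], [[6],[3],[5],[1,2],[0],[7]],
    [[4],[6],[3],[2],[0,8],[1]], [[0],[6],[1],[5],[2,4],[7]], [[3],[8],[0],[2],[1,7],[4]],
    [[6,1],[3],[0],[2],[8],[7]], [[1],[0],[4],[2],[3],[6,7]], [[6],[5],[2],[4],[7,3],[8]],
    [[4],[5,0],[6],[2],[8],[7]], [[6],[5],[0],[2,8],[7],[1]], [[4],[2],[7,3],[8],[6],[5]],
    [[2],[7,5],[4],[3],[1],[0]], [[7],[2],[1,6],[0],[8],[4]], [[2],[8],[0],[7],[1],[4,6]],
    [[6,4],[8],[5],[7],[1],[0]], [[4,5],[3],[8],[0],[2],[1]], [[3],[0],[7,5],[1],[2],[8]],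
    [[6],[2],[3],[4],[5],[1,7]], [[0],[3],[2],[4],[8,7],[1]], [[1],[0,2],[4],[6],[5],[7]],
    [[7],[4],[3,2],[6],[8],[5]], [[0],[7],[8],[2],[3],[4,6]], [[8,6],[4],[2],[3],[5],[7]],
    [[8],[3,6],[2],[0],[4],[1]], [[8],[1,2],[6],[0],[3],[4]], [[1,6],[5],[4],[3],[2],[0]],
    [[1],[3],[4,6],[2],[0],[8]], [[2],[4,7],[0],[3],[1],[8]], [[2],[0],[3],[4],[8,5],[1]],
    [[6],[0],[5,4],[7],[1],[8]], [[0],[6],[4],[8],[2],[1,7]], [[1],[2,3],[0],[8],[6],[4]],
    [[2],[3],[0],[7,5],[1],[8]], [[4],[0],[5],[6],[1],[7,8]], [[3],[0,6],[2],[4],[7],[1]],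
    [[4],[8],[5],[2,3],[7],[6]], [[2],[1],[4,6],[7],[3],[0]], [[6],[0,5],[1],[4],[7],[8]],
    [[4],[7],[2],[0],[1],[3,5]], [[3],[4],[0,7],[6],[1],[2]], [[3],[6],[2],[8],[5,0],[7]],
    [[3],[2],[4],[0],[6,7],[1]], [[5],[7],[6],[0,4],[1],[8]], [[0],[7,5],[4],[3],[2],[1]],
    [[3],[6],[1],[5],[4],[2,0]], [[1],[0],[3],[7,5],[8],[2]], [[5],[7],[3],[6],[8],[4,1]],
    [[3],[0],[7],[2,1],[4],[5]], [[5,4],[8],[1],[0],[6],[7]], [[1,2],[0],[6],[8],[7],[4]],
    [[8],[2,5],[6],[4],[3],[0]], [[0,8],[4],[2],[3],[5],[1]], [[4],[2],[8],[0,5],[3],[1]],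
    [[3],[4],[6,7],[2],[0],[1]], [[8],[7],[4,6],[0],[2],[1]], [[2],[4],[7],[3,8],[5],[6]],
    [[0],[4],[1],[7],[6],[2,3]], [[4],[0],[3],[2,6],[8],[1]], [[0],[5],[2],[8],[4],[1,7]],
    [[7],[4],[5],[6],[8,3],[2]], [[4],[3],[1,5],[7],[0],[2]], [[4,7],[5],[6],[2],[3],[0]],
    [[5],[2],[3],[8,4],[7],[6]], [[7,8],[2],[3],[4],[0],[1]], [[7],[0],[4],[3],[2],[5]],
    [[0],[2],[1],[8],[6],[4]], [[7],[4],[8],[0],[6],[1]], [[4],[1],[8],[3],[2],[0]], [[2],[0],[8],[1],[4],[7]],
    [[0],[8],[3],[2],[1],[7]], [[5],[7],[4],[8],[6],[1]], [[4],[8],[5],[7],[6],[2]], [[1],[8],[7],[3],[2],[0]],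
    [[4],[2],[8],[1],[3],[0]], [[8],[6],[1],[4],[3],[2]], [[7],[6],[3],[0],[4],[1]], [[4],[0],[6],[8],[5],[7]],
    [[2],[7],[0],[3],[8],[1]], [[1],[7],[4],[8],[0],[2]], [[5],[7],[8],[6],[4],[3]], [[8],[4],[5],[6],[3],[7]],
    [[5],[8],[3],[4],[6],[7]], [[8],[6],[3],[2],[0],[4]], [[2],[3],[0],[1],[7],[4]], [[2],[3],[1],[4],[8],[5]],
    [[7],[8],[2],[5],[6],[4]], [[4],[3],[0],[7],[2],[8]], [[4],[0],[3],[7],[8],[1]], [[4],[0],[8],[6],[3],[1]],
    [[7],[4],[3],[0],[1],[2]], [[7],[3],[4],[6],[5],[8]], [[0],[2],[5],[3],[4],[8]], [[0],[3],[5],[2],[1],[8]],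
    [[5],[6],[1],[7],[8],[4]], [[3],[8],[7],[1],[0],[2]], [[7],[6],[5],[4],[3],[8]], [[2],[8],[5],[4],[6],[7]],
    [[8],[0],[7],[2],[4],[3]], [[7],[1],[4],[3],[8],[0]], [[5],[8],[1],[7],[6],[4]], [[2],[3],[8],[4],[0],[1]],
    [[2],[4],[6],[3],[0],[7]], [[6],[2],[7],[8],[4],[5]], [[6],[5],[3],[4],[2],[1]], [[5],[2],[0],[4],[1],[3]],
    [[0],[3],[4],[2],[1],[8]], [[4],[0],[7],[5],[3],[2]], [[7],[1],[2],[8],[0],[4]], [[4],[2],[3],[0],[1],[6]],
    [[1],[6],[2],[4],[3],[0]], [[8],[4],[7],[3],[5],[0]], [[3],[1],[4],[0],[2],[8]], [[1],[3],[0],[2],[4],[7]],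
    [[3],[4],[6],[1],[2],[0]], [[1],[2],[0],[3],[6],[4]], [[3],[2],[8],[7],[0],[4]], [[6],[0],[7],[2],[3],[4]],
    [[7],[1],[0],[5],[8],[6]], [[2],[3],[4],[1],[0],[8]], [[4],[1],[0],[2],[7],[8]], [[1],[0],[8],[7],[3],[2]],
    [[1],[8],[4],[3],[2],[0]], [[0],[1],[4],[2],[3],[8]], [[1],[8],[0],[3],[7],[2]], [[8],[6],[7],[4],[3],[5]],
    [[1],[4],[7],[0],[2],[3]], [[3],[1],[7],[4],[0],[2]], [[1],[3],[7],[2],[0],[4]], [[1],[8],[2],[7],[0],[4]]]"

text \<open>A list \<open>i # js\<close> stands for the clause that \<open>i\<close> is not joined to all of the four vertices in \<open>js\<close> by red edges.\<close>

definition stars_low :: "nat list list" where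
  "stars_low = [
    [0,1,2,3,4], [0,1,2,3,5], [0,1,2,4,5], [0,1,2,5,6], [0,1,4,5,6], [0,1,5,6,7], [0,4,5,6,7], [0,5,6,7,8],
    [1,0,2,3,4], [1,0,2,4,5], [1,0,2,4,6], [1,0,2,5,6], [1,0,2,6,7], [1,0,3,4,5], [1,0,3,4,6], [1,0,3,5,6],
    [1,0,3,6,7], [1,0,4,5,6], [1,0,4,5,7], [1,0,4,6,7], [1,0,4,7,8], [1,0,5,6,7], [1,0,5,7,8], [1,0,6,7,8],
    [1,4,5,6,7], [1,4,5,6,8], [1,4,5,7,8], [1,4,6,7,8], [1,5,6,7,8], [2,0,1,4,5], [2,0,1,4,6], [2,0,1,4,7],
    [2,0,1,5,6], [2,0,1,6,7], [2,0,3,4,5], [2,0,3,4,6], [2,0,3,4,7], [2,0,3,5,6], [2,0,3,5,7], [2,0,3,6,7],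
    [2,0,3,7,8], [2,0,4,5,6], [2,0,4,5,7], [2,0,4,5,8], [2,0,4,6,7], [2,0,4,6,8], [2,0,4,7,8], [2,0,5,6,7],
    [2,0,5,6,8], [2,0,5,7,8], [2,0,6,7,8], [2,3,4,5,6], [2,3,4,5,7], [2,3,4,5,8], [2,3,4,6,7], [2,3,4,6,8],
    [2,3,4,7,8], [2,3,5,6,7], [2,3,5,6,8], [2,3,5,7,8], [2,3,6,7,8], [2,4,5,6,7], [2,4,5,6,8], [2,4,5,7,8],
    [2,4,6,7,8], [2,5,6,7,8], [3,0,4,5,6], [3,0,4,5,7], [3,0,4,5,8], [3,0,4,6,7], [3,0,4,6,8], [3,0,5,6,8],
    [3,0,5,7,8], [3,1,2,4,5], [3,1,2,4,6], [3,1,2,4,7], [3,1,2,4,8], [3,1,2,5,6], [3,1,2,5,7], [3,1,2,5,8],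
    [3,1,2,6,7], [3,1,4,5,6], [3,1,4,5,7], [3,1,4,5,8], [3,1,4,6,7], [3,1,4,6,8], [3,1,4,7,8], [3,1,5,6,7],
    [3,1,5,6,8], [3,1,5,7,8], [3,1,6,7,8], [3,2,4,5,6], [3,2,4,5,7], [3,2,4,5,8], [3,2,4,6,7], [3,2,4,6,8],
    [3,2,4,7,8], [3,2,5,6,7], [3,2,5,6,8], [3,2,5,7,8], [3,2,6,7,8], [3,4,5,6,7], [3,4,5,6,8], [3,4,5,7,8],
    [3,4,6,7,8], [3,5,6,7,8], [4,0,1,2,3], [4,0,1,2,5], [4,0,1,2,6], [4,0,1,2,7], [4,0,1,2,8], [4,0,1,3,5],
    [4,0,1,3,6], [4,0,1,3,7], [4,0,1,3,8], [4,0,1,5,6], [4,0,1,5,8], [4,0,1,6,7], [4,0,1,6,8], [4,0,1,7,8],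
    [4,0,2,3,5], [4,0,2,3,6], [4,0,2,3,7], [4,0,2,3,8], [4,0,2,5,6], [4,0,2,5,7], [4,0,2,5,8], [4,0,2,6,7],
    [4,0,2,6,8], [4,0,2,7,8], [4,0,3,5,6], [4,0,3,5,7], [4,0,3,5,8], [4,0,3,6,7], [4,0,3,6,8], [4,0,3,7,8],
    [4,0,5,6,7], [4,0,5,6,8], [4,0,5,7,8], [4,0,6,7,8], [4,1,2,3,5], [4,1,2,3,6], [4,1,2,3,7], [4,1,2,3,8],
    [4,1,2,5,6], [4,1,2,5,7], [4,1,2,5,8], [4,1,2,6,7], [4,1,2,6,8], [4,1,2,7,8], [4,1,3,5,6], [4,1,3,5,7],
    [4,1,3,5,8], [4,1,3,6,7], [4,1,3,6,8], [4,1,3,7,8], [4,1,5,6,7], [4,1,5,6,8], [4,1,5,7,8], [4,1,6,7,8],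
    [4,2,3,5,6], [4,2,3,5,7], [4,2,3,5,8], [4,2,3,6,7], [4,2,3,6,8], [4,2,3,7,8], [4,2,5,6,7], [4,2,5,6,8],
    [4,2,5,7,8], [4,2,6,7,8], [4,3,5,6,7], [4,3,5,6,8], [4,3,5,7,8], [4,3,6,7,8], [4,5,6,7,8]]"

text \<open>Vertex 4 takes no part in the sorting of 0 to 3, but its colours enter the columns by
  which 5 to 8 are sorted. The degree bound appears only through the selected clauses of
  \<open>stars_low\<close>.\<close>

lemma few_red_neighbours_core:
  fixes r :: "nat \<Rightarrow> nat \<Rightarrow> bool"
  assumes r_commute: "\<And>i j. r i j = r j i"
    and certs: "list_all (\<lambda>ss. bicoloured r (seg_pairs ss)) segments_low"
    and degrees: "list_all (\<lambda>js. list_ex (\<lambda>j. \<not> r (hd js) j) (tl js)) stars_low"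
    and quad: "sorted_quad (r 0 1) (r 0 2) (r 0 3) (r 1 2) (r 1 3) (r 2 3)"
    and columns: "lexge [r 0 5, r 1 5, r 2 5, r 3 5, r 4 5] [r 0 6, r 1 6, r 2 6, r 3 6, r 4 6]"
      "lexge [r 0 6, r 1 6, r 2 6, r 3 6, r 4 6] [r 0 7, r 1 7, r 2 7, r 3 7, r 4 7]"
      "lexge [r 0 7, r 1 7, r 2 7, r 3 7, r 4 7] [r 0 8, r 1 8, r 2 8, r 3 8, r 4 8]"
  shows False
  using certs[unfolded segments_low_def list.pred_inject, unfolded clause_simps, simplified r_commute]
    degrees[unfolded stars_low_def list.pred_inject, unfolded clause_simps list.sel, simplified r_commute]
    quad[unfolded sorted_quad_def lexge.simps, simplified r_commute]
    columns[unfolded lexge.simps, simplified r_commute]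
  by sat
text \<open>The permutation \<open>twist\<close> maps each model to its complement.\<close>

fun model1 :: "'b list \<Rightarrow> ('b \<times> 'b) list" where
  "model1 [a, b, c, d, e, f, g, h] =
    [(a, b), (a, c), (a, d), (b, c), (b, e), (c, d), (c, f), (d, e), (d, g), (e, f), (e, h), (f, g), (f, h), (g, h)]"
| "model1 _ = []"

fun twist1 :: "'b list \<Rightarrow> 'b list" where
  "twist1 [a, b, c, d, e, f, g, h] = [d, f, b, h, a, g, c, e]"
| "twist1 _ = []"

fun model2 :: "'b list \<Rightarrow> ('b \<times> 'b) list" where
  "model2 [a, b, c, d, e, f, g, h] =
    [(a, b), (a, c), (a, d), (b, e), (b, f), (c, d), (c, e), (c, g), (d, f), (d, g), (e, f), (e, h), (f, h), (g, h)]"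
| "model2 _ = []"

fun twist2 :: "'b list \<Rightarrow> 'b list" where
  "twist2 [a, b, c, d, e, f, g, h] = [c, f, b, h, g, a, d, e]"
| "twist2 _ = []"

fun model3 :: "'b list \<Rightarrow> ('b \<times> 'b) list" where
  "model3 [a, b, c, d, e, f, g, h] =
    [(a, b), (a, c), (a, d), (b, e), (b, f), (c, d), (c, e), (c, g), (d, f), (d, h), (e, f), (e, g), (f, h), (g, h)]"
| "model3 _ = []"

fun twist3 :: "'b list \<Rightarrow> 'b list" where
  "twist3 [a, b, c, d, e, f, g, h] = [c, f, b, h, g, a, d, e]"
| "twist3 _ = []"

text \<open>Index 0 stands for a vertex whose red neighbours are exactly 1, 2, 3 and whose blue
  neighbours are 4 to 7.\<close>

definition segments_eight :: "nat list list list" where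
  "segments_eight = [
    [[0,1],[4,5],[7],[3],[6],[2]], [[0,5],[3],[2],[6],[1],[7]], [[0,6],[3],[2],[5],[4],[7]],
    [[0,7],[1],[3],[4,5],[2],[6]], [[0],[1],[4],[2,7],[6],[3]], [[0],[1],[5,7],[2],[4,6],[3]],
    [[0],[2],[4],[1],[5,7],[6,3]], [[0],[2],[5,7],[3],[4],[1]], [[0],[2],[6,5],[1],[4],[7,3]],
    [[0],[2],[7],[3,5],[4],[6,1]], [[0],[3,6],[4],[2],[7,5],[1]], [[0],[3],[5,6],[2,7],[4],[1]],
    [[0],[3],[6],[2,7],[4],[5,1]], [[0],[6,4],[2],[7],[1,3],[5]], [[0],[6],[1],[7],[2,3,4],[5]],
    [[0],[6],[2],[5],[4,3],[1,7]], [[0],[6],[3,2],[7],[1],[5]], [[0],[7,1],[6],[4,3],[2],[5]],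
    [[0],[7],[3],[4,2,6],[1],[5]], [[0],[7],[3],[4,6],[1],[2,5]], [[0],[7],[5],[6],[1],[2,3,4]],
    [[1,2],[6],[5],[7,0],[4],[3]], [[1],[4,5],[3],[6,7],[2],[0]], [[1],[4],[2,7],[5],[3],[0]],
    [[2],[0,3],[7],[5],[1],[4]], [[2],[4],[3,1],[7],[0],[5]], [[2],[4],[7,3],[0],[1],[5,6]],
    [[2],[6],[3],[0,1,5],[7],[4]], [[3,7],[4],[2,5],[6],[1],[0]], [[3],[0,2,5],[7],[6],[1],[4]],
    [[3],[1],[7],[2],[6],[0,4]], [[3],[4],[1],[0],[2,5],[6]], [[3],[4],[2],[0],[1,5],[6,7]],
    [[3],[4],[6],[5,0],[7,1],[2]], [[3],[5],[2],[6],[7,4,1],[0]], [[4],[1],[0,2],[7],[6,5],[3]],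
    [[4],[1],[2,0],[3],[5],[6,7]], [[4],[1],[5,7],[6,2],[0],[3]], [[4],[2],[6,7],[5,1],[0],[3]],
    [[4],[3],[0],[1,6],[7],[2]], [[4],[5,3],[1],[7],[0],[6]], [[4],[5],[0],[6],[1],[7,2]],
    [[4],[5],[2,6],[7],[3,0],[1]], [[4],[6],[0,5],[3],[1],[7]], [[5,4],[2],[7],[1],[6],[0]],
    [[5,6],[1],[3],[2],[7],[4,0]], [[5,6],[2],[4,7],[3],[0],[1]], [[5],[1],[0],[3],[4],[2,6]],
    [[5],[3],[4],[7],[1,2],[6,0]], [[5],[6],[0],[4,3],[1],[7,2]], [[5],[6],[3],[7],[2],[0,1]],
    [[5],[7],[1],[6],[0,4],[3]], [[6,0],[4],[7],[5],[3],[1,2]], [[6,2],[0],[3,7],[5],[1],[4]],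
    [[6],[0,4,3],[1],[7],[5],[2]], [[6],[1,3],[5,2],[4],[7],[0]], [[6],[1,5],[4],[0],[7],[2,3]],
    [[6],[1],[3],[5],[2,4],[7,0]], [[6],[1],[4],[7,3],[0],[2,5]], [[6],[1],[5,3],[2],[7],[0]],
    [[6],[2],[0,1],[5,4],[7],[3]], [[6],[2],[1,0,3],[7],[5],[4]], [[6],[2],[1,0],[3],[5,7],[4]],
    [[6],[5],[0],[4],[2,3],[7,1]], [[6],[5],[7],[2,0],[1],[4,3]], [[6],[7,5],[1],[4],[3],[0,2]],
    [[7,2],[0],[1],[5],[3,6],[4]], [[7,2],[4],[5],[3,0],[1],[6]], [[7,5],[1],[0],[2],[4],[3]],
    [[7],[0,5],[2,3],[4],[6],[1]], [[7],[6],[2,5],[0,4],[3],[1]]]"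

text \<open>In a pair \<open>(P, Q)\<close> two of the eight vertices are missing; removing them must not separate \<open>P\<close> from \<open>Q\<close>.\<close>

definition cuts_eight :: "(nat list \<times> nat list) list" where
  "cuts_eight = [
    ([2],[3,4,5,6,7]), ([5],[2,3,4,6,7]), ([6],[2,3,4,5,7]), ([7],[2,3,4,5,6]), ([4],[1,3,5,6,7]),
    ([5],[1,3,4,6,7]), ([6],[1,3,4,5,7]), ([4],[1,2,5,6,7]), ([5],[1,2,4,6,7]), ([1],[2,3,5,6,7]),
    ([2],[1,3,5,6,7]), ([3],[1,2,5,6,7]), ([3],[1,2,4,6,7]), ([4],[1,2,3,6,7]), ([2],[1,3,4,5,7]),
    ([3],[1,2,4,5,7]), ([4],[1,2,3,5,7]), ([2],[1,3,4,5,6]), ([3],[1,2,4,5,6]), ([3],[0,4,5,6,7]),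
    ([4],[0,3,5,6,7]), ([5],[0,3,4,6,7]), ([2],[0,4,5,6,7]), ([4],[0,2,5,6,7]), ([5],[0,2,4,6,7]),
    ([6],[0,2,4,5,7]), ([5],[0,2,3,6,7]), ([4],[0,2,3,6,7]), ([6],[0,2,3,4,7]), ([4],[0,2,3,5,7]),
    ([5],[0,2,3,4,7]), ([5],[0,2,3,4,6]), ([6],[0,2,3,4,5]), ([0,1],[4,5,6,7]), ([1],[0,4,5,6,7]),
    ([5],[0,1,4,6,7]), ([6],[0,1,4,5,7]), ([7],[0,1,4,5,6]), ([3],[0,1,5,6,7]), ([6],[0,1,3,5,7]),
    ([7],[0,1,3,5,6]), ([6],[0,1,3,4,7]), ([7],[0,1,3,4,6]), ([7],[0,1,3,4,5]), ([6],[0,1,3,4,5]),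
    ([0,1,2],[5,6,7]), ([2],[0,1,5,6,7]), ([7],[0,1,2,5,6]), ([2],[0,1,4,6,7]), ([7],[0,1,2,4,6]),
    ([7],[0,1,2,4,5]), ([1],[0,2,4,5,6]), ([2],[0,1,4,5,6]), ([6],[0,1,2,4,5]), ([3],[0,1,2,6,7]),
    ([6,7],[0,1,2,3]), ([7],[0,1,2,3,6]), ([7],[0,1,2,3,5]), ([2],[0,1,3,5,6]), ([3],[0,1,2,5,6]),
    ([7],[0,1,2,3,4]), ([3],[0,1,2,4,6]), ([0,4,5],[1,2,3]), ([1],[0,2,3,4,5]), ([2,3],[0,1,4,5]),
    ([2],[0,1,3,4,5])]"

text \<open>Sorting does not fix the place of \<open>model1\<close>: its vertices of degree three
  form two orbits, and index 0 plays the role of \<open>a\<close> or of \<open>b\<close>. In the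
  other two models they form a single orbit, and index 0 plays the role of \<open>a\<close>.\<close>

definition labellings1 :: "nat list list" where
  "labellings1 = [
    [0,2,1,3,5,4,6,7], [0,3,1,2,5,4,6,7], [1,0,2,4,3,5,7,6], [2,0,1,4,3,5,7,6]]"

definition labellings2 :: "nat list list" where
  "labellings2 = [
    [0,3,1,2,5,6,4,7]]"

definition labellings3 :: "nat list list" where
  "labellings3 = [
    [0,3,1,2,4,6,5,7]]"

text \<open>Here the clauses themselves are satisfiable. The negated conclusion adds one clause for
  each listed labelling, saying that some pair has the wrong colour, and only then they contradict
  each other.\<close>

lemma order_eight_core:
  fixes r :: "nat \<Rightarrow> nat \<Rightarrow> bool"
  assumes r_commute: "\<And>i j. r i j = r j i"
    and certs: "list_all (\<lambda>ss. bicoloured r (seg_pairs ss)) segments_eight"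
    and cuts: "list_all (\<lambda>(P, Q). bicoloured r (List.product P Q)) cuts_eight"
    and v: "r 0 1" "r 0 2" "r 0 3" "\<not> r 0 4" "\<not> r 0 5" "\<not> r 0 6" "\<not> r 0 7"
    and triple: "sorted_triple (r 1 2) (r 1 3) (r 2 3)"
    and columns: "lexge [r 1 4, r 2 4, r 3 4] [r 1 5, r 2 5, r 3 5]"
      "lexge [r 1 5, r 2 5, r 3 5] [r 1 6, r 2 6, r 3 6]"
      "lexge [r 1 6, r 2 6, r 3 6] [r 1 7, r 2 7, r 3 7]"
  shows "list_ex (\<lambda>q. all_coloured r (model1 q) (model1 (twist1 q))) labellings1 \<or>
    list_ex (\<lambda>q. all_coloured r (model2 q) (model2 (twist2 q))) labellings2 \<or>
    list_ex (\<lambda>q. all_coloured r (model3 q) (model3 (twist3 q))) labellings3"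
proof (rule ccontr)
  assume *: "\<not> ?thesis"
  show False
    using certs[unfolded segments_eight_def list.pred_inject, unfolded clause_simps, simplified r_commute]
      cuts[unfolded cuts_eight_def list.pred_inject, unfolded clause_simps product.simps list.map, unfolded clause_simps, simplified r_commute]
      *[unfolded labellings1_def labellings2_def labellings3_def, unfolded clause_simps,
        unfolded model1.simps(1) twist1.simps(1) model2.simps(1) twist2.simps(1) model3.simps(1) twist3.simps(1),
        unfolded all_coloured_def clause_simps, simplified r_commute]
      triple[unfolded sorted_triple_def, simplified r_commute]
      columns[unfolded lexge.simps, simplified r_commute] v[simplified r_commute]
    by sat
qed

text \<open>The inequality of the pairs matters for blue: a pair absent from \<open>G\<close> is an
  arc of the complement only if its vertices are distinct.\<close>

definition valid_segments :: "nat \<Rightarrow> nat list list \<Rightarrow> bool" where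
  "valid_segments n ss \<longleftrightarrow> (length ss = 5 \<or> length ss = 6) \<and> [] \<notin> set ss \<and> distinct (concat ss) \<and>
    list_all (\<lambda>i. i < n) (concat ss) \<and> list_all (\<lambda>(i, j). i \<noteq> j) (seg_pairs ss)"

lemma valid_segments_eight: "list_all (valid_segments 8) segments_eight" by code_simp

lemma valid_segments_low: "list_all (valid_segments 9) segments_low" by code_simp

lemma valid_stars_low: "list_all (\<lambda>js. length js = 5 \<and> distinct js \<and> hd js < 5 \<and> list_all (\<lambda>j. j < 9) js) stars_low"
  by code_simp

lemma valid_segments_balanced: "list_all (valid_segments 9) segments_balanced" by code_simp

section \<open>Graphs that are planar together with their complements\<close>

lemma pverts_complement [simp]: "pverts (complement_graph G) = pverts G"
  by (simp add: complement_graph_def)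

lemma parcs_complement:
  "(u, v) \<in> parcs (complement_graph G) \<longleftrightarrow> u \<in> pverts G \<and> v \<in> pverts G \<and> u \<noteq> v \<and> (u, v) \<notin> parcs G"
  by (simp add: complement_graph_def)

lemma pair_graphI:
  assumes "finite (pverts G)" "\<And>u v. (u, v) \<in> parcs G \<Longrightarrow> u \<in> pverts G \<and> v \<in> pverts G \<and> u \<noteq> v \<and> (v, u) \<in> parcs G"
  shows "pair_graph G"
proof
  have "parcs G \<subseteq> pverts G \<times> pverts G" using assms(2) by auto
  then show "finite (parcs G)" using assms(1) by (simp add: finite_subset)
  show "symmetric (with_proj G)" using assms(2) by (auto simp: symmetric_def sym_def)
qed (use assms in \<open>auto dest: assms(2)\<close>)

context pair_graph
begin

lemma arc_commute: "(u, v) \<in> parcs G \<longleftrightarrow> (v, u) \<in> parcs G"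
  using pair_sym_arcs by (auto simp: symmetric_def sym_def)

lemma no_loop: "(u, u) \<notin> parcs G"
  using pair_no_loops[of "(u, u)"] by auto

lemma pair_graph_complement: "pair_graph (complement_graph G)"
  by (rule pair_graphI) (use pair_finite_verts arc_commute in \<open>auto simp: parcs_complement\<close>)

lemma complement_complement: "complement_graph (complement_graph G) = G"
proof -
  have "parcs (complement_graph (complement_graph G)) = parcs G"
    using wellformed' no_loop by (auto simp: parcs_complement)
  then show ?thesis by (intro pair_pre_digraph.equality) simp_all
qed

lemma planar_no_segments:
  assumes "planar G" "distinct (concat ss)" "length ss = 5 \<or> length ss = 6" "[] \<notin> set ss"
    "set (seg_pairs ss) \<subseteq> parcs G"
  shows False
proof -
  obtain p \<gamma> where "plane_embedding G p \<gamma>" using assms(1) by (auto simp: planar_def)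
  then interpret plane_graph G p \<gamma> by unfold_locales
  have cyc: "cycle_pairs (concat ss) \<subseteq> parcs G" and ch: "set (chords ss) \<subseteq> parcs G"
    using assms(5) by (auto simp: seg_pairs_def cycle_pairs_def)
  from assms(3) show False
  proof
    assume "length ss = 6"
    then obtain s0 s1 s2 s3 s4 s5 where ss: "ss = [s0, s1, s2, s3, s4, s5]"
      by (auto simp: numeral_eq_Suc length_Suc_conv)
    show False by (rule no_Kuratowski6[OF assms(2) ss assms(4) cyc]) (use ch ss in auto)
  next
    assume "length ss = 5"
    then obtain s0 s1 s2 s3 s4 where ss: "ss = [s0, s1, s2, s3, s4]"
      by (auto simp: numeral_eq_Suc length_Suc_conv)
    show False by (rule no_Kuratowski5[OF assms(2) ss assms(4) cyc]) (use ch ss in auto)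
  qed
qed

end

section \<open>From clauses on indices to clauses on vertices\<close>

text \<open>Segments must be nonempty because \<open>hd\<close> does not commute with
  \<open>map\<close> on the empty list.\<close>

lemma chords_map: "[] \<notin> set ss \<Longrightarrow> chords (map (map f) ss) = map (map_prod f f) (chords ss)"
  by (cases ss rule: chords.cases) (auto simp: hd_map)

lemma seg_pairs_map: "[] \<notin> set ss \<Longrightarrow> seg_pairs (map (map f) ss) = map (map_prod f f) (seg_pairs ss)"
  by (simp add: seg_pairs_def chords_map zip_map_map map_prod_def case_prod_unfold rotate1_map flip: map_concat)

lemma seg_pairs_subset: "[] \<notin> set ss \<Longrightarrow> set (seg_pairs ss) \<subseteq> set (concat ss) \<times> set (concat ss)"
proof -
  assume ss: "[] \<notin> set ss"
  have "set (zip (concat ss) (rotate1 (concat ss))) \<subseteq> set (concat ss) \<times> set (concat ss)"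
    by (auto dest: set_zip_leftD set_zip_rightD)
  moreover have "set (chords ss) \<subseteq> set (concat ss) \<times> set (concat ss)"
    using ss by (cases ss rule: chords.cases) (auto intro: hd_in_set)
  ultimately show ?thesis by (auto simp: seg_pairs_def)
qed

locale biplanar = pair_graph G for G :: "'a pair_pre_digraph" +
  assumes planar: "planar G" and coplanar: "planar (complement_graph G)"
begin

text \<open>This exchanges the colours, so that results about red edges can be applied to blue
  ones.\<close>

lemma biplanar_complement: "biplanar (complement_graph G)"
  unfolding biplanar_def biplanar_axioms_def
  by (simp add: pair_graph_complement planar coplanar complement_complement)

text \<open>With distinct vertices put in for the indices, the clause describes an actual subdivided
  Kuratowski graph. If it were all red it would lie in \<open>G\<close>, if all blue in the
  complement, and both are planar.\<close>

lemma segments_bicoloured: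
  assumes xs: "distinct xs" "set xs \<subseteq> pverts G" and ss: "valid_segments (length xs) ss"
  shows "bicoloured (\<lambda>i j. (xs ! i, xs ! j) \<in> parcs G) (seg_pairs ss)"
proof -
  interpret co: pair_graph "complement_graph G" by (rule pair_graph_complement)
  have ss': "length ss = 5 \<or> length ss = 6" "[] \<notin> set ss" "distinct (concat ss)"
    "\<And>i. i \<in> set (concat ss) \<Longrightarrow> i < length xs" "\<And>i j. (i, j) \<in> set (seg_pairs ss) \<Longrightarrow> i \<noteq> j"
    using ss unfolding valid_segments_def list_all_iff by auto
  let ?ss = "map (map ((!) xs)) ss"
  have "inj_on ((!) xs) (set (concat ss))"
    using xs(1) ss'(4) by (auto simp: inj_on_def nth_eq_iff_index_eq)
  then have dist: "distinct (concat ?ss)"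
    using ss'(3) by (simp add: distinct_map flip: map_concat)
  have ne: "[] \<notin> set ?ss" "length ?ss = 5 \<or> length ?ss = 6" using ss' by auto
  have pairs: "seg_pairs ?ss = map (map_prod ((!) xs) ((!) xs)) (seg_pairs ss)"
    by (rule seg_pairs_map[OF ss'(2)])
  have bound: "i < length xs \<and> j < length xs" if "(i, j) \<in> set (seg_pairs ss)" for i j
    using that seg_pairs_subset[OF ss'(2)] ss'(4) by blast
  have "\<exists>(i, j) \<in> set (seg_pairs ss). (xs ! i, xs ! j) \<notin> parcs G"
    using planar_no_segments[OF planar dist ne(2,1)] unfolding pairs by fastforce
  moreover have "\<exists>(i, j) \<in> set (seg_pairs ss). (xs ! i, xs ! j) \<in> parcs G"
  proof (rule ccontr)
    assume neg: "\<not> ?thesis"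
    have "(xs ! i, xs ! j) \<in> parcs (complement_graph G)" if "(i, j) \<in> set (seg_pairs ss)" for i j
    proof -
      have "i \<noteq> j" "i < length xs" "j < length xs" using that bound ss'(5) by blast+
      moreover have "(xs ! i, xs ! j) \<notin> parcs G" using neg that by blast
      ultimately show ?thesis using xs by (auto simp: parcs_complement nth_eq_iff_index_eq)
    qed
    then show False
      using co.planar_no_segments[OF coplanar dist ne(2,1)] unfolding pairs by fastforce
  qed
  ultimately show ?thesis unfolding bicoloured_def list_ex_iff by auto
qed

lemma segments_bicoloured_all:
  assumes "distinct xs" "set xs \<subseteq> pverts G" "list_all (valid_segments (length xs)) sss"
  shows "list_all (\<lambda>ss. bicoloured (\<lambda>i j. (xs ! i, xs ! j) \<in> parcs G) (seg_pairs ss)) sss"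
  using assms(3) segments_bicoloured[OF assms(1,2)] by (auto simp: list_all_iff)

end

section \<open>Orders of the vertices that meet the sorting conditions\<close>

text \<open>A numerical key for \<open>sort_key\<close>: among lists of equal length a larger value
  means lexicographically larger, because the tail never outweighs the leading digit.\<close>

fun binary_value :: "bool list \<Rightarrow> nat" where
  "binary_value [] = 0"
| "binary_value (x # xs) = of_bool x * 2 ^ length xs + binary_value xs"

lemma binary_value_less: "binary_value xs < 2 ^ length xs"
  by (induction xs) auto

lemma lexge_binary_value:
  "length xs = length ys \<Longrightarrow> binary_value ys \<le> binary_value xs \<Longrightarrow> lexge xs ys"
proof (induction xs ys rule: list_induct2)
  case (Cons x xs y ys)
  then show ?case
    using binary_value_less[of xs] binary_value_less[of ys] by (cases x; cases y) auto
qed simp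

lemma lexge_arrangement:
  fixes f :: "'a \<Rightarrow> bool list"
  assumes "card B = 4" "\<And>x. length (f x) = n"
  obtains w x y z where "B = {w, x, y, z}" "distinct [w, x, y, z]"
    "lexge (f w) (f x)" "lexge (f x) (f y)" "lexge (f y) (f z)"
proof -
  have "finite B" using assms(1) by (metis card.infinite zero_neq_numeral)
  then obtain l where l: "set l = B" "distinct l" using finite_distinct_list by blast
  define m where "m = rev (sort_key (\<lambda>x. binary_value (f x)) l)"
  have m: "set m = B" "distinct m" using l by (auto simp: m_def)
  then have "length m = 4" using assms(1) distinct_card by metis
  then obtain w x y z where wxyz: "m = [w, x, y, z]" by (auto simp: numeral_eq_Suc length_Suc_conv)
  have "sorted (map (\<lambda>x. binary_value (f x)) (rev m))" by (simp add: m_def)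
  then have "binary_value (f x) \<le> binary_value (f w)" "binary_value (f y) \<le> binary_value (f x)"
    "binary_value (f z) \<le> binary_value (f y)" by (simp_all add: wxyz)
  then show ?thesis using that[of w x y z] m wxyz lexge_binary_value assms(2) by auto
qed

lemma sorted_quad_arrangement:
  fixes E :: "'a \<Rightarrow> 'a \<Rightarrow> bool"
  assumes "card A = 4" and E: "\<And>x y. E x y = E y x"
  obtains a b c d where "A = {a, b, c, d}" "distinct [a, b, c, d]"
    "sorted_quad (E a b) (E a c) (E a d) (E b c) (E b d) (E c d)"
proof -
  have "finite A" using assms(1) by (metis card.infinite zero_neq_numeral)
  then obtain l where l: "set l = A" "distinct l" using finite_distinct_list by blast
  then have "length l = 4" using assms(1) distinct_card by metis
  then obtain a b c d where abcd: "l = [a, b, c, d]" by (auto simp: numeral_eq_Suc length_Suc_conv)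
  let ?Q = "\<lambda>a b c d. sorted_quad (E a b) (E a c) (E a d) (E b c) (E b d) (E c d)"
  \<comment> \<open>All 24 orders are tried. One with the lexicographically largest edge vector
    satisfies \<open>?Q\<close>, and this is a propositional fact about six atoms.\<close>
  have "?Q a b c d \<or> ?Q a b d c \<or> ?Q a c b d \<or> ?Q a c d b \<or> ?Q a d b c \<or> ?Q a d c b \<or>
    ?Q b a c d \<or> ?Q b a d c \<or> ?Q b c a d \<or> ?Q b c d a \<or> ?Q b d a c \<or> ?Q b d c a \<or>
    ?Q c a b d \<or> ?Q c a d b \<or> ?Q c b a d \<or> ?Q c b d a \<or> ?Q c d a b \<or> ?Q c d b a \<or>
    ?Q d a b c \<or> ?Q d a c b \<or> ?Q d b a c \<or> ?Q d b c a \<or> ?Q d c a b \<or> ?Q d c b a"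
    unfolding E[of b a] E[of c a] E[of d a] E[of c b] E[of d b] E[of d c] sorted_quad_def lexge.simps
    by argo
  then show ?thesis
    using that l(1)[unfolded abcd, symmetric] l(2)[unfolded abcd] by (elim disjE) (auto simp: insert_commute)
qed

lemma sorted_triple_arrangement:
  fixes E :: "'a \<Rightarrow> 'a \<Rightarrow> bool"
  assumes "card A = 3" and E: "\<And>x y. E x y = E y x"
  obtains a b c where "A = {a, b, c}" "distinct [a, b, c]" "sorted_triple (E a b) (E a c) (E b c)"
proof -
  obtain a b c where abc: "A = {a, b, c}" "a \<noteq> b" "a \<noteq> c" "b \<noteq> c" using assms(1) by (metis card_3_iff)
  let ?Q = "\<lambda>a b c. sorted_triple (E a b) (E a c) (E b c)"
  have "?Q a b c \<or> ?Q a c b \<or> ?Q b a c \<or> ?Q b c a \<or> ?Q c a b \<or> ?Q c b a"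
    unfolding E[of b a] E[of c a] E[of c b] sorted_triple_def by argo
  then show ?thesis
    using that abc by (elim disjE) (auto simp: insert_commute)
qed

context biplanar
begin

text \<open>\<open>B\<close> is sorted by its columns against \<open>A\<close> after the order of
  \<open>A\<close> has been fixed, so both normalisations hold at once.\<close>

lemma no_balanced_vertex:
  assumes v: "v \<in> pverts G" and A: "A \<subseteq> pverts G" "card A = 4" "\<And>a. a \<in> A \<Longrightarrow> (v, a) \<in> parcs G"
    and B: "B \<subseteq> pverts G - {v}" "card B = 4" "\<And>b. b \<in> B \<Longrightarrow> (v, b) \<notin> parcs G"
  shows False
proof -
  obtain a b c d where abcd: "A = {a, b, c, d}" "distinct [a, b, c, d]"
    and quad: "sorted_quad ((a, b) \<in> parcs G) ((a, c) \<in> parcs G) ((a, d) \<in> parcs G)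
      ((b, c) \<in> parcs G) ((b, d) \<in> parcs G) ((c, d) \<in> parcs G)"
    using sorted_quad_arrangement[OF A(2), of "\<lambda>x y. (x, y) \<in> parcs G"] arc_commute by metis
  obtain w x y z where wxyz: "B = {w, x, y, z}" "distinct [w, x, y, z]"
    and columns: "lexge [(a, w) \<in> parcs G, (b, w) \<in> parcs G, (c, w) \<in> parcs G, (d, w) \<in> parcs G]
        [(a, x) \<in> parcs G, (b, x) \<in> parcs G, (c, x) \<in> parcs G, (d, x) \<in> parcs G]"
      "lexge [(a, x) \<in> parcs G, (b, x) \<in> parcs G, (c, x) \<in> parcs G, (d, x) \<in> parcs G]
        [(a, y) \<in> parcs G, (b, y) \<in> parcs G, (c, y) \<in> parcs G, (d, y) \<in> parcs G]"
      "lexge [(a, y) \<in> parcs G, (b, y) \<in> parcs G, (c, y) \<in> parcs G, (d, y) \<in> parcs G]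
        [(a, z) \<in> parcs G, (b, z) \<in> parcs G, (c, z) \<in> parcs G, (d, z) \<in> parcs G]"
    by (rule lexge_arrangement[OF B(2), of "\<lambda>u. [(a, u) \<in> parcs G, (b, u) \<in> parcs G, (c, u) \<in> parcs G, (d, u) \<in> parcs G]" 4])
      simp_all
  define xs where "xs = [v, a, b, c, d, w, x, y, z]"
  have AB: "A \<inter> B = {}" "v \<notin> A" "v \<notin> B" using A(3) B(1,3) no_loop by blast+
  have xs: "distinct xs" "set xs \<subseteq> pverts G" "length xs = 9"
    using abcd wxyz AB A(1) B(1) v by (auto simp: xs_def)
  have nth: "xs ! 0 = v" "xs ! 1 = a" "xs ! 2 = b" "xs ! 3 = c" "xs ! 4 = d"
    "xs ! 5 = w" "xs ! 6 = x" "xs ! 7 = y" "xs ! 8 = z" by (simp_all add: xs_def)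
  have red: "(v, a) \<in> parcs G" "(v, b) \<in> parcs G" "(v, c) \<in> parcs G" "(v, d) \<in> parcs G"
    using A(3) by (simp_all add: abcd(1))
  have blue: "(v, w) \<notin> parcs G" "(v, x) \<notin> parcs G" "(v, y) \<notin> parcs G" "(v, z) \<notin> parcs G"
    using B(3) by (simp_all add: wxyz(1))
  show False
  proof (rule balanced_vertex_core[where r = "\<lambda>i j. (xs ! i, xs ! j) \<in> parcs G"])
    show "list_all (\<lambda>ss. bicoloured (\<lambda>i j. (xs ! i, xs ! j) \<in> parcs G) (seg_pairs ss)) segments_balanced"
      using segments_bicoloured_all[OF xs(1,2)] valid_segments_balanced xs(3) by simp
    show "((xs ! i, xs ! j) \<in> parcs G) = ((xs ! j, xs ! i) \<in> parcs G)" for i j by (rule arc_commute)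
  qed (simp_all only: nth quad columns red blue simp_thms)
qed

text \<open>Degrees are counted within \<open>V\<close> only, so the nine vertices may come from a
  larger graph.\<close>

lemma no_five_low_vertices:
  assumes V: "V \<subseteq> pverts G" "card V = 9" and L: "L \<subseteq> V" "5 \<le> card L"
    "\<And>v. v \<in> L \<Longrightarrow> card {w \<in> V. (v, w) \<in> parcs G} \<le> 3"
  shows False
proof -
  have finV: "finite V" using V(1) pair_finite_verts finite_subset by blast
  obtain L' where L': "L' \<subseteq> L" "card L' = 5" "finite L'" by (rule obtain_subset_with_card_n[OF L(2)])
  \<comment> \<open>One of the five low vertices is set aside as index 4, which leaves the four that
    \<open>sorted_quad\<close> can order.\<close>
  obtain e where e: "e \<in> L'" using L'(2) by fastforce
  define A where "A = L' - {e}"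
  define B where "B = V - L'"
  have LV: "L' \<subseteq> V" "finite L'" using L'(1,3) L(1) by (auto intro: subset_trans)
  have cA: "card A = 4" using L'(2) e LV(2) by (simp add: A_def)
  have cB: "card B = 4" using V(2) LV L'(2) by (simp add: B_def card_Diff_subset)
  obtain a b c d where abcd: "A = {a, b, c, d}" "distinct [a, b, c, d]"
    and quad: "sorted_quad ((a, b) \<in> parcs G) ((a, c) \<in> parcs G) ((a, d) \<in> parcs G)
      ((b, c) \<in> parcs G) ((b, d) \<in> parcs G) ((c, d) \<in> parcs G)"
    using sorted_quad_arrangement[OF cA, of "\<lambda>x y. (x, y) \<in> parcs G"] arc_commute by metis
  obtain w x y z where wxyz: "B = {w, x, y, z}" "distinct [w, x, y, z]"
    and columns: "lexge [(a, w) \<in> parcs G, (b, w) \<in> parcs G, (c, w) \<in> parcs G, (d, w) \<in> parcs G, (e, w) \<in> parcs G]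
        [(a, x) \<in> parcs G, (b, x) \<in> parcs G, (c, x) \<in> parcs G, (d, x) \<in> parcs G, (e, x) \<in> parcs G]"
      "lexge [(a, x) \<in> parcs G, (b, x) \<in> parcs G, (c, x) \<in> parcs G, (d, x) \<in> parcs G, (e, x) \<in> parcs G]
        [(a, y) \<in> parcs G, (b, y) \<in> parcs G, (c, y) \<in> parcs G, (d, y) \<in> parcs G, (e, y) \<in> parcs G]"
      "lexge [(a, y) \<in> parcs G, (b, y) \<in> parcs G, (c, y) \<in> parcs G, (d, y) \<in> parcs G, (e, y) \<in> parcs G]
        [(a, z) \<in> parcs G, (b, z) \<in> parcs G, (c, z) \<in> parcs G, (d, z) \<in> parcs G, (e, z) \<in> parcs G]"
    by (rule lexge_arrangement[OF cB, of "\<lambda>u. [(a, u) \<in> parcs G, (b, u) \<in> parcs G, (c, u) \<in> parcs G, (d, u) \<in> parcs G, (e, u) \<in> parcs G]" 5])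
      simp_all
  define xs where "xs = [a, b, c, d, e, w, x, y, z]"
  have L'eq: "L' = {a, b, c, d, e}" using abcd(1) e by (auto simp: A_def)
  have "e \<notin> A" "A \<inter> B = {}" "e \<notin> B" using e by (auto simp: A_def B_def)
  then have xs: "distinct xs" "length xs = 9" using abcd wxyz by (auto simp: xs_def)
  have setxs: "set xs = V" using LV L'eq wxyz(1) by (auto simp: xs_def B_def)
  have nth: "xs ! 0 = a" "xs ! 1 = b" "xs ! 2 = c" "xs ! 3 = d" "xs ! 4 = e"
    "xs ! 5 = w" "xs ! 6 = x" "xs ! 7 = y" "xs ! 8 = z" by (simp_all add: xs_def)
  have degrees: "list_all (\<lambda>js. list_ex (\<lambda>j. (xs ! hd js, xs ! j) \<notin> parcs G) (tl js)) stars_low"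
    unfolding list_all_iff
  proof
    fix js assume js: "js \<in> set stars_low"
    have v: "length js = 5" "distinct js" "hd js < 5" "\<And>j. j \<in> set js \<Longrightarrow> j < 9"
      using valid_stars_low js by (auto simp: list_all_iff)
    show "list_ex (\<lambda>j. (xs ! hd js, xs ! j) \<notin> parcs G) (tl js)"
    proof (rule ccontr)
      assume "\<not> ?thesis"
      then have adj: "\<And>j. j \<in> set (tl js) \<Longrightarrow> (xs ! hd js, xs ! j) \<in> parcs G" by (auto simp: list_ex_iff)
      have tl: "set (tl js) \<subseteq> set js" "card (set (tl js)) = 4"
        using v(1,2) by (auto simp: list.set_sel(2) distinct_tl distinct_card) (metis list.sel(2) list.set_sel(2))
      \<comment> \<open>By injectivity a star with four red edges would give a low vertex four
        neighbours in \<open>V\<close>.\<close>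
      have inj: "inj_on ((!) xs) (set (tl js))"
        using xs v(4) tl(1) by (auto simp: inj_on_def nth_eq_iff_index_eq subset_iff)
      have "(!) xs ` set (tl js) \<subseteq> {w \<in> V. (xs ! hd js, w) \<in> parcs G}"
        using adj setxs xs(2) v(4) tl(1) by (auto simp: subset_iff)
      then have "card ((!) xs ` set (tl js)) \<le> card {w \<in> V. (xs ! hd js, w) \<in> parcs G}"
        by (intro card_mono) (simp_all add: finV)
      then have "4 \<le> card {w \<in> V. (xs ! hd js, w) \<in> parcs G}"
        using card_image[OF inj] tl(2) by simp
      moreover have "xs ! hd js \<in> L'"
        using v(3) unfolding L'eq xs_def by (auto simp: less_Suc_eq numeral_eq_Suc)
      ultimately show False using L(3) L'(1) by fastforce
    qed
  qed
  show False
  proof (rule few_red_neighbours_core[where r = "\<lambda>i j. (xs ! i, xs ! j) \<in> parcs G"])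
    show "list_all (\<lambda>ss. bicoloured (\<lambda>i j. (xs ! i, xs ! j) \<in> parcs G) (seg_pairs ss)) segments_low"
      using segments_bicoloured_all[OF xs(1)] valid_segments_low xs(2) setxs V(1) by simp
    show "((xs ! i, xs ! j) \<in> parcs G) = ((xs ! j, xs ! i) \<in> parcs G)" for i j by (rule arc_commute)
    show "list_all (\<lambda>js. list_ex (\<lambda>j. (xs ! hd js, xs ! j) \<notin> parcs G) (tl js)) stars_low" by (rule degrees)
  qed (simp_all only: nth quad columns)
qed

end

text \<open>Within nine vertices the red and the blue degree add up to 8. If no vertex is split
  evenly, each has at most three neighbours in one of the colours, and because nine exceeds four
  plus four, five vertices share such a colour. The larger graph keeps its own embedding; no induced
  subgraph is formed.\<close>

lemma biplanar_order_le_eight: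
  assumes "biplanar G"
  shows "card (pverts G) \<le> 8"
proof (rule ccontr)
  interpret biplanar G by fact
  interpret co: biplanar "complement_graph G" by (rule biplanar_complement)
  assume "\<not> ?thesis"
  then have "9 \<le> card (pverts G)" by simp
  then obtain V where V: "V \<subseteq> pverts G" "card V = 9" "finite V"
    by (rule obtain_subset_with_card_n)
  define R where "R v = {w \<in> V. (v, w) \<in> parcs G}" for v
  define B where "B v = {w \<in> V. (v, w) \<in> parcs (complement_graph G)}" for v
  have RB: "card (R v) + card (B v) = 8" if "v \<in> V" for v
  proof -
    have "R v \<inter> B v = {}" "R v \<union> B v = V - {v}"
      using that V(1) no_loop by (auto simp: R_def B_def parcs_complement)
    then show ?thesis using V that card_Un_disjoint[of "R v" "B v"] by (simp add: R_def B_def)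
  qed
  have "card (R v) \<noteq> 4" if "v \<in> V" for v
  proof
    assume 4: "card (R v) = 4"
    then have "card (B v) = 4" using RB[OF that] by simp
    then show False
      by (rule no_balanced_vertex[of v "R v" "B v", rotated 5])
        (use 4 that V(1) in \<open>auto simp: R_def B_def parcs_complement\<close>)
  qed
  then have V_eq: "V = {v \<in> V. card (R v) \<le> 3} \<union> {v \<in> V. card (B v) \<le> 3}" (is "_ = ?L \<union> ?M")
    using RB by fastforce
  have "card V \<le> card ?L + card ?M" by (subst V_eq) (rule card_Un_le)
  then consider "5 \<le> card ?L" | "5 \<le> card ?M" using V(2) by linarith
  then show False
  proof cases
    case 1
    show False by (rule no_five_low_vertices[OF V(1,2) _ 1]) (auto simp: R_def)
  next
    case 2
    show False by (rule co.no_five_low_vertices[OF _ V(2) _ 2]) (use V(1) in \<open>auto simp: B_def\<close>)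
  qed
qed

section \<open>Cuts, minimum degree and parity\<close>

context pair_graph
begin

text \<open>Connectivity as the absence of empty cuts, the form in which it becomes a clause and is
  easily transported. One direction takes for \<open>P\<close> the set of vertices reachable from
  \<open>u\<close>. The empty graph counts as disconnected.\<close>

lemma connected_induce_iff:
  assumes "W \<subseteq> pverts G"
  shows "Digraph_Component.connected (with_proj G \<restriction> W) \<longleftrightarrow>
    W \<noteq> {} \<and> (\<forall>P \<subseteq> W. P \<noteq> {} \<longrightarrow> P \<noteq> W \<longrightarrow> (\<exists>u \<in> P. \<exists>v \<in> W - P. (u, v) \<in> parcs G))"
proof -
  let ?R = "{(u, v) \<in> parcs G. u \<in> W \<and> v \<in> W}"
  have "parcs (mk_symmetric (with_proj G \<restriction> W)) = ?R"
    using arc_commute by (auto simp: parcs_mk_symmetric)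
  then have *: "Digraph_Component.connected (with_proj G \<restriction> W) \<longleftrightarrow>
      W \<noteq> {} \<and> (\<forall>u \<in> W. \<forall>v \<in> W. (u, v) \<in> rtrancl_on W ?R)"
    by (simp add: Digraph_Component.connected_def strongly_connected_def reachable_def)
  show ?thesis unfolding *
  proof (intro conj_cong refl iffI allI impI)
    fix P assume con: "\<forall>u \<in> W. \<forall>v \<in> W. (u, v) \<in> rtrancl_on W ?R" and P: "P \<subseteq> W" "P \<noteq> {}" "P \<noteq> W"
    obtain u v where uv: "u \<in> P" "v \<in> W - P" using P by blast
    show "\<exists>u \<in> P. \<exists>v \<in> W - P. (u, v) \<in> parcs G"
    proof (rule ccontr)
      assume no: "\<not> ?thesis"
      have "(u, v) \<in> rtrancl_on W ?R" using con uv P by blast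
      then have "v \<in> P" by (induction rule: rtrancl_on_induct) (use uv no in auto)
      then show False using uv by blast
    qed
  next
    assume cut: "\<forall>P \<subseteq> W. P \<noteq> {} \<longrightarrow> P \<noteq> W \<longrightarrow> (\<exists>u \<in> P. \<exists>v \<in> W - P. (u, v) \<in> parcs G)"
    show "\<forall>u \<in> W. \<forall>v \<in> W. (u, v) \<in> rtrancl_on W ?R"
    proof (intro ballI)
      fix u v assume uv: "u \<in> W" "v \<in> W"
      define P where "P = {x \<in> W. (u, x) \<in> rtrancl_on W ?R}"
      have "P = W"
      proof (rule ccontr)
        assume "P \<noteq> W"
        moreover have "u \<in> P" "P \<subseteq> W" using uv by (auto simp: P_def)
        ultimately obtain x y where "x \<in> P" "y \<in> W - P" "(x, y) \<in> parcs G" using cut by blast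
        then have "(u, x) \<in> rtrancl_on W ?R" "(x, y) \<in> ?R" "y \<in> W" by (simp_all add: P_def)
        then have "(u, y) \<in> rtrancl_on W ?R" by (rule rtrancl_on_into_rtrancl_on)
        then show False using \<open>y \<in> W - P\<close> by (simp add: P_def)
      qed
      then show "(u, v) \<in> rtrancl_on W ?R" using uv(2) by (auto simp: P_def)
    qed
  qed
qed

text \<open>At most two vertices lie outside the two sets; deleting them leaves a connected graph,
  in which the cut between \<open>P\<close> and \<open>Q\<close> is not empty.\<close>

lemma three_connected_crossing:
  assumes "three_connected G" "P \<union> Q \<subseteq> pverts G" "P \<inter> Q = {}" "P \<noteq> {}" "Q \<noteq> {}"
    "card (pverts G) \<le> card (P \<union> Q) + 2"
  shows "\<exists>u \<in> P. \<exists>v \<in> Q. (u, v) \<in> parcs G"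
proof -
  define S where "S = pverts G - (P \<union> Q)"
  have "finite (P \<union> Q)" using assms(2) pair_finite_verts finite_subset by blast
  then have "card S \<le> 2" using assms(2,6) by (simp add: S_def card_Diff_subset)
  moreover have W: "pverts G - S = P \<union> Q" using assms(2) by (auto simp: S_def)
  ultimately have "Digraph_Component.connected (with_proj G \<restriction> (P \<union> Q))"
    using assms(1) unfolding three_connected_def by (metis Diff_subset S_def)
  then have "\<exists>u \<in> P. \<exists>v \<in> P \<union> Q - P. (u, v) \<in> parcs G"
    unfolding connected_induce_iff[OF assms(2)] using assms(3-5) by blast
  then show ?thesis by blast
qed

text \<open>Two or fewer neighbours would separate \<open>v\<close> from the remaining vertices
  \<open>Q\<close>, and \<open>Q\<close> is nonempty because there are at least four
  vertices.\<close>

lemma three_connected_degree: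
  assumes "three_connected G" "v \<in> pverts G"
  shows "3 \<le> card {w \<in> pverts G. (v, w) \<in> parcs G}" (is "_ \<le> card ?N")
proof (rule ccontr)
  assume "\<not> ?thesis"
  then have N: "card ?N \<le> 2" by simp
  have fin: "finite (pverts G)" by (rule pair_finite_verts)
  define Q where "Q = pverts G - ?N - {v}"
  have vN: "v \<notin> ?N" using no_loop by simp
  have cQ: "card Q + card ?N + 1 = card (pverts G)"
  proof -
    have "card (insert v ?N) = card ?N + 1" using fin vN by simp
    moreover have "Q = pverts G - insert v ?N" by (auto simp: Q_def)
    moreover have "insert v ?N \<subseteq> pverts G" using assms(2) by auto
    ultimately show ?thesis
      using fin by (metis (no_types, lifting) add.assoc card_Diff_subset card_mono finite_subset le_add_diff_inverse2)
  qed
  have "4 \<le> card (pverts G)" using assms(1) by (simp add: three_connected_def)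
  then have "Q \<noteq> {}" using cQ N by auto
  moreover have "v \<notin> Q" "finite Q" using fin by (auto simp: Q_def)
  then have "card ({v} \<union> Q) = card Q + 1" by simp
  ultimately have "\<exists>u \<in> {v}. \<exists>w \<in> Q. (u, w) \<in> parcs G"
    using cQ N assms(2) by (intro three_connected_crossing[OF assms(1)]) (auto simp: Q_def)
  then show False by (auto simp: Q_def)
qed

text \<open>The arcs are partitioned into pairs of opposite arcs; absence of loops makes each block
  have two elements.\<close>

lemma even_card_arcs: "even (card (parcs G))"
proof -
  let ?C = "(\<lambda>(u, v). {(u, v), (v, u)}) ` parcs G"
  have "2 * card ?C = card (\<Union>?C)"
  proof (rule card_partition)
    show "finite ?C" "finite (\<Union>?C)" using pair_finite_arcs by auto
    show "card c = 2" if c: "c \<in> ?C" for c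
    proof -
      obtain u v where "(u, v) \<in> parcs G" "c = {(u, v), (v, u)}" using c by auto
      moreover from this have "u \<noteq> v" using no_loop by auto
      ultimately show ?thesis by simp
    qed
    show "c \<inter> d = {}" if "c \<in> ?C" "d \<in> ?C" "c \<noteq> d" for c d using that by auto
  qed
  moreover have "\<Union>?C = parcs G"
  proof
    show "\<Union>?C \<subseteq> parcs G" by (auto dest: arc_commute[THEN iffD1])
    show "parcs G \<subseteq> \<Union>?C" by auto
  qed
  ultimately have "card (parcs G) = 2 * card ?C" by (simp only:)
  then show ?thesis by (rule dvdI)
qed

lemma card_arcs: "card (parcs G) = (\<Sum>v \<in> pverts G. card {w \<in> pverts G. (v, w) \<in> parcs G})"
proof -
  have "parcs G = (SIGMA v:pverts G. {w \<in> pverts G. (v, w) \<in> parcs G})" (is "_ = ?S")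
    using wellformed' by auto
  then have "card (parcs G) = card ?S" by (rule arg_cong)
  then show ?thesis using pair_finite_verts by simp
qed

end

section \<open>The case of eight vertices\<close>

definition valid_cut :: "nat list \<times> nat list \<Rightarrow> bool" where
  "valid_cut = (\<lambda>(P, Q). P \<noteq> [] \<and> Q \<noteq> [] \<and> distinct (P @ Q) \<and> length (P @ Q) = 6 \<and> list_all (\<lambda>i. i < 8) (P @ Q))"

lemma valid_cuts_eight: "list_all valid_cut cuts_eight"
  by code_simp

lemma valid_labellings:
  "list_all (\<lambda>q. length q = 8 \<and> distinct q \<and> list_all (\<lambda>i. i < 8) q) (labellings1 @ labellings2 @ labellings3)"
  by code_simp

text \<open>Arcs are listed in one orientation, symmetry of \<open>G\<close> supplies the other. For
  a model and its twist the two lists settle all pairs of vertices and so determine \<open>G\<close>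
  up to isomorphism.\<close>

definition labelled ::
    "('a list \<Rightarrow> ('a \<times> 'a) list) \<Rightarrow> ('a list \<Rightarrow> 'a list) \<Rightarrow> 'a pair_pre_digraph \<Rightarrow> 'a list \<Rightarrow> bool" where
  "labelled m t G ys \<longleftrightarrow> distinct ys \<and> length ys = 8 \<and> set ys = pverts G \<and>
    set (m ys) \<subseteq> parcs G \<and> set (m (t ys)) \<inter> parcs G = {}"

lemma length_eight:
  assumes "length q = 8"
  obtains a b c d e f g h where "q = [a, b, c, d, e, f, g, h]"
  using assms by (auto simp: numeral_eq_Suc length_Suc_conv)

lemma model_map:
  assumes "length q = 8"
  shows "model1 (map f q) = map (map_prod f f) (model1 q)" "twist1 (map f q) = map f (twist1 q)" "length (twist1 q) = 8"
    "model2 (map f q) = map (map_prod f f) (model2 q)" "twist2 (map f q) = map f (twist2 q)" "length (twist2 q) = 8"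
    "model3 (map f q) = map (map_prod f f) (model3 q)" "twist3 (map f q) = map f (twist3 q)" "length (twist3 q) = 8"
  by (rule length_eight[OF assms], simp)+

text \<open>Eight distinct indices below 8 form a permutation, so \<open>xs\<close> carries
  \<open>q\<close> to a list of all vertices. The lists \<open>es\<close> and \<open>fs\<close>
  stand for the model and its twist at type \<open>nat\<close>, where \<open>m\<close> itself cannot
  be applied.\<close>

lemma labelled_map:
  fixes xs :: "'a list"
  assumes xs: "distinct xs" "length xs = 8" "set xs = pverts G"
    and q: "length q = 8 \<and> distinct q \<and> list_all (\<lambda>i. i < 8) q"
    and col: "all_coloured (\<lambda>i j. (xs ! i, xs ! j) \<in> parcs G) es fs"
    and m: "m (map ((!) xs) q) = map (map_prod ((!) xs) ((!) xs)) es"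
      "m (t (map ((!) xs) q)) = map (map_prod ((!) xs) ((!) xs)) fs"
  shows "labelled m t G (map ((!) xs) q)"
proof -
  have q8: "set q \<subseteq> {..<8}" using q by (auto simp: list_all_iff)
  have "card (set q) = 8" using q distinct_card by metis
  then have setq: "set q = {..<8}" using q8 by (simp add: card_subset_eq)
  have inj: "inj_on ((!) xs) (set q)" using xs q8 by (auto simp: inj_on_def nth_eq_iff_index_eq subset_iff)
  have "(!) xs ` {..<8} = pverts G" using xs by (auto simp: set_conv_nth)
  moreover have "(xs ! i, xs ! j) \<in> parcs G" if "(i, j) \<in> set es" for i j
    using col that by (auto simp: all_coloured_def list_ex_iff)
  moreover have "(xs ! i, xs ! j) \<notin> parcs G" if "(i, j) \<in> set fs" for i j
    using col that by (auto simp: all_coloured_def list_ex_iff)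
  ultimately show ?thesis
    using q inj setq unfolding labelled_def m by (auto simp: distinct_map)
qed

locale bipolyhedral = biplanar G for G :: "'a pair_pre_digraph" +
  assumes conn: "three_connected G" and coconn: "three_connected (complement_graph G)"
begin

lemma bipolyhedral_complement: "bipolyhedral (complement_graph G)"
  unfolding bipolyhedral_def bipolyhedral_axioms_def
  by (simp add: biplanar_complement conn coconn complement_complement)

lemma degree_codegree:
  assumes "v \<in> pverts G"
  shows "card {w \<in> pverts G. (v, w) \<in> parcs G} + card {w \<in> pverts G. (v, w) \<in> parcs (complement_graph G)} + 1
    = card (pverts G)" (is "card ?R + card ?B + 1 = _")
proof -
  have "?R \<inter> ?B = {}" "?R \<union> ?B = pverts G - {v}"
    using assms no_loop by (auto simp: parcs_complement)
  then have "card ?R + card ?B = card (pverts G - {v})"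
    using pair_finite_verts card_Un_disjoint[of ?R ?B] by simp
  moreover have "card (pverts G) > 0" using assms pair_finite_verts card_gt_0_iff by blast
  ultimately show ?thesis using assms pair_finite_verts by simp
qed

lemma order_eq_eight: "card (pverts G) = 8"
proof -
  interpret co: pair_graph "complement_graph G" by (rule pair_graph_complement)
  have le: "card (pverts G) \<le> 8" by (rule biplanar_order_le_eight) unfold_locales
  have deg: "3 \<le> card {w \<in> pverts G. (v, w) \<in> parcs G}"
    "3 \<le> card {w \<in> pverts G. (v, w) \<in> parcs (complement_graph G)}" if "v \<in> pverts G" for v
    using three_connected_degree[OF conn that] co.three_connected_degree[OF coconn] that by simp_all
  have "4 \<le> card (pverts G)" using conn by (simp add: three_connected_def)
  then obtain v where v: "v \<in> pverts G" by fastforce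
  have "7 \<le> card (pverts G)" using deg[OF v] degree_codegree[OF v] by simp
  moreover have "card (pverts G) \<noteq> 7"
  proof
    assume 7: "card (pverts G) = 7"
    \<comment> \<open>On seven vertices both degrees are forced to be 3, which makes 21
      arcs.\<close>
    have "card {w \<in> pverts G. (v, w) \<in> parcs G} = 3" if "v \<in> pverts G" for v
      using deg[OF that] degree_codegree[OF that] 7 by simp
    then have "card (parcs G) = 21" using card_arcs 7 by simp
    then show False using even_card_arcs by simp
  qed
  ultimately show ?thesis using le by simp
qed

text \<open>\<open>P\<close> and \<open>Q\<close> leave out two of the eight vertices, so
  three-connectedness of \<open>G\<close> gives a red edge between them and that of the complement a
  blue one.\<close>

lemma cuts_bicoloured:
  assumes xs: "distinct xs" "set xs = pverts G" "length xs = 8"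
  shows "list_all (\<lambda>(P, Q). bicoloured (\<lambda>i j. (xs ! i, xs ! j) \<in> parcs G) (List.product P Q)) cuts_eight"
  unfolding list_all_iff
proof (clarify)
  interpret co: pair_graph "complement_graph G" by (rule pair_graph_complement)
  fix P Q assume "(P, Q) \<in> set cuts_eight"
  then have PQ: "P \<noteq> []" "Q \<noteq> []" "distinct (P @ Q)" "length (P @ Q) = 6" "\<And>i. i \<in> set P \<union> set Q \<Longrightarrow> i < 8"
    using valid_cuts_eight by (fastforce simp: list_all_iff valid_cut_def)+
  let ?f = "(!) xs"
  have inj: "inj_on ?f (set P \<union> set Q)" using xs PQ(5) by (auto simp: inj_on_def nth_eq_iff_index_eq)
  have sub: "?f ` set P \<union> ?f ` set Q \<subseteq> pverts G" using xs PQ(5) by auto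
  have disj: "?f ` set P \<inter> ?f ` set Q = {}"
    using inj_on_image_Int[OF inj, of "set P" "set Q"] PQ(3) by auto
  have "card (set (P @ Q)) = 6" using PQ(3,4) distinct_card by metis
  then have card6: "card (pverts G) \<le> card (?f ` set P \<union> ?f ` set Q) + 2"
    using card_image[OF inj] order_eq_eight by (simp add: image_Un)
  have "\<exists>u \<in> ?f ` set P. \<exists>v \<in> ?f ` set Q. (u, v) \<in> parcs G"
    using three_connected_crossing[OF conn sub disj] PQ(1,2) card6 by simp
  moreover have "\<exists>u \<in> ?f ` set P. \<exists>v \<in> ?f ` set Q. (u, v) \<in> parcs (complement_graph G)"
    using co.three_connected_crossing[OF coconn _ disj] sub PQ(1,2) card6 by simp
  ultimately show "bicoloured (\<lambda>i j. (xs ! i, xs ! j) \<in> parcs G) (List.product P Q)"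
    unfolding bicoloured_def list_ex_iff by (fastforce simp: parcs_complement)
qed

lemma labelling_of_degree_three:
  assumes v: "v \<in> pverts G" and deg: "card {w \<in> pverts G. (v, w) \<in> parcs G} = 3"
  shows "\<exists>ys. labelled model1 twist1 G ys \<or> labelled model2 twist2 G ys \<or> labelled model3 twist3 G ys"
proof -
  define A where "A = {w \<in> pverts G. (v, w) \<in> parcs G}"
  define B where "B = {w \<in> pverts G. (v, w) \<in> parcs (complement_graph G)}"
  have cA: "card A = 3" using deg by (simp add: A_def)
  have cB: "card B = 4" using degree_codegree[OF v] deg order_eq_eight by (simp add: B_def)
  obtain a b c where abc: "A = {a, b, c}" "distinct [a, b, c]"
    and triple: "sorted_triple ((a, b) \<in> parcs G) ((a, c) \<in> parcs G) ((b, c) \<in> parcs G)"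
    using sorted_triple_arrangement[OF cA, of "\<lambda>x y. (x, y) \<in> parcs G"] arc_commute by metis
  obtain w x y z where wxyz: "B = {w, x, y, z}" "distinct [w, x, y, z]"
    and columns: "lexge [(a, w) \<in> parcs G, (b, w) \<in> parcs G, (c, w) \<in> parcs G]
        [(a, x) \<in> parcs G, (b, x) \<in> parcs G, (c, x) \<in> parcs G]"
      "lexge [(a, x) \<in> parcs G, (b, x) \<in> parcs G, (c, x) \<in> parcs G]
        [(a, y) \<in> parcs G, (b, y) \<in> parcs G, (c, y) \<in> parcs G]"
      "lexge [(a, y) \<in> parcs G, (b, y) \<in> parcs G, (c, y) \<in> parcs G]
        [(a, z) \<in> parcs G, (b, z) \<in> parcs G, (c, z) \<in> parcs G]"
    by (rule lexge_arrangement[OF cB, of "\<lambda>u. [(a, u) \<in> parcs G, (b, u) \<in> parcs G, (c, u) \<in> parcs G]" 3])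
      simp_all
  define xs where "xs = [v, a, b, c, w, x, y, z]"
  have AB: "A \<inter> B = {}" "v \<notin> A" "v \<notin> B" "pverts G = insert v (A \<union> B)"
    using v no_loop by (auto simp: A_def B_def parcs_complement)
  have xs: "distinct xs" "length xs = 8" "set xs = pverts G"
    using abc wxyz AB by (auto simp: xs_def)
  have nth: "xs ! 0 = v" "xs ! 1 = a" "xs ! 2 = b" "xs ! 3 = c"
    "xs ! 4 = w" "xs ! 5 = x" "xs ! 6 = y" "xs ! 7 = z" by (simp_all add: xs_def)
  have "a \<in> A" "b \<in> A" "c \<in> A" by (simp_all add: abc(1))
  then have red: "(v, a) \<in> parcs G" "(v, b) \<in> parcs G" "(v, c) \<in> parcs G" by (simp_all add: A_def)
  have "w \<in> B" "x \<in> B" "y \<in> B" "z \<in> B" by (simp_all add: wxyz(1))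
  then have blue: "(v, w) \<notin> parcs G" "(v, x) \<notin> parcs G" "(v, y) \<notin> parcs G" "(v, z) \<notin> parcs G"
    by (simp_all add: B_def parcs_complement)
  let ?r = "\<lambda>i j. (xs ! i, xs ! j) \<in> parcs G"
  have "list_ex (\<lambda>q. all_coloured ?r (model1 q) (model1 (twist1 q))) labellings1 \<or>
    list_ex (\<lambda>q. all_coloured ?r (model2 q) (model2 (twist2 q))) labellings2 \<or>
    list_ex (\<lambda>q. all_coloured ?r (model3 q) (model3 (twist3 q))) labellings3"
  proof (rule order_eight_core)
    show "((xs ! i, xs ! j) \<in> parcs G) = ((xs ! j, xs ! i) \<in> parcs G)" for i j by (rule arc_commute)
    show "list_all (\<lambda>ss. bicoloured ?r (seg_pairs ss)) segments_eight"
      using segments_bicoloured_all[OF xs(1)] valid_segments_eight xs(2,3) by simp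
    show "list_all (\<lambda>(P, Q). bicoloured ?r (List.product P Q)) cuts_eight"
      by (rule cuts_bicoloured[OF xs(1,3,2)])
  qed (simp_all only: nth triple columns red blue simp_thms)
  then consider q where "q \<in> set labellings1" "all_coloured ?r (model1 q) (model1 (twist1 q))"
    | q where "q \<in> set labellings2" "all_coloured ?r (model2 q) (model2 (twist2 q))"
    | q where "q \<in> set labellings3" "all_coloured ?r (model3 q) (model3 (twist3 q))"
    by (auto simp: list_ex_iff)
  then show ?thesis
  proof cases
    case 1
    then have q: "length q = 8 \<and> distinct q \<and> list_all (\<lambda>i. i < 8) q"
      using valid_labellings by (auto simp: list_all_iff)
    show ?thesis
      by (intro exI[of _ "map ((!) xs) q"] disjI1 labelled_map[OF xs q 1(2)]) (use q in \<open>simp_all add: model_map\<close>)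
  next
    case 2
    then have q: "length q = 8 \<and> distinct q \<and> list_all (\<lambda>i. i < 8) q"
      using valid_labellings by (auto simp: list_all_iff)
    show ?thesis
      by (intro exI[of _ "map ((!) xs) q"] disjI2[OF disjI1] labelled_map[OF xs q 2(2)]) (use q in \<open>simp_all add: model_map\<close>)
  next
    case 3
    then have q: "length q = 8 \<and> distinct q \<and> list_all (\<lambda>i. i < 8) q"
      using valid_labellings by (auto simp: list_all_iff)
    show ?thesis
      by (intro exI[of _ "map ((!) xs) q"] disjI2[OF disjI2] labelled_map[OF xs q 3(2)]) (use q in \<open>simp_all add: model_map\<close>)
  qed
qed

end

section \<open>Isomorphisms as vertex bijections, and the model graphs\<close>

text \<open>A \<open>digraph_iso\<close> also carries a map of arcs and new head and tail functions.
  With arcs that are pairs of vertices, \<open>f\<close> determines all of them.\<close>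

lemma digraph_isoI:
  assumes "pair_graph G" "pair_graph H" "bij_betw f (pverts G) (pverts H)"
    "\<And>u v. u \<in> pverts G \<Longrightarrow> v \<in> pverts G \<Longrightarrow> (f u, f v) \<in> parcs H \<longleftrightarrow> (u, v) \<in> parcs G"
  shows "digraph_iso (with_proj G) (with_proj H)"
proof -
  interpret G: pair_graph G by fact
  interpret H: pair_graph H by fact
  define hom where "hom = \<lparr> iso_verts = f, iso_arcs = map_prod f f, iso_head = snd, iso_tail = fst \<rparr>"
  have inj: "inj_on f (pverts G)" and img: "f ` pverts G = pverts H" using assms(3) by (auto simp: bij_betw_def)
  have sub: "parcs G \<subseteq> pverts G \<times> pverts G" using G.wellformed' by auto
  have "inj_on (map_prod f f) (pverts G \<times> pverts G)" using inj by (auto simp: inj_on_def)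
  then have inj2: "inj_on (map_prod f f) (parcs G)" using sub by (rule inj_on_subset)
  have img2: "map_prod f f ` parcs G = parcs H"
  proof (intro set_eqI iffI)
    fix e assume "e \<in> map_prod f f ` parcs G"
    then obtain u v where "(u, v) \<in> parcs G" "e = (f u, f v)" by auto
    then show "e \<in> parcs H" using assms(4) G.wellformed' by auto
  next
    fix e assume e: "e \<in> parcs H"
    then have "fst e \<in> f ` pverts G" "snd e \<in> f ` pverts G"
      using H.arc_fst_in_verts H.arc_snd_in_verts img by auto
    then obtain u v where "u \<in> pverts G" "v \<in> pverts G" "fst e = f u" "snd e = f v" by auto
    then have uv: "u \<in> pverts G" "v \<in> pverts G" "e = (f u, f v)" by (simp_all add: prod_eq_iff)
    then have "(u, v) \<in> parcs G" using assms(4) e by simp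
    then show "e \<in> map_prod f f ` parcs G" using uv(3) by force
  qed
  have "G.digraph_isomorphism hom"
    unfolding G.digraph_isomorphism_def using inj inj2 G.wf_digraph_axioms by (simp add: hom_def)
  moreover have "with_proj H = app_iso hom (with_proj G)"
    by (simp add: app_iso_def hom_def img img2 with_proj_def)
  ultimately show ?thesis unfolding digraph_iso_def by blast
qed

lemma digraph_isoE:
  assumes "digraph_iso (with_proj G) (with_proj H)"
  obtains f where "bij_betw f (pverts G) (pverts H)"
    "\<And>u v. u \<in> pverts G \<Longrightarrow> v \<in> pverts G \<Longrightarrow> (f u, f v) \<in> parcs H \<longleftrightarrow> (u, v) \<in> parcs G"
proof -
  obtain hom where hom: "pre_digraph.digraph_isomorphism (with_proj G) hom" and H: "with_proj H = app_iso hom (with_proj G)"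
    using assms unfolding digraph_iso_def by blast
  define f where "f = iso_verts hom"
  have wf: "wf_digraph (with_proj G)" and inj: "inj_on f (pverts G)"
    and ends: "\<And>a. a \<in> parcs G \<Longrightarrow> f (fst a) = iso_tail hom (iso_arcs hom a) \<and> f (snd a) = iso_head hom (iso_arcs hom a)"
    using hom unfolding pre_digraph.digraph_isomorphism_def by (auto simp: f_def)
  interpret wf_digraph "with_proj G" by (rule wf)
  \<comment> \<open>Comparing the fields of \<open>H\<close> forces the new tail and head to be
    \<open>fst\<close> and \<open>snd\<close>, so the arc map is \<open>f\<close> on both
    components.\<close>
  have vH: "pverts H = f ` pverts G" and aH: "parcs H = iso_arcs hom ` parcs G"
    and tH: "iso_tail hom = fst" and hH: "iso_head hom = snd"
    using arg_cong[OF H, of verts] arg_cong[OF H, of arcs] arg_cong[OF H, of tail] arg_cong[OF H, of head]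
    by (simp_all add: f_def)
  have "iso_arcs hom a = (f (fst a), f (snd a))" if "a \<in> parcs G" for a
    using ends[OF that] by (simp add: tH hH prod_eq_iff)
  then have aH': "parcs H = (\<lambda>a. (f (fst a), f (snd a))) ` parcs G" unfolding aH by (rule image_cong[OF refl])
  have "(f u, f v) \<in> parcs H \<longleftrightarrow> (u, v) \<in> parcs G" if uv: "u \<in> pverts G" "v \<in> pverts G" for u v
  proof
    assume "(f u, f v) \<in> parcs H"
    then obtain a where a: "a \<in> parcs G" "f u = f (fst a)" "f v = f (snd a)" unfolding aH' by auto
    moreover have "fst a \<in> pverts G" "snd a \<in> pverts G" using wellformed a(1) by simp_all
    ultimately have "a = (u, v)" using inj uv by (auto simp: inj_on_def prod_eq_iff)
    then show "(u, v) \<in> parcs G" using a(1) by simp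
  qed (force simp: aH')
  then show ?thesis using that[of f] inj vH by (auto simp: bij_betw_def)
qed

definition model_arcs :: "(nat list \<Rightarrow> (nat \<times> nat) list) \<Rightarrow> (nat \<times> nat) list" where
  "model_arcs m = m [0..<8] @ map prod.swap (m [0..<8])"

definition model_graph :: "(nat list \<Rightarrow> (nat \<times> nat) list) \<Rightarrow> nat pair_pre_digraph" where
  "model_graph m = \<lparr> pverts = set [0..<8], parcs = set (model_arcs m) \<rparr>"

text \<open>An executable test that the twisted copy is the complement of the model. The bounds and
  inequalities on the arcs also make \<open>model_graph m\<close> a simple graph.\<close>

definition complementary :: "(nat list \<Rightarrow> (nat \<times> nat) list) \<Rightarrow> (nat list \<Rightarrow> nat list) \<Rightarrow> bool" where
  "complementary m t \<longleftrightarrow>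
    list_all (\<lambda>(i, j). i < 8 \<and> j < 8 \<and> i \<noteq> j \<and> (i, j) \<notin> set (model_arcs (m \<circ> t))) (model_arcs m) \<and>
    list_all (\<lambda>i. list_all (\<lambda>j. i = j \<or> (i, j) \<in> set (model_arcs m) \<or> (i, j) \<in> set (model_arcs (m \<circ> t))) [0..<8]) [0..<8]"

lemma complementary_models:
  "complementary model1 twist1" "complementary model2 twist2" "complementary model3 twist3"
  by code_simp+

lemma pair_graph_model:
  assumes "complementary m t"
  shows "pair_graph (model_graph m)"
proof (rule pair_graphI)
  fix u v assume uv: "(u, v) \<in> parcs (model_graph m)"
  then have "(v, u) \<in> parcs (model_graph m)" by (auto simp: model_graph_def model_arcs_def)
  then show "u \<in> pverts (model_graph m) \<and> v \<in> pverts (model_graph m) \<and> u \<noteq> v \<and> (v, u) \<in> parcs (model_graph m)"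
    using assms uv by (auto simp: complementary_def list_all_iff model_graph_def)
qed (simp add: model_graph_def)

text \<open>\<open>m\<close> and \<open>m'\<close> are one model at two types, and the last two
  hypotheses express its naturality. Red and blue pairs together cover all pairs of distinct
  indices, so indexing into \<open>ys\<close> preserves arcs and non-arcs.\<close>

lemma labelled_iso:
  fixes G :: "'a pair_pre_digraph" and m' :: "'a list \<Rightarrow> ('a \<times> 'a) list"
  assumes "pair_graph G" "complementary m t" "labelled m' t' G ys"
    and m': "m' ys = map (map_prod ((!) ys) ((!) ys)) (m [0..<8])"
      "m' (t' ys) = map (map_prod ((!) ys) ((!) ys)) (m (t [0..<8]))"
  shows "digraph_iso (with_proj G) (with_proj (model_graph m))"
proof -
  interpret pair_graph G by fact
  have ys: "distinct ys" "length ys = 8" "set ys = pverts G" "set (m' ys) \<subseteq> parcs G" "set (m' (t' ys)) \<inter> parcs G = {}"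
    using assms(3) by (auto simp: labelled_def)
  have red: "(ys ! i, ys ! j) \<in> parcs G" if "(i, j) \<in> set (model_arcs m)" for i j
  proof -
    have "(i, j) \<in> set (m [0..<8]) \<or> (j, i) \<in> set (m [0..<8])" using that by (auto simp: model_arcs_def)
    then have "(ys ! i, ys ! j) \<in> set (m' ys) \<or> (ys ! j, ys ! i) \<in> set (m' ys)" unfolding m' by force
    then show ?thesis using ys(4) arc_commute by blast
  qed
  have blue: "(ys ! i, ys ! j) \<notin> parcs G" if "(i, j) \<in> set (model_arcs (m \<circ> t))" for i j
  proof -
    have "(i, j) \<in> set (m (t [0..<8])) \<or> (j, i) \<in> set (m (t [0..<8]))" using that by (auto simp: model_arcs_def)
    then have "(ys ! i, ys ! j) \<in> set (m' (t' ys)) \<or> (ys ! j, ys ! i) \<in> set (m' (t' ys))" unfolding m' by force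
    then show ?thesis using ys(5) arc_commute by blast
  qed
  have "digraph_iso (with_proj (model_graph m)) (with_proj G)"
  proof (rule digraph_isoI)
    show "bij_betw ((!) ys) (pverts (model_graph m)) (pverts G)"
      using ys(1-3) by (intro bij_betw_nth) (auto simp: model_graph_def)
    fix i j assume "i \<in> pverts (model_graph m)" "j \<in> pverts (model_graph m)"
    then have "i < 8" "j < 8" by (auto simp: model_graph_def)
    then have "i = j \<or> (i, j) \<in> set (model_arcs m) \<or> (i, j) \<in> set (model_arcs (m \<circ> t))"
      using assms(2) by (auto simp: complementary_def list_all_iff)
    then show "(ys ! i, ys ! j) \<in> parcs G \<longleftrightarrow> (i, j) \<in> parcs (model_graph m)"
      using red blue no_loop by (auto simp: model_graph_def)
  qed (use assms(1,2) pair_graph_model in auto)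
  moreover have "wf_digraph (with_proj (model_graph m))"
    using pair_graph_model[OF assms(2)] by (simp add: wf_digraph_wp_iff pair_graph_def pair_digraph_def pair_fin_digraph_def)
  ultimately show ?thesis by (rule digraph_iso_swap[rotated])
qed

section \<open>The three graphs\<close>

text \<open>The embedding is pulled back along the bijection: an edge of \<open>G\<close> receives
  the curve of its image, and injectivity keeps distinct edges distinct.\<close>

lemma planar_iso:
  assumes "pair_graph G" "digraph_iso (with_proj G) (with_proj H)" "planar H"
  shows "planar G"
proof -
  interpret pair_graph G by fact
  obtain f where f: "bij_betw f (pverts G) (pverts H)"
    "\<And>u v. u \<in> pverts G \<Longrightarrow> v \<in> pverts G \<Longrightarrow> (f u, f v) \<in> parcs H \<longleftrightarrow> (u, v) \<in> parcs G"
    using digraph_isoE[OF assms(2)] by blast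
  have inj: "inj_on f (pverts G)" and img: "f ` pverts G = pverts H" using f(1) by (auto simp: bij_betw_def)
  obtain p \<gamma> where emb: "plane_embedding H p \<gamma>" using assms(3) by (auto simp: planar_def)
  have "plane_embedding G (p \<circ> f) (\<lambda>e. \<gamma> (f ` e))"
    unfolding plane_embedding_def
  proof (intro conjI ballI; clarify?)
    show "inj_on (p \<circ> f) (pverts G)"
      using emb inj img by (auto simp: plane_embedding_def intro: comp_inj_on)
  next
    fix u v assume uv: "(u, v) \<in> parcs G"
    then have "(f u, f v) \<in> parcs H" using f(2)[OF wellformed'[OF uv]] by simp
    then have "Path_Connected.arc (\<gamma> {f u, f v}) \<and> {pathstart (\<gamma> {f u, f v}), pathfinish (\<gamma> {f u, f v})} = {p (f u), p (f v)} \<and>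
        path_image (\<gamma> {f u, f v}) \<inter> p ` pverts H = {p (f u), p (f v)}"
      using emb unfolding plane_embedding_def by blast
    then show "Path_Connected.arc (\<gamma> (f ` {u, v})) \<and>
        {pathstart (\<gamma> (f ` {u, v})), pathfinish (\<gamma> (f ` {u, v}))} = {(p \<circ> f) u, (p \<circ> f) v} \<and>
        path_image (\<gamma> (f ` {u, v})) \<inter> (p \<circ> f) ` pverts G = {(p \<circ> f) u, (p \<circ> f) v}"
      by (simp add: img[symmetric] image_image)
  next
    fix u v x y z assume uv: "(u, v) \<in> parcs G" and xy: "(x, y) \<in> parcs G" and ne: "{u, v} \<noteq> {x, y}"
      and z: "z \<in> path_image (\<gamma> (f ` {u, v}))" "z \<in> path_image (\<gamma> (f ` {x, y}))"
    have sub: "{u, v} \<subseteq> pverts G" "{x, y} \<subseteq> pverts G" using uv xy wellformed' by auto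
    have arcs: "(f u, f v) \<in> parcs H" "(f x, f y) \<in> parcs H" using f(2)[OF wellformed'[OF uv]] f(2)[OF wellformed'[OF xy]] uv xy by simp_all
    have "f ` {u, v} \<noteq> f ` {x, y}" using inj_on_image_eq_iff[OF inj sub] ne by blast
    then have "{f u, f v} \<noteq> {f x, f y}" by simp
    then have "path_image (\<gamma> {f u, f v}) \<inter> path_image (\<gamma> {f x, f y}) \<subseteq> p ` ({f u, f v} \<inter> {f x, f y})"
      using emb arcs unfolding plane_embedding_def by (smt (verit) case_prodD)
    moreover have "{f u, f v} \<inter> {f x, f y} = f ` ({u, v} \<inter> {x, y})"
      using inj_on_image_Int[OF inj sub] by simp
    moreover have "z \<in> path_image (\<gamma> {f u, f v}) \<inter> path_image (\<gamma> {f x, f y})" using z by simp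
    ultimately have "z \<in> p ` f ` ({u, v} \<inter> {x, y})" by auto
    then show "z \<in> (p \<circ> f) ` ({u, v} \<inter> {x, y})" by (simp only: image_comp)
  qed
  then show ?thesis unfolding planar_def by blast
qed

text \<open>Connectivity after deletions is moved along the bijection by the cut criterion
  \<open>connected_induce_iff\<close>, which needs no walks.\<close>

lemma three_connected_iso:
  assumes "pair_graph G" "pair_graph H" "digraph_iso (with_proj G) (with_proj H)" "three_connected H"
  shows "three_connected G"
proof -
  interpret G: pair_graph G by fact
  interpret H: pair_graph H by fact
  obtain f where f: "bij_betw f (pverts G) (pverts H)"
    "\<And>u v. u \<in> pverts G \<Longrightarrow> v \<in> pverts G \<Longrightarrow> (f u, f v) \<in> parcs H \<longleftrightarrow> (u, v) \<in> parcs G"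
    using digraph_isoE[OF assms(3)] by blast
  have inj: "inj_on f (pverts G)" and img: "f ` pverts G = pverts H" using f(1) by (auto simp: bij_betw_def)
  have "Digraph_Component.connected (with_proj G \<restriction> (pverts G - S))" if S: "S \<subseteq> pverts G" "card S \<le> 2" for S
  proof -
    define W where "W = pverts G - S"
    have W: "W \<subseteq> pverts G" by (auto simp: W_def)
    have fW: "f ` W = pverts H - f ` S"
      unfolding W_def using inj_on_image_set_diff[OF inj, of "pverts G" S] S(1) img by auto
    have "f ` S \<subseteq> pverts H" "card (f ` S) \<le> 2"
      using S img card_image_le[of S f] finite_subset[OF S(1) G.pair_finite_verts] by (auto intro: order_trans)
    then have "Digraph_Component.connected (with_proj H \<restriction> f ` W)"
      using assms(4) unfolding three_connected_def fW by blast
    moreover have "f ` W \<subseteq> pverts H" using fW by blast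
    ultimately have ne: "W \<noteq> {}" and
      cut: "\<And>P. P \<subseteq> f ` W \<Longrightarrow> P \<noteq> {} \<Longrightarrow> P \<noteq> f ` W \<Longrightarrow> \<exists>u \<in> P. \<exists>v \<in> f ` W - P. (u, v) \<in> parcs H"
      using H.connected_induce_iff[of "f ` W"] by auto
    have "\<exists>u \<in> P. \<exists>v \<in> W - P. (u, v) \<in> parcs G" if P: "P \<subseteq> W" "P \<noteq> {}" "P \<noteq> W" for P
    proof -
      have PV: "P \<subseteq> pverts G" using P(1) W by (rule subset_trans)
      have "f ` P \<noteq> f ` W" using inj_on_image_eq_iff[OF inj PV W] P(3) by simp
      then obtain a b where ab: "a \<in> f ` P" "b \<in> f ` W - f ` P" "(a, b) \<in> parcs H"
        using cut[of "f ` P"] P by blast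
      obtain u v where uv: "u \<in> P" "a = f u" "v \<in> W" "b = f v" using ab(1,2) by blast
      have "v \<notin> P" using ab(2) uv(4) by blast
      moreover have "(u, v) \<in> parcs G" using f(2)[of u v] ab(3) uv PV W by blast
      ultimately show ?thesis using uv by blast
    qed
    then show ?thesis using ne G.connected_induce_iff[OF W] unfolding W_def by simp
  qed
  moreover have "4 \<le> card (pverts G)"
    using assms(4) bij_betw_same_card[OF f(1)] by (simp add: three_connected_def)
  ultimately show ?thesis unfolding three_connected_def by blast
qed

lemma digraph_iso_complement:
  assumes "pair_graph G" "pair_graph H" "digraph_iso (with_proj G) (with_proj H)"
  shows "digraph_iso (with_proj (complement_graph G)) (with_proj (complement_graph H))"
proof -
  obtain f where f: "bij_betw f (pverts G) (pverts H)"
    "\<And>u v. u \<in> pverts G \<Longrightarrow> v \<in> pverts G \<Longrightarrow> (f u, f v) \<in> parcs H \<longleftrightarrow> (u, v) \<in> parcs G"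
    using digraph_isoE[OF assms(3)] by blast
  have inj: "inj_on f (pverts G)" using f(1) by (simp add: bij_betw_def)
  show ?thesis
  proof (rule digraph_isoI)
    show "bij_betw f (pverts (complement_graph G)) (pverts (complement_graph H))" using f(1) by simp
    fix u v assume "u \<in> pverts (complement_graph G)" "v \<in> pverts (complement_graph G)"
    then have "u \<in> pverts G" "v \<in> pverts G" by simp_all
    then show "(f u, f v) \<in> parcs (complement_graph H) \<longleftrightarrow> (u, v) \<in> parcs (complement_graph G)"
      using f(2) bij_betwE[OF f(1)] inj_on_eq_iff[OF inj] by (simp add: parcs_complement)
  qed (use assms pair_graph.pair_graph_complement in auto)
qed

text \<open>The model of the permuted list is the model moved along the permutation
  \<open>?f\<close>, and by \<open>complementary\<close> the moved arcs are those of the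
  complement.\<close>

lemma model_self_complementary:
  assumes comp: "complementary m t" and t: "distinct (t [0..<8])" "length (t [0..<8]) = 8" "set (t [0..<8]) = set [0..<8]"
    and m: "m (t [0..<8]) = map (map_prod ((!) (t [0..<8])) ((!) (t [0..<8]))) (m [0..<8])"
  shows "digraph_iso (with_proj (model_graph m)) (with_proj (complement_graph (model_graph m)))"
proof (rule digraph_isoI)
  let ?f = "(!) (t [0..<8])"
  let ?A = "set (model_arcs m)" and ?B = "set (model_arcs (m \<circ> t))"
  show "pair_graph (model_graph m)" by (rule pair_graph_model[OF comp])
  then show "pair_graph (complement_graph (model_graph m))" by (rule pair_graph.pair_graph_complement)
  show bij: "bij_betw ?f (pverts (model_graph m)) (pverts (complement_graph (model_graph m)))"
    by (rule bij_betw_nth[OF t(1)]) (simp_all add: model_graph_def t(2,3) lessThan_atLeast0 del: upt_rec_numeral)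
  have A: "i < 8 \<and> j < 8 \<and> i \<noteq> j \<and> (i, j) \<notin> ?B" if "(i, j) \<in> ?A" for i j
    using comp that by (auto simp: complementary_def list_all_iff)
  have AB: "i = j \<or> (i, j) \<in> ?A \<or> (i, j) \<in> ?B" if "i < 8" "j < 8" for i j
    using comp that by (auto simp: complementary_def list_all_iff)
  have B: "?B = map_prod ?f ?f ` ?A" unfolding model_arcs_def comp_def m by force
  have inj: "?f i = ?f j \<longleftrightarrow> i = j" if "i < 8" "j < 8" for i j
    using that t by (simp add: nth_eq_iff_index_eq)
  fix u v assume "u \<in> pverts (model_graph m)" "v \<in> pverts (model_graph m)"
  then have uv: "u < 8" "v < 8" by (auto simp: model_graph_def)
  have "?f u \<in> set [0..<8]" "?f v \<in> set [0..<8]" using uv t(2,3) nth_mem by metis+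
  then have fuv: "?f u < 8" "?f v < 8" by auto
  have "(?f u, ?f v) \<in> ?B \<longleftrightarrow> (u, v) \<in> ?A"
  proof
    assume "(?f u, ?f v) \<in> ?B"
    then obtain i j where ij: "(i, j) \<in> ?A" "?f u = ?f i" "?f v = ?f j" unfolding B by auto
    then have "u = i" "v = j" using inj uv A by blast+
    then show "(u, v) \<in> ?A" using ij(1) by simp
  next
    assume "(u, v) \<in> ?A"
    then show "(?f u, ?f v) \<in> ?B" unfolding B by force
  qed
  moreover have "(u, v) \<in> ?A \<Longrightarrow> u \<noteq> v" using A by blast
  moreover have "(?f u, ?f v) \<in> ?A \<Longrightarrow> (?f u, ?f v) \<notin> ?B" using A by blast
  ultimately show "(?f u, ?f v) \<in> parcs (complement_graph (model_graph m)) \<longleftrightarrow> (u, v) \<in> parcs (model_graph m)"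
    using AB[OF fuv] fuv inj[OF uv] by (auto simp: parcs_complement model_graph_def)
qed

section \<open>Straight-line drawings checked by orientation\<close>

text \<open>Twice the signed area of the triangle; its sign tells on which side of the line through
  \<open>a\<close> and \<open>b\<close> the point \<open>c\<close> lies. Integer coordinates make it
  computable.\<close>

definition det3 :: "int \<times> int \<Rightarrow> int \<times> int \<Rightarrow> int \<times> int \<Rightarrow> int" where
  "det3 a b c = (fst b - fst a) * (snd c - snd a) - (snd b - snd a) * (fst c - fst a)"

text \<open>A sufficient test for a plane drawing. Keeping all other vertices off the whole line of
  an edge, not just off the segment, also makes edges with a common end meet only there. Edges
  without a common end are apart if the line of one leaves both ends of the other strictly on one
  side.\<close>

definition straight_drawing :: "(int \<times> int) list \<Rightarrow> (nat \<times> nat) list \<Rightarrow> bool" where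
  "straight_drawing P es \<longleftrightarrow> distinct P \<and>
    list_all (\<lambda>(u, v). list_all (\<lambda>w. w = u \<or> w = v \<or> det3 (P ! u) (P ! v) (P ! w) \<noteq> 0) [0..<length P]) es \<and>
    list_all (\<lambda>(u, v). list_all (\<lambda>(x, y). u = x \<or> u = y \<or> v = x \<or> v = y \<or>
      det3 (P ! u) (P ! v) (P ! x) * det3 (P ! u) (P ! v) (P ! y) > 0 \<or>
      det3 (P ! x) (P ! y) (P ! u) * det3 (P ! x) (P ! y) (P ! v) > 0) es) es"

definition cdet :: "complex \<Rightarrow> complex \<Rightarrow> complex \<Rightarrow> real" where
  "cdet a b z = (Re b - Re a) * (Im z - Im a) - (Im b - Im a) * (Re z - Re a)"

text \<open>\<open>cdet a b\<close> is affine in its last argument.\<close>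

lemma cdet_segment:
  assumes "z \<in> closed_segment c d"
  obtains t where "0 \<le> t" "t \<le> 1" "z = c + of_real t * (d - c)" "\<forall>a b. cdet a b z = (1 - t) * cdet a b c + t * cdet a b d"
proof -
  obtain t where t: "0 \<le> t" "t \<le> 1" "z = (1 - t) *\<^sub>R c + t *\<^sub>R d" using assms by (auto simp: in_segment)
  have "z = c + of_real t * (d - c)" using t(3) by (simp add: scaleR_conv_of_real algebra_simps)
  moreover have "cdet a b z = (1 - t) * cdet a b c + t * cdet a b d" for a b
    unfolding t(3) cdet_def by (simp add: algebra_simps)
  ultimately show ?thesis using that t by blast
qed

lemma cdet_segment_same_side:
  assumes "z \<in> closed_segment c d" "cdet a b c * cdet a b d > 0"
  shows "cdet a b z \<noteq> 0"
proof -
  obtain t where t: "0 \<le> t" "t \<le> 1" and eq: "cdet a b z = (1 - t) * cdet a b c + t * cdet a b d"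
    using cdet_segment[OF assms(1)] by metis
  from assms(2) consider "cdet a b c > 0" "cdet a b d > 0" | "cdet a b c < 0" "cdet a b d < 0"
    by (auto simp: zero_less_mult_iff)
  then show ?thesis
  proof cases
    case 1
    \<comment> \<open>\<open>convex_bound_le\<close> gives upper bounds, so the lower bound comes
      from the negated values.\<close>
    then have "min (cdet a b c) (cdet a b d) \<le> cdet a b z"
      unfolding eq using t convex_bound_le[of "- cdet a b c" "- min (cdet a b c) (cdet a b d)" "- cdet a b d" "1 - t" t] by auto
    then show ?thesis using 1 by auto
  next
    case 2
    then have "cdet a b z \<le> max (cdet a b c) (cdet a b d)"
      unfolding eq using t convex_bound_le[of "cdet a b c" "max (cdet a b c) (cdet a b d)" "cdet a b d" "1 - t" t] by auto
    then show ?thesis using 2 by auto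
  qed
qed

lemma cdet_self [simp]: "cdet a b a = 0" "cdet a b b = 0"
  by (simp_all add: cdet_def algebra_simps)

lemma cdet_on_segment: "z \<in> closed_segment a b \<Longrightarrow> cdet a b z = 0"
  by (erule cdet_segment) simp

text \<open>Along the second segment \<open>cdet a b\<close> equals \<open>t * cdet a b d\<close>,
  which vanishes only at \<open>t = 0\<close>, whereas it is constantly 0 on the first.\<close>

lemma segments_common_end:
  assumes "cdet a b d \<noteq> 0"
  shows "closed_segment a b \<inter> closed_segment a d \<subseteq> {a}"
proof
  fix z assume z: "z \<in> closed_segment a b \<inter> closed_segment a d"
  then have "z \<in> closed_segment a d" by simp
  then obtain t where t: "0 \<le> t" "t \<le> 1" "z = a + of_real t * (d - a)"
    "\<forall>a' b'. cdet a' b' z = (1 - t) * cdet a' b' a + t * cdet a' b' d"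
    by (rule cdet_segment)
  have "cdet a b z = 0" using z by (intro cdet_on_segment) simp
  then have "t * cdet a b d = 0" using t(4) by simp
  then show "z \<in> {a}" using assms t(3) by simp
qed

lemma straight_drawing_planar:
  assumes "pair_graph G" "pverts G = set [0..<length P]" "parcs G = set es" "straight_drawing P es"
  shows "planar G"
proof -
  interpret pair_graph G by fact
  define p where "p i = Complex (of_int (fst (P ! i))) (of_int (snd (P ! i)))" for i :: nat
  \<comment> \<open>\<open>Min\<close> and \<open>Max\<close> choose one direction for the curve of
    an unordered pair.\<close>
  define \<gamma> where "\<gamma> e = linepath (p (Min e)) (p (Max e))" for e :: "nat set"
  have img: "path_image (\<gamma> {u, v}) = closed_segment (p u) (p v)" for u v
    by (cases "u \<le> v") (auto simp: \<gamma>_def closed_segment_commute)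
  have det: "cdet (p u) (p v) (p w) = of_int (det3 (P ! u) (P ! v) (P ! w))" for u v w
    by (simp add: cdet_def p_def det3_def)
  have inj: "inj_on p (pverts G)"
    using assms(2,4) by (auto simp: inj_on_def p_def straight_drawing_def nth_eq_iff_index_eq prod_eq_iff[symmetric])
  have free: "cdet (p u) (p v) (p w) \<noteq> 0" if "(u, v) \<in> parcs G" "w \<in> pverts G" "w \<noteq> u" "w \<noteq> v" for u v w
    using assms(2-4) that unfolding det straight_drawing_def list_all_iff by fastforce
  have apart: "closed_segment (p u) (p v) \<inter> closed_segment (p x) (p y) = {}"
    if "(u, v) \<in> parcs G" "(x, y) \<in> parcs G" "{u, v} \<inter> {x, y} = {}" for u v x y
  proof -
    have "det3 (P ! u) (P ! v) (P ! x) * det3 (P ! u) (P ! v) (P ! y) > 0 \<or>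
      det3 (P ! x) (P ! y) (P ! u) * det3 (P ! x) (P ! y) (P ! v) > 0"
      using assms(3,4) that unfolding straight_drawing_def list_all_iff by fastforce
    then have "cdet (p u) (p v) (p x) * cdet (p u) (p v) (p y) > 0 \<or> cdet (p x) (p y) (p u) * cdet (p x) (p y) (p v) > 0"
      unfolding det of_int_mult[symmetric] of_int_0_less_iff .
    then show ?thesis using cdet_segment_same_side cdet_on_segment by blast
  qed
  have fan: "closed_segment (p u) (p v) \<inter> closed_segment (p u) (p w) \<subseteq> {p u}"
    if "(u, v) \<in> parcs G" "(u, w) \<in> parcs G" "v \<noteq> w" for u v w
  proof (rule segments_common_end, rule free[OF that(1)])
    show "w \<in> pverts G" "w \<noteq> u" "w \<noteq> v" using that wellformed' no_loop by blast+
  qed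
  have "plane_embedding G p \<gamma>"
    unfolding plane_embedding_def
  proof (intro conjI ballI; clarify?)
    show "inj_on p (pverts G)" by (rule inj)
  next
    fix u v assume uv: "(u, v) \<in> parcs G"
    then have ne: "u \<noteq> v" "u \<in> pverts G" "v \<in> pverts G" using no_loop wellformed' by blast+
    then have pne: "p u \<noteq> p v" using inj by (auto dest: inj_onD)
    have "closed_segment (p u) (p v) \<inter> p ` pverts G \<subseteq> {p u, p v}"
      using free[OF uv] cdet_on_segment by fastforce
    then show "Path_Connected.arc (\<gamma> {u, v}) \<and> {pathstart (\<gamma> {u, v}), pathfinish (\<gamma> {u, v})} = {p u, p v} \<and>
        path_image (\<gamma> {u, v}) \<inter> p ` pverts G = {p u, p v}"
      unfolding img using ne pne by (cases "u \<le> v") (auto simp: \<gamma>_def intro!: arc_linepath)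
  next
    fix u v x y z assume uv: "(u, v) \<in> parcs G" and xy: "(x, y) \<in> parcs G" and ne: "{u, v} \<noteq> {x, y}"
      and z: "z \<in> path_image (\<gamma> {u, v})" "z \<in> path_image (\<gamma> {x, y})"
    have z': "z \<in> closed_segment (p u) (p v)" "z \<in> closed_segment (p x) (p y)"
      "z \<in> closed_segment (p v) (p u)" "z \<in> closed_segment (p y) (p x)"
      using z unfolding img by (simp_all add: closed_segment_commute)
    have vu: "(v, u) \<in> parcs G" "(y, x) \<in> parcs G" using uv xy arc_commute by blast+
    consider "{u, v} \<inter> {x, y} = {}" | "u = x" "v \<noteq> y" | "u = y" "v \<noteq> x" | "v = x" "u \<noteq> y" | "v = y" "u \<noteq> x"
      using ne by blast
    then show "z \<in> p ` ({u, v} \<inter> {x, y})"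
    proof cases
      case 1 then show ?thesis using apart[OF uv xy] z' by blast
    next
      case 2 then show ?thesis using fan[OF uv, of y] xy z' by auto
    next
      case 3 then show ?thesis using fan[OF uv, of x] vu z' by auto
    next
      case 4 then show ?thesis using fan[OF vu(1), of y] xy z' by auto
    next
      case 5 then show ?thesis using fan[OF vu(1), of x] vu z' by auto
    qed
  qed
  then show ?thesis unfolding planar_def by blast
qed

section \<open>Three-connectedness checked by search\<close>

text \<open>Filtering \<open>W\<close> keeps its order, so a completed search can be recognised by
  equality of lists.\<close>

definition grow :: "(nat \<times> nat) list \<Rightarrow> nat list \<Rightarrow> nat list \<Rightarrow> nat list" where
  "grow es W A = filter (\<lambda>w. w \<in> set A \<or> list_ex (\<lambda>u. (u, w) \<in> set es) A) W"

text \<open>A sufficient test for connectivity: four rounds of search from the first vertex reach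
  all of \<open>W\<close>. Four rounds suffice for the models and their deletions, as
  \<open>triply_spanned_models\<close> confirms.\<close>

definition spanned :: "(nat \<times> nat) list \<Rightarrow> nat list \<Rightarrow> bool" where
  "spanned es W \<longleftrightarrow> W \<noteq> [] \<and> grow es W (grow es W (grow es W (grow es W [hd W]))) = W"

text \<open>The range of \<open>y\<close> starts at \<open>x\<close> itself, so the deletion of a
  single vertex is included as \<open>y = x\<close>.\<close>

definition triply_spanned :: "(nat \<times> nat) list \<Rightarrow> bool" where
  "triply_spanned es \<longleftrightarrow> spanned es [0..<8] \<and>
    list_all (\<lambda>x. list_all (\<lambda>y. spanned es (filter (\<lambda>w. w \<noteq> x \<and> w \<noteq> y) [0..<8])) [x..<8]) [0..<8]"

lemma spanned_connected:
  assumes "pair_graph G" "parcs G = set es" "spanned es W" "set W \<subseteq> pverts G"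
  shows "Digraph_Component.connected (with_proj G \<restriction> set W)"
proof -
  interpret pair_graph G by fact
  have W: "W \<noteq> []" and span: "grow es W (grow es W (grow es W (grow es W [hd W]))) = W"
    using assms(3) by (auto simp: spanned_def)
  have "\<exists>u \<in> P. \<exists>v \<in> set W - P. (u, v) \<in> parcs G" if P: "P \<subseteq> set W" "P \<noteq> {}" "P \<noteq> set W" for P
  proof (rule ccontr)
    assume no: "\<not> ?thesis"
    \<comment> \<open>\<open>C\<close> is the side of the cut that contains the starting point. No
      edge leaves it in either case, since arcs are symmetric, so the search never gets to the other
      side.\<close>
    define C where "C = (if hd W \<in> P then P else set W - P)"
    have "w \<in> C" if "u \<in> C" "w \<in> set W" "(u, w) \<in> set es" for u w
      using that no P(1) arc_commute[of u w] assms(2) by (auto simp: C_def split: if_splits)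
    then have grow: "set (grow es W A) \<subseteq> C" if "set A \<subseteq> C" for A
      using that by (auto simp: grow_def list_ex_iff)
    have "set [hd W] \<subseteq> C" using W by (simp add: C_def)
    then have "set (grow es W (grow es W (grow es W (grow es W [hd W])))) \<subseteq> C" by (intro grow)
    then have "set W \<subseteq> C" unfolding span .
    then show False using P by (auto simp: C_def split: if_splits)
  qed
  then show ?thesis using connected_induce_iff[OF assms(4)] W by simp
qed

lemma triply_spanned_three_connected:
  assumes "pair_graph G" "pverts G = set [0..<8]" "parcs G = set es" "triply_spanned es"
  shows "three_connected G"
proof -
  have "Digraph_Component.connected (with_proj G \<restriction> (pverts G - S))" if S: "S \<subseteq> pverts G" "card S \<le> 2" for S
  proof -
    have "finite S" using S(1) assms(2) finite_subset by auto
    consider "S = {}" | x y where "S = {x, y}" "x \<le> y" "y < 8"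
    proof -
      from S(2) consider "card S = 0" | "card S = 1" | "card S = 2" by linarith
      then show ?thesis
      proof cases
        case 1 then show ?thesis using that(1) \<open>finite S\<close> by simp
      next
        case 2
        then obtain x where "S = {x}" by (auto simp: card_1_singleton_iff)
        then show ?thesis using that(2)[of x x] S(1) assms(2) by simp
      next
        case 3
        then obtain x y where xy: "S = {x, y}" by (auto simp: card_2_iff)
        show ?thesis
          using that(2)[of x y] that(2)[of y x] xy S(1) assms(2) by (cases "x \<le> y") (auto simp: insert_commute)
      qed
    qed
    then show ?thesis
    proof cases
      case 1
      then show ?thesis
        using spanned_connected[OF assms(1,3), of "[0..<8]"] assms(2,4) by (simp add: triply_spanned_def)
    next
      case 2
      let ?W = "filter (\<lambda>w. w \<noteq> x \<and> w \<noteq> y) [0..<8]"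
      have "spanned es ?W" using assms(4) 2 by (simp add: triply_spanned_def list_all_iff)
      moreover have "set ?W = pverts G - S" unfolding set_filter assms(2) 2(1) by blast
      ultimately show ?thesis using spanned_connected[OF assms(1,3), of ?W] by auto
    qed
  qed
  then show ?thesis unfolding three_connected_def using assms(2) by simp
qed

section \<open>An invariant that separates the models\<close>

text \<open>Degrees do not separate the models: each has four vertices of degree 3 and four of
  degree 4. The pairs counted are ordered.\<close>

definition common_two :: "'a pair_pre_digraph \<Rightarrow> nat" where
  "common_two G = card {(u, v). u \<in> pverts G \<and> v \<in> pverts G \<and>
    card {w \<in> pverts G. (u, w) \<in> parcs G \<and> (v, w) \<in> parcs G} = 2}"

lemma common_two_iso:
  assumes "digraph_iso (with_proj G) (with_proj H)"
  shows "common_two G = common_two H"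
proof -
  obtain f where f: "bij_betw f (pverts G) (pverts H)"
    "\<And>u v. u \<in> pverts G \<Longrightarrow> v \<in> pverts G \<Longrightarrow> (f u, f v) \<in> parcs H \<longleftrightarrow> (u, v) \<in> parcs G"
    using digraph_isoE[OF assms] by blast
  have inj: "inj_on f (pverts G)" and img: "f ` pverts G = pverts H" using f(1) by (auto simp: bij_betw_def)
  have common: "card {w \<in> pverts H. (f u, w) \<in> parcs H \<and> (f v, w) \<in> parcs H} =
      card {w \<in> pverts G. (u, w) \<in> parcs G \<and> (v, w) \<in> parcs G}" if "u \<in> pverts G" "v \<in> pverts G" for u v
  proof -
    have "{w \<in> pverts H. (f u, w) \<in> parcs H \<and> (f v, w) \<in> parcs H} =
        f ` {w \<in> pverts G. (u, w) \<in> parcs G \<and> (v, w) \<in> parcs G}"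
      unfolding img[symmetric] using f(2) that by auto
    moreover have "inj_on f {w \<in> pverts G. (u, w) \<in> parcs G \<and> (v, w) \<in> parcs G}"
      using inj by (rule inj_on_subset) auto
    ultimately show ?thesis by (simp only: card_image)
  qed
  let ?S = "{(u, v). u \<in> pverts G \<and> v \<in> pverts G \<and> card {w \<in> pverts G. (u, w) \<in> parcs G \<and> (v, w) \<in> parcs G} = 2}"
  let ?T = "{(u, v). u \<in> pverts H \<and> v \<in> pverts H \<and> card {w \<in> pverts H. (u, w) \<in> parcs H \<and> (v, w) \<in> parcs H} = 2}"
  have "map_prod f f ` ?S = ?T"
  proof (intro set_eqI iffI)
    fix e assume "e \<in> map_prod f f ` ?S"
    then show "e \<in> ?T" using common img by auto
  next
    fix e assume "e \<in> ?T"
    then obtain a b where ab: "e = (a, b)" "a \<in> f ` pverts G" "b \<in> f ` pverts G"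
      "card {w \<in> pverts H. (a, w) \<in> parcs H \<and> (b, w) \<in> parcs H} = 2" using img by auto
    then obtain u v where uv: "u \<in> pverts G" "v \<in> pverts G" "a = f u" "b = f v" by blast
    then have "(u, v) \<in> ?S" using common ab(4) by simp
    then show "e \<in> map_prod f f ` ?S" using ab(1) uv(3,4) by force
  qed
  moreover have "inj_on (map_prod f f) ?S" using inj by (auto simp: inj_on_def)
  ultimately show ?thesis unfolding common_two_def by (metis (lifting) card_image)
qed

definition count_common_two :: "(nat \<times> nat) list \<Rightarrow> nat" where
  "count_common_two es = length (filter (\<lambda>(u, v).
    length (filter (\<lambda>w. (u, w) \<in> set es \<and> (v, w) \<in> set es) [0..<8]) = 2) (List.product [0..<8] [0..<8]))"

lemma common_two_model: "common_two (model_graph m) = count_common_two (model_arcs m)"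
proof -
  have "card {w \<in> set [0..<8]. (u, w) \<in> set es \<and> (v, w) \<in> set es} =
      length (filter (\<lambda>w. (u, w) \<in> set es \<and> (v, w) \<in> set es) [0..<8])" for u v and es :: "(nat \<times> nat) list"
    unfolding set_filter[symmetric] by (rule distinct_card) simp
  then have "common_two (model_graph m) = card (set (filter (\<lambda>(u, v).
      length (filter (\<lambda>w. (u, w) \<in> set (model_arcs m) \<and> (v, w) \<in> set (model_arcs m)) [0..<8]) = 2)
      (List.product [0..<8] [0..<8])))"
    unfolding common_two_def model_graph_def by (intro arg_cong[of _ _ card]) auto
  also have "\<dots> = count_common_two (model_arcs m)"
    unfolding count_common_two_def by (rule distinct_card) (simp add: distinct_product)
  finally show ?thesis .
qed

lemma count_common_two_models:
  "count_common_two (model_arcs model1) = 12"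
  "count_common_two (model_arcs model2) = 28"
  "count_common_two (model_arcs model3) = 20"
  by code_simp+

lemma triply_spanned_models:
  "triply_spanned (model_arcs model1)" "triply_spanned (model_arcs model2)" "triply_spanned (model_arcs model3)"
  by code_simp+

lemma straight_drawing_models:
  "straight_drawing [(4, 2), (4, 1), (5, 5), (3, 2), (3, 0), (0, 4), (2, 4), (1, 3)] (model_arcs model1)"
  "straight_drawing [(1, 3), (3, 3), (1, 2), (0, 5), (4, 2), (5, 5), (0, 1), (5, 0)] (model_arcs model2)"
  "straight_drawing [(5, 5), (4, 0), (0, 5), (3, 4), (1, 0), (3, 1), (1, 2), (2, 1)] (model_arcs model3)"
  by code_simp+

lemma pverts_model [simp]: "pverts (model_graph m) = set [0..<8]" and parcs_model [simp]: "parcs (model_graph m) = set (model_arcs m)"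
  by (simp_all only: model_graph_def pair_pre_digraph.select_convs)

text \<open>Drawing and connectivity are tested for the model only; its complement inherits both
  through the isomorphism.\<close>

lemma polyhedral_model:
  assumes "complementary m t" "straight_drawing P (model_arcs m)" "length P = 8" "triply_spanned (model_arcs m)"
    and iso: "digraph_iso (with_proj (model_graph m)) (with_proj (complement_graph (model_graph m)))"
  shows "polyhedral (model_graph m) \<and> polyhedral (complement_graph (model_graph m))"
proof -
  have g: "pair_graph (model_graph m)" by (rule pair_graph_model[OF assms(1)])
  then have cg: "pair_graph (complement_graph (model_graph m))" by (rule pair_graph.pair_graph_complement)
  have p: "planar (model_graph m)"
    using straight_drawing_planar[OF g, of P "model_arcs m"] assms(2,3) by (simp del: upt_rec_numeral)
  have c: "three_connected (model_graph m)"
    using triply_spanned_three_connected[OF g, of "model_arcs m"] assms(4) by (simp del: upt_rec_numeral)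
  have "wf_digraph (with_proj (model_graph m))"
    using g by (simp add: wf_digraph_wp_iff pair_graph_def pair_digraph_def pair_fin_digraph_def)
  then have iso': "digraph_iso (with_proj (complement_graph (model_graph m))) (with_proj (model_graph m))"
    using iso by (rule digraph_iso_swap)
  show ?thesis
    unfolding polyhedral_def using g cg p c planar_iso[OF cg iso' p] three_connected_iso[OF cg g iso' c] by blast
qed

lemma models_self_complementary:
  "digraph_iso (with_proj (model_graph model1)) (with_proj (complement_graph (model_graph model1)))"
  "digraph_iso (with_proj (model_graph model2)) (with_proj (complement_graph (model_graph model2)))"
  "digraph_iso (with_proj (model_graph model3)) (with_proj (complement_graph (model_graph model3)))"
proof -
  show "digraph_iso (with_proj (model_graph model1)) (with_proj (complement_graph (model_graph model1)))"
    by (rule model_self_complementary[OF complementary_models(1)]; code_simp)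
  show "digraph_iso (with_proj (model_graph model2)) (with_proj (complement_graph (model_graph model2)))"
    by (rule model_self_complementary[OF complementary_models(2)]; code_simp)
  show "digraph_iso (with_proj (model_graph model3)) (with_proj (complement_graph (model_graph model3)))"
    by (rule model_self_complementary[OF complementary_models(3)]; code_simp)
qed

lemma labelled_imp_iso:
  assumes "pair_graph G"
  shows "labelled model1 twist1 G ys \<Longrightarrow> digraph_iso (with_proj G) (with_proj (model_graph model1))"
    "labelled model2 twist2 G ys \<Longrightarrow> digraph_iso (with_proj G) (with_proj (model_graph model2))"
    "labelled model3 twist3 G ys \<Longrightarrow> digraph_iso (with_proj G) (with_proj (model_graph model3))"
proof -
  \<comment> \<open>Writing \<open>ys\<close> as the image of \<open>[0..<8]\<close> turns the
    naturality rules \<open>model_map\<close> into the equations that \<open>labelled_iso\<close>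
    asks for.\<close>
  have ys: "ys = map ((!) ys) [0..<8]" if "labelled m t G ys" for m t
    using that map_nth[of ys] by (simp add: labelled_def del: upt_rec_numeral)
  have len: "length [0..<8::nat] = 8" by simp
  show "digraph_iso (with_proj G) (with_proj (model_graph model1))" if "labelled model1 twist1 G ys"
    by (rule labelled_iso[OF assms complementary_models(1) that])
      (subst ys[OF that], simp only: model_map[OF len] model_map(1)[OF model_map(3)[OF len]])+
  show "digraph_iso (with_proj G) (with_proj (model_graph model2))" if "labelled model2 twist2 G ys"
    by (rule labelled_iso[OF assms complementary_models(2) that])
      (subst ys[OF that], simp only: model_map[OF len] model_map(4)[OF model_map(6)[OF len]])+
  show "digraph_iso (with_proj G) (with_proj (model_graph model3))" if "labelled model3 twist3 G ys"
    by (rule labelled_iso[OF assms complementary_models(3) that])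
      (subst ys[OF that], simp only: model_map[OF len] model_map(7)[OF model_map(9)[OF len]])+
qed

text \<open>Both degrees of a vertex are at least 3 and they add up to 7, so one of them is 3. If it
  is the blue one, the complement of \<open>G\<close> is isomorphic to a model; taking complements
  and using that the model is self-complementary leads back to \<open>G\<close>.\<close>

lemma bipolyhedral_iso_model:
  fixes G :: "'a pair_pre_digraph"
  assumes "bipolyhedral G"
  shows "\<exists>H \<in> {model_graph model1, model_graph model2, model_graph model3}. digraph_iso (with_proj G) (with_proj H)"
proof -
  interpret bipolyhedral G by fact
  interpret co: bipolyhedral "complement_graph G" by (rule bipolyhedral_complement)
  have G: "pair_graph G" and coG: "pair_graph (complement_graph G)" by unfold_locales
  obtain v where v: "v \<in> pverts G" using order_eq_eight by fastforce
  have "3 \<le> card {w \<in> pverts G. (v, w) \<in> parcs G}" "3 \<le> card {w \<in> pverts G. (v, w) \<in> parcs (complement_graph G)}"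
    using three_connected_degree[OF conn v] co.three_connected_degree[OF coconn] v by simp_all
  then consider "card {w \<in> pverts G. (v, w) \<in> parcs G} = 3" | "card {w \<in> pverts G. (v, w) \<in> parcs (complement_graph G)} = 3"
    using degree_codegree[OF v] order_eq_eight by linarith
  then show ?thesis
  proof cases
    case 1
    then show ?thesis using labelling_of_degree_three[OF v] labelled_imp_iso[OF G] by blast
  next
    case 2
    then obtain ys where "labelled model1 twist1 (complement_graph G) ys \<or>
        labelled model2 twist2 (complement_graph G) ys \<or> labelled model3 twist3 (complement_graph G) ys"
      using co.labelling_of_degree_three[of v] v by auto
    then obtain H where H: "H \<in> {model_graph model1, model_graph model2, model_graph model3}"
      "digraph_iso (with_proj (complement_graph G)) (with_proj H)"
      using labelled_imp_iso[OF coG] by blast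
    have gH: "pair_graph H" using H(1) complementary_models pair_graph_model by blast
    then have "wf_digraph (with_proj H)"
      by (simp add: wf_digraph_wp_iff pair_graph_def pair_digraph_def pair_fin_digraph_def)
    moreover have "digraph_iso (with_proj H) (with_proj (complement_graph H))"
      using H(1) models_self_complementary by blast
    ultimately have "digraph_iso (with_proj (complement_graph H)) (with_proj H)" by (rule digraph_iso_swap)
    moreover have "digraph_iso (with_proj G) (with_proj (complement_graph H))"
      using digraph_iso_complement[OF coG gH H(2)] by (simp add: complement_complement)
    ultimately have "digraph_iso (with_proj G) (with_proj H)" by (rule digraph_iso_trans[rotated])
    then show ?thesis using H(1) by blast
  qed
qed

theorem theorem1:
  shows "\<exists>\<G> :: nat pair_pre_digraph set.
    card \<G> = 3 \<and>
    (\<forall>G \<in> \<G>. polyhedral G \<and> polyhedral (complement_graph G)) \<and>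
    (\<forall>G \<in> \<G>. \<forall>H \<in> \<G>. digraph_iso (with_proj G) (with_proj H) \<longrightarrow> G = H) \<and>
    (\<forall>G :: 'a pair_pre_digraph. polyhedral G \<and> polyhedral (complement_graph G) \<longrightarrow>
      (\<exists>H \<in> \<G>. digraph_iso (with_proj G) (with_proj H))) \<and>
    (\<forall>G \<in> \<G>. digraph_iso (with_proj G) (with_proj (complement_graph G)))"
proof -
  let ?S = "{model_graph model1, model_graph model2, model_graph model3}"
  note common = common_two_model[of model1] common_two_model[of model2] common_two_model[of model3]
  \<comment> \<open>The three distinct values of the invariant show at once that the set has three
    elements and that these are pairwise not isomorphic.\<close>
  have "inj_on common_two ?S" "card (common_two ` ?S) = 3"
    by (auto simp: common count_common_two_models inj_on_def)
  then have "card ?S = 3" by (simp only: card_image)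
  moreover have "polyhedral G \<and> polyhedral (complement_graph G)" if "G \<in> ?S" for G
    using that polyhedral_model[OF complementary_models(1) straight_drawing_models(1) _ triply_spanned_models(1) models_self_complementary(1)]
      polyhedral_model[OF complementary_models(2) straight_drawing_models(2) _ triply_spanned_models(2) models_self_complementary(2)]
      polyhedral_model[OF complementary_models(3) straight_drawing_models(3) _ triply_spanned_models(3) models_self_complementary(3)]
    by auto
  moreover have "G = H" if "G \<in> ?S" "H \<in> ?S" "digraph_iso (with_proj G) (with_proj H)" for G H
    using \<open>inj_on common_two ?S\<close> common_two_iso[OF that(3)] that(1,2) by (rule inj_onD)
  moreover have "\<exists>H \<in> ?S. digraph_iso (with_proj G) (with_proj H)"
    if "polyhedral G" "polyhedral (complement_graph G)" for G :: "'a pair_pre_digraph"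
    using that by (intro bipolyhedral_iso_model)
      (simp add: polyhedral_def bipolyhedral_def bipolyhedral_axioms_def biplanar_def biplanar_axioms_def)
  moreover have "digraph_iso (with_proj G) (with_proj (complement_graph G))" if "G \<in> ?S" for G
    using that models_self_complementary by blast
  ultimately show ?thesis by (intro exI[of _ ?S]) blast
qed

end
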